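(* Let $\Omega$ be a bounded multiply connected region of connectivity $M+1$ with parametrized boundary $\Gamma$ as in the context, let $f$ be the Ahlfors map of $\Omega$ with respect to a point $a_0\in\Omega$, let $a_0,a_1,\dots,a_M\in\Omega$ be the zeros of $f$ (listed with multiplicity), and let $\theta(t)$ be its boundary correspondence function, so that $f(z(t))=e^{\mathrm{i}\theta(t)}$ for $t\in J$. Then for all $t\in J$ $$\theta'(t)+\int_J N^*(t,s)\,\theta'(s)\,ds=\phi(t),\qquad \phi(t):=2\,\mathrm{Im}\left[\sum_{j=0}^{M}\frac{z'(t)}{z(t)-a_j}\right].$$ Moreover $\mathbf{J}\theta'=\psi$, where $\psi(t)=0$ for $t\in J_0$ and $\psi(t)=1$ for $t\in J_j$, $j=1,\dots,M$, and consequently $$(\mathbf{I}+\mathbf{N}^*+\mathbf{J})\,\theta'=\phi+\psi .$$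
   Context: Setting. $\Omega\subset\mathbb{C}$ is a bounded region whose boundary $\Gamma=\Gamma_0\cup\Gamma_1\cup\dots\cup\Gamma_M$ consists of $M+1$ disjoint smooth Jordan curves, with $\Gamma_1,\dots,\Gamma_M$ in the interior of $\Gamma_0$. The outer curve $\Gamma_0$ is oriented counterclockwise and $\Gamma_1,\dots,\Gamma_M$ clockwise, so that $\Omega$ lies to the left. Each $\Gamma_j$ is parametrized, in the direction of its orientation, by a $2\pi$-periodic three times continuously differentiable function $z_j(t)$, $t\in J_j=[0,2\pi]$, with $z_j'(t)\neq 0$. $J$ is the disjoint union of the intervals $J_0,\dots,J_M$, and $z(t)=z_j(t)$ for $t\in J_j$. Integration over $J$ means the sum of the integrals over $J_0,\dots,J_M$. Ahlfors map. For $a_0\in\Omega$, the Ahlfors map $f$ is the unique analytic function from $\Omega$ into the unit disk $D$ with $f(a_0)=0$, $f'(a_0)>0$ and $f'(a_0)$ maximal among all analytic maps $h:\Omega\to D$ with $h(a_0)=0$ and $h'(a_0)>0$. It maps $\Omega$ onto $D$ in an $(M+1)$-to-one fashion, extends to $\Gamma$ and maps each $\Gamma_j$ one-to-one onto the unit circle. The boundary correspondence function $\theta$ is a real function on $J$, differentiable on each $J_j$, with $f(z(t))=e^{\mathrm{i}\theta(t)}$; equivalently $\dfrac{f'(z(t))z'(t)}{f(z(t))}=\mathrm{i}\theta'(t)$. Kernels and operators. $N^*(t,s)=\frac1\pi\,\mathrm{Im}\left(\frac{z'(t)}{z(t)-z(s)}\right)$ for $t\ne s$, and $N^*(t,t)=\frac{1}{2\pi}\mathrm{Im}\left(\frac{z''(t)}{z'(t)}\right)$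 (the adjoint of the classical Neumann kernel). $\mathbf{N}^*\nu(t)=\int_J N^*(t,s)\nu(s)\,ds$. $\mathbf{J}\nu(t)=\int_J\frac{1}{2\pi}\sum_{j=1}^M\chi^{[j]}(s)\chi^{[j]}(t)\nu(s)\,ds$, where $\chi^{[j]}$ is $1$ on $J_j$ and $0$ on the other $J_k$. $\mathbf{I}$ is the identity. *)

theory Defs
  imports "HOL-Complex_Analysis.Complex_Analysis"
begin

text \<open>
  The boundary curves are \<open>z j\<close> for \<open>j \<le> M\<close>, each a \<open>2 * pi\<close>-periodic function on the whole
  real line. The library's notions for paths use the parameter interval \<open>[0,1]\<close>, hence the
  rescaling in \<open>bdry_path\<close>.
\<close>

definition bdry_path :: "(real \<Rightarrow> complex) \<Rightarrow> real \<Rightarrow> complex" where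
  "bdry_path g = (\<lambda>x. g (2 * pi * x))"

definition vderiv :: "(real \<Rightarrow> complex) \<Rightarrow> real \<Rightarrow> complex" where
  "vderiv g = (\<lambda>t. vector_derivative g (at t))"

definition C3 :: "(real \<Rightarrow> complex) \<Rightarrow> bool" where
  "C3 g \<longleftrightarrow> g C1_differentiable_on UNIV \<and> vderiv g C1_differentiable_on UNIV
     \<and> vderiv (vderiv g) C1_differentiable_on UNIV"

definition smooth_jordan_param :: "(real \<Rightarrow> complex) \<Rightarrow> bool" where
  "smooth_jordan_param g \<longleftrightarrow> C3 g \<and> (\<forall>t. g (t + 2 * pi) = g t) \<and> (\<forall>t. vderiv g t \<noteq> 0)
     \<and> simple_path (bdry_path g)"

text \<open>
  Orientation is expressed by winding numbers about the points enclosed by the curve: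
  \<open>1\<close> is counterclockwise and \<open>-1\<close> is clockwise.
\<close>

definition bounded_mc_region :: "complex set \<Rightarrow> nat \<Rightarrow> (nat \<Rightarrow> real \<Rightarrow> complex) \<Rightarrow> bool" where
  "bounded_mc_region \<Omega> M z \<longleftrightarrow>
     open \<Omega> \<and> connected \<Omega> \<and> \<Omega> \<noteq> {} \<and> bounded \<Omega>
   \<and> (\<forall>j\<le>M. smooth_jordan_param (z j))
   \<and> frontier \<Omega> = (\<Union>j\<le>M. path_image (bdry_path (z j)))
   \<and> (\<forall>j\<le>M. \<forall>k\<le>M. j \<noteq> k \<longrightarrow> path_image (bdry_path (z j)) \<inter> path_image (bdry_path (z k)) = {})
   \<and> (\<forall>j\<in>{1..M}. path_image (bdry_path (z j)) \<subseteq> inside (path_image (bdry_path (z 0))))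
   \<and> (\<forall>w\<in>inside (path_image (bdry_path (z 0))). winding_number (bdry_path (z 0)) w = 1)
   \<and> (\<forall>j\<in>{1..M}. \<forall>w\<in>inside (path_image (bdry_path (z j))).
        winding_number (bdry_path (z j)) w = - 1)"

definition ahlfors_candidate :: "complex set \<Rightarrow> complex \<Rightarrow> (complex \<Rightarrow> complex) \<Rightarrow> bool" where
  "ahlfors_candidate \<Omega> a h \<longleftrightarrow> h holomorphic_on \<Omega> \<and> h ` \<Omega> \<subseteq> ball 0 1 \<and> h a = 0
     \<and> deriv h a \<in> \<real> \<and> Re (deriv h a) > 0"

definition ahlfors_map :: "complex set \<Rightarrow> complex \<Rightarrow> (complex \<Rightarrow> complex) \<Rightarrow> bool" where
  "ahlfors_map \<Omega> a f \<longleftrightarrow> ahlfors_candidate \<Omega> a f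
     \<and> (\<forall>h. ahlfors_candidate \<Omega> a h \<longrightarrow> Re (deriv h a) \<le> Re (deriv f a))"

text \<open>
  \<open>a 0, \<dots>, a M\<close> lists the zeros of \<open>f\<close> in \<open>\<Omega>\<close>, each as often as its multiplicity.
  For \<open>f\<close> holomorphic and not identically zero near \<open>w\<close>, \<open>zorder f w\<close> is the multiplicity of the
  zero at \<open>w\<close>, and it is \<open>0\<close> if \<open>f w \<noteq> 0\<close>.
\<close>

definition lists_zeros :: "complex set \<Rightarrow> nat \<Rightarrow> (complex \<Rightarrow> complex) \<Rightarrow> (nat \<Rightarrow> complex) \<Rightarrow> bool" where
  "lists_zeros \<Omega> M f a \<longleftrightarrow> (\<forall>j\<le>M. a j \<in> \<Omega>)
     \<and> (\<forall>w\<in>\<Omega>. int (card {j. j \<le> M \<and> a j = w}) = zorder f w)"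

text \<open>
  The disjoint union \<open>J\<close> of the parameter intervals consists of pairs \<open>(j, t)\<close>. Functions on \<open>J\<close>
  are functions on \<open>nat \<times> real\<close>; their values off \<open>J\<close> are never used.
\<close>

definition J_set :: "nat \<Rightarrow> (nat \<times> real) set" where
  "J_set M = {..M} \<times> {0..2 * pi}"

definition integrable_J :: "nat \<Rightarrow> (nat \<times> real \<Rightarrow> real) \<Rightarrow> bool" where
  "integrable_J M \<nu> \<longleftrightarrow> (\<forall>k\<le>M. (\<lambda>s. \<nu> (k, s)) integrable_on {0..2 * pi})"

definition integral_J :: "nat \<Rightarrow> (nat \<times> real \<Rightarrow> real) \<Rightarrow> real" where
  "integral_J M \<nu> = (\<Sum>k\<le>M. integral {0..2 * pi} (\<lambda>s. \<nu> (k, s)))"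

definition zJ :: "(nat \<Rightarrow> real \<Rightarrow> complex) \<Rightarrow> nat \<times> real \<Rightarrow> complex" where
  "zJ z p = z (fst p) (snd p)"

definition zJ' :: "(nat \<Rightarrow> real \<Rightarrow> complex) \<Rightarrow> nat \<times> real \<Rightarrow> complex" where
  "zJ' z p = vderiv (z (fst p)) (snd p)"

definition zJ'' :: "(nat \<Rightarrow> real \<Rightarrow> complex) \<Rightarrow> nat \<times> real \<Rightarrow> complex" where
  "zJ'' z p = vderiv (vderiv (z (fst p))) (snd p)"

text \<open>
  The derivative of a function on \<open>J\<close>, one-sided at the end points of the intervals.
\<close>

definition derivJ :: "(nat \<times> real \<Rightarrow> real) \<Rightarrow> nat \<times> real \<Rightarrow> real" where
  "derivJ \<theta> p = vector_derivative (\<lambda>s. \<theta> (fst p, s)) (at (snd p) within {0..2 * pi})"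

text \<open>
  On \<open>\<Gamma>\<close> the Ahlfors map is understood through its boundary values, that is, its limits from
  within \<open>\<Omega>\<close>; values that the total function \<open>f\<close> happens to take off \<open>\<Omega>\<close> play no role.
\<close>

definition boundary_correspondence ::
    "complex set \<Rightarrow> nat \<Rightarrow> (nat \<Rightarrow> real \<Rightarrow> complex) \<Rightarrow> (complex \<Rightarrow> complex) \<Rightarrow> (nat \<times> real \<Rightarrow> real) \<Rightarrow> bool"
  where
  "boundary_correspondence \<Omega> M z f \<theta> \<longleftrightarrow>
     (\<forall>j\<le>M. (\<lambda>t. \<theta> (j, t)) differentiable_on {0..2 * pi})
   \<and> (\<forall>p\<in>J_set M. (f \<longlongrightarrow> exp (\<i> * complex_of_real (\<theta> p))) (at (zJ z p) within \<Omega>))"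

text \<open>
  The parameters \<open>0\<close> and \<open>2 * pi\<close> of one curve give the same boundary point, so there the first
  formula divides by zero. This affects at most one \<open>s\<close> for each \<open>t\<close> and hence no integral.
\<close>

definition Nstar :: "(nat \<Rightarrow> real \<Rightarrow> complex) \<Rightarrow> nat \<times> real \<Rightarrow> nat \<times> real \<Rightarrow> real" where
  "Nstar z p q =
     (if p = q then 1 / (2 * pi) * Im (zJ'' z p / zJ' z p)
      else 1 / pi * Im (zJ' z p / (zJ z p - zJ z q)))"

definition Nstar_op ::
    "nat \<Rightarrow> (nat \<Rightarrow> real \<Rightarrow> complex) \<Rightarrow> (nat \<times> real \<Rightarrow> real) \<Rightarrow> nat \<times> real \<Rightarrow> real" where
  "Nstar_op M z \<nu> p = integral_J M (\<lambda>q. Nstar z p q * \<nu> q)"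

definition chi :: "nat \<Rightarrow> nat \<times> real \<Rightarrow> real" where
  "chi j p = (if fst p = j then 1 else 0)"

definition J_op :: "nat \<Rightarrow> (nat \<times> real \<Rightarrow> real) \<Rightarrow> nat \<times> real \<Rightarrow> real" where
  "J_op M \<nu> p = integral_J M (\<lambda>q. 1 / (2 * pi) * (\<Sum>j=1..M. chi j q * chi j p * \<nu> q))"

definition phi ::
    "nat \<Rightarrow> (nat \<Rightarrow> real \<Rightarrow> complex) \<Rightarrow> (nat \<Rightarrow> complex) \<Rightarrow> nat \<times> real \<Rightarrow> real" where
  "phi M z a p = 2 * Im (\<Sum>j=0..M. zJ' z p / (zJ z p - a j))"

definition psi :: "nat \<times> real \<Rightarrow> real" where
  "psi p = (if fst p = 0 then 0 else 1)"

end

theory Submission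
  imports Defs "HOL-Real_Asymp.Real_Asymp"
begin

text \<open>
  On the boundary \<open>f\<close> is \<open>exp (\<i> * \<theta>)\<close>, so \<open>f' / f\<close> has boundary differential \<open>\<i> * \<theta>'(s) ds\<close>. Cauchy's theorem on
  curves offset into \<open>\<Omega>\<close>, followed by an integration by parts and a limit, evaluates the Cauchy transform
  \<open>\<Sum>\<^sub>k \<integral> \<theta>'(s) / (z\<^sub>k(s) - w) ds\<close>: it is \<open>2 * pi * (f'(w) / f(w) - \<Sum>\<^sub>k 1 / (w - a\<^sub>k))\<close> for \<open>w\<close> in \<open>\<Omega>\<close> and
  \<open>- 2 * pi * \<Sum>\<^sub>k 1 / (w - a\<^sub>k)\<close> outside the closure. Let \<open>w\<close> tend to \<open>z(t)\<close> along the normal from both sides. The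
  difference of the two identities is a Poisson integral and gives \<open>z'(t) * f'(w) / f(w) \<longrightarrow> \<i> * \<theta>'(t)\<close>; with Hopf's
  lemma it follows that \<open>\<theta>' > 0\<close>. The imaginary part of their sum has a bounded kernel tending to \<open>- N\<^sup>*\<close> up to a factor,
  and dominated convergence yields the integral equation. As each curve contributes a positive multiple of
  \<open>2 * pi\<close> to the total increase \<open>2 * pi * (M + 1)\<close> of \<open>\<theta>\<close>, each contributes exactly \<open>2 * pi\<close>.

  Integrals are gauge integrals, so \<open>\<theta>'\<close> is integrable as soon as it exists everywhere.
\<close>

section \<open>Boundary limits of Poisson-type integrals\<close>

text \<open>The obstacle is regularity. \<open>\<theta>\<close> is only differentiable on each
  closed parameter interval and \<open>f\<close> has only limits at the boundary, so at first
  \<open>\<theta>'\<close> is not known to be continuous, bounded or absolutely integrable. This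
  fixes the order of the steps. The difference of the two one-sided identities needs no majorant:
  integration by parts leaves a difference quotient of \<open>\<theta>\<close>, which is continuous.
  The sum is treated by dominated convergence, which asks for an integrable majorant; once Hopf's
  lemma has given \<open>\<theta>' > 0\<close>, constant multiples of \<open>\<theta>'\<close>
  itself serve. So positivity comes before the integral equation. Both limits are taken at interior
  parameters, because at \<open>0\<close> and \<open>2 * pi\<close> a closed curve passes through
  the point at both ends of the interval. A second obstacle is that the hypotheses fix orientations
  by winding numbers, whereas the argument needs to know that \<open>\<i> * z'\<close> points into
  the region; this is derived from the jump of the winding number across a curve.\<close>

lemma tendsto_at_right_sequentiallyI:
  fixes f :: "real \<Rightarrow> 'a::topological_space"
  assumes d: "d > 0"
    and seq: "\<And>X. (\<And>i. 0 < X i) \<Longrightarrow> (\<And>i. X i \<le> d) \<Longrightarrow> X \<longlonglongrightarrow> 0 \<Longrightarrow> (\<lambda>i. f (X i)) \<longlonglongrightarrow> L"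
  shows "(f \<longlongrightarrow> L) (at_right 0)"
proof -
  have eq: "at_right 0 = at (0::real) within {0<..d}"
    by (rule at_within_nhd[where S="{..<d}"]) (use d in auto)
  show ?thesis unfolding eq tendsto_at_iff_sequentially o_def
    by (intro allI impI seq) auto
qed

text \<open>Integrability of \<open>\<theta>' * k\<close> is part of the conclusion. The derivative
  of the product is gauge integrable by the fundamental theorem, and \<open>\<theta> * k'\<close> is
  continuous, so their difference is integrable as well.\<close>

lemma has_integral_by_parts_complex:
  fixes \<theta> \<theta>' k k' :: "real \<Rightarrow> complex"
  assumes ab: "a \<le> b"
    and th: "\<And>s. s \<in> {a..b} \<Longrightarrow> (\<theta> has_vector_derivative \<theta>' s) (at s within {a..b})"
    and k: "\<And>s. s \<in> {a..b} \<Longrightarrow> (k has_vector_derivative k' s) (at s within {a..b})"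
    and k': "continuous_on {a..b} k'"
  shows "((\<lambda>s. \<theta>' s * k s) has_integral \<theta> b * k b - \<theta> a * k a - integral {a..b} (\<lambda>s. \<theta> s * k' s)) {a..b}"
proof -
  have "continuous_on {a..b} \<theta>"
    using th has_vector_derivative_continuous unfolding continuous_on_eq_continuous_within by blast
  then have "(\<lambda>s. \<theta> s * k' s) integrable_on {a..b}"
    by (intro integrable_continuous_real continuous_intros k')
  moreover have "((\<lambda>s. \<theta> s * k' s + \<theta>' s * k s) has_integral \<theta> b * k b - \<theta> a * k a) {a..b}"
    using ab by (intro fundamental_theorem_of_calculus[where f="\<lambda>s. \<theta> s * k s"])
      (auto intro!: has_vector_derivative_mult th k)
  ultimately show ?thesis
    using has_integral_diff[of "\<lambda>s. \<theta> s * k' s + \<theta>' s * k s" _ "{a..b}" "\<lambda>s. \<theta> s * k' s"]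
    by (auto dest: integrable_integral)
qed

text \<open>The total mass of the limit kernel in \<open>approximate_identity\<close>. An
  antiderivative is \<open>arctan x - x / (1 + x^2)\<close>, whose second term vanishes at both
  infinities.\<close>

lemma has_integral_square_over_1_plus_square_squared:
  "((\<lambda>x::real. 2 * x\<^sup>2 / (1 + x\<^sup>2)\<^sup>2) has_integral pi) UNIV"
proof -
  have pos: "1 + x\<^sup>2 \<noteq> 0" for x :: real
    using zero_le_power2[of x] by linarith
  have ge: "AE x in lborel. - \<infinity> < ereal x \<longrightarrow> ereal x < \<infinity> \<longrightarrow> 0 \<le> 2 * x\<^sup>2 / (1 + x\<^sup>2)\<^sup>2"
    by (auto intro!: AE_I2)
  have D: "DERIV (\<lambda>x. arctan x - x / (1 + x\<^sup>2)) x :> 2 * x\<^sup>2 / (1 + x\<^sup>2)\<^sup>2" for x :: real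
  proof -
    have "DERIV (\<lambda>x. x / (1 + x\<^sup>2)) x :> (1 * (1 + x\<^sup>2) - x * (2 * x)) / ((1 + x\<^sup>2) * (1 + x\<^sup>2))"
      using pos by (intro DERIV_divide) (auto intro!: derivative_eq_intros)
    moreover have "inverse (1 + x\<^sup>2) - (1 * (1 + x\<^sup>2) - x * (2 * x)) / ((1 + x\<^sup>2) * (1 + x\<^sup>2)) = 2 * x\<^sup>2 / (1 + x\<^sup>2)\<^sup>2"
      using pos[of x] by (simp add: divide_simps power2_eq_square)
    ultimately show ?thesis
      using DERIV_cong[OF DERIV_diff[OF DERIV_arctan]] by blast
  qed
  have c: "isCont (\<lambda>x::real. 2 * x\<^sup>2 / (1 + x\<^sup>2)\<^sup>2) x" for x
    by (intro continuous_intros) (use pos in simp)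
  have t1: "((\<lambda>x::real. x / (1 + x\<^sup>2)) \<longlongrightarrow> 0) at_top"
    and t2: "((\<lambda>x::real. x / (1 + x\<^sup>2)) \<longlongrightarrow> 0) at_bot"
    by real_asymp+
  have "((\<lambda>x::real. arctan x - x / (1 + x\<^sup>2)) \<longlongrightarrow> - (pi/2)) at_bot"
    "((\<lambda>x::real. arctan x - x / (1 + x\<^sup>2)) \<longlongrightarrow> pi/2) at_top"
    using tendsto_diff[OF tendsto_arctan_at_bot t2] tendsto_diff[OF tendsto_arctan_at_top t1] by auto
  then have l: "(((\<lambda>x::real. arctan x - x / (1 + x\<^sup>2)) \<circ> real_of_ereal) \<longlongrightarrow> - (pi/2)) (at_right (- \<infinity>))"
    "(((\<lambda>x::real. arctan x - x / (1 + x\<^sup>2)) \<circ> real_of_ereal) \<longlongrightarrow> pi/2) (at_left \<infinity>)"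
    by (simp_all add: ereal_tendsto_simps)
  have "set_integrable lborel (einterval (-\<infinity>) \<infinity>) (\<lambda>x::real. 2 * x\<^sup>2 / (1 + x\<^sup>2)\<^sup>2)"
    "(LBINT x=-\<infinity>..\<infinity>. 2 * x\<^sup>2 / (1 + x\<^sup>2)\<^sup>2) = pi/2 - - (pi/2)"
    by (rule interval_integral_FTC_nonneg[where F="\<lambda>x. arctan x - x / (1 + x\<^sup>2)", OF _ _ _ ge l]; use D c in auto)+
  then have "set_integrable lborel UNIV (\<lambda>x::real. 2 * x\<^sup>2 / (1 + x\<^sup>2)\<^sup>2)"
    "(LINT x:UNIV|lborel. 2 * x\<^sup>2 / (1 + x\<^sup>2)\<^sup>2) = pi"
    by (auto simp: interval_lebesgue_integral_def einterval_def)
  then show ?thesis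
    using set_borel_integral_eq_integral[of UNIV "\<lambda>x::real. 2 * x\<^sup>2 / (1 + x\<^sup>2)\<^sup>2"]
    by (metis integrable_integral)
qed

text \<open>A boundary curve after translation and division by its velocity at \<open>t0\<close>:
  the tangent at \<open>t0\<close> is the positive real direction, and moving along the normal means
  moving to \<open>\<i> * \<delta>\<close>. Together \<open>ends\<close> and \<open>zero_iff\<close>
  restrict a closed curve to interior parameters.\<close>

locale normalized_arc =
  fixes \<alpha> \<beta> t0 :: real and \<zeta> :: "real \<Rightarrow> complex"
  assumes ends: "\<alpha> < t0" "t0 < \<beta>"
    and cont: "continuous_on {\<alpha>..\<beta>} \<zeta>"
    and deriv1: "(\<zeta> has_vector_derivative 1) (at t0)"
    and zero_iff: "\<And>s. s \<in> {\<alpha>..\<beta>} \<Longrightarrow> \<zeta> s = 0 \<longleftrightarrow> s = t0"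
begin

definition quot :: "real \<Rightarrow> complex" where
  "quot s = (if s = t0 then 1 else \<zeta> s / (s - t0))"

lemma zeta_eq_quot: "s \<in> {\<alpha>..\<beta>} \<Longrightarrow> \<zeta> s = (s - t0) * quot s"
  using zero_iff by (auto simp: quot_def)

lemma quot_nonzero: "s \<in> {\<alpha>..\<beta>} \<Longrightarrow> quot s \<noteq> 0"
  using zero_iff by (auto simp: quot_def)

lemma zeta_t0: "\<zeta> t0 = 0"
  using zero_iff ends by auto

text \<open>Stated for a general function because it serves twice: for \<open>\<zeta>\<close> in
  \<open>continuous_on_quot\<close> and for \<open>\<theta>\<close> in
  \<open>Fatou_kernel_limit\<close>. Differentiability at the single point \<open>t0\<close>
  suffices.\<close>

lemma continuous_on_diff_quotient:
  fixes g :: "real \<Rightarrow> complex"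
  assumes c: "continuous_on {\<alpha>..\<beta>} g" and d: "(g has_vector_derivative l) (at t0)"
  shows "continuous_on {\<alpha>..\<beta>} (\<lambda>s. if s = t0 then l else (g s - g t0) / (s - t0))"
proof (unfold continuous_on_eq_continuous_within, rule ballI)
  fix s assume s: "s \<in> {\<alpha>..\<beta>}"
  show "continuous (at s within {\<alpha>..\<beta>}) (\<lambda>s. if s = t0 then l else (g s - g t0) / (s - t0))"
  proof (cases "s = t0")
    case True
    have "((\<lambda>y. (1 / norm (y - t0)) *\<^sub>R (g y - (g t0 + (y - t0) *\<^sub>R l))) \<longlongrightarrow> 0) (at t0 within {\<alpha>..\<beta>})"
      using has_vector_derivative_at_within[OF d] by (simp add: has_vector_derivative_def has_derivative_within)
    then have lim: "((\<lambda>y. norm ((1 / norm (y - t0)) *\<^sub>R (g y - (g t0 + (y - t0) *\<^sub>R l)))) \<longlongrightarrow> 0) (at t0 within {\<alpha>..\<beta>})"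
      by (rule tendsto_norm_zero)
    have nn: "norm ((1 / norm (y - t0)) *\<^sub>R (g y - (g t0 + (y - t0) *\<^sub>R l)))
        = norm ((if y = t0 then l else (g y - g t0) / (y - t0)) - l)" if "y \<noteq> t0" for y
    proof -
      have "(g y - g t0) / (y - t0) - l = (g y - (g t0 + (y - t0) *\<^sub>R l)) / (y - t0)"
        using that by (simp add: scaleR_conv_of_real diff_divide_distrib add_divide_distrib flip: of_real_diff)
      then show ?thesis using that by (simp add: norm_divide flip: of_real_diff)
    qed
    have "((\<lambda>y. norm ((if y = t0 then l else (g y - g t0) / (y - t0)) - l)) \<longlongrightarrow> 0) (at t0 within {\<alpha>..\<beta>})"
      by (rule Lim_transform_within[OF lim, of 1]) (use nn in auto)
    then have "((\<lambda>y. if y = t0 then l else (g y - g t0) / (y - t0)) \<longlongrightarrow> l) (at t0 within {\<alpha>..\<beta>})"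
      by (simp add: tendsto_norm_zero_iff LIM_zero_iff)
    then show ?thesis by (simp add: True continuous_within)
  next
    case False
    have "continuous (at s within {\<alpha>..\<beta>}) (\<lambda>s. (g s - g t0) / (s - t0))"
      using c s False by (auto intro!: continuous_intros simp: continuous_on_eq_continuous_within)
    then show ?thesis
      by (rule continuous_transform_within[where \<delta>="\<bar>s - t0\<bar>"]) (use False s in \<open>auto simp: dist_real_def\<close>)
  qed
qed

lemma continuous_on_quot: "continuous_on {\<alpha>..\<beta>} quot"
  using continuous_on_diff_quotient[OF cont deriv1] by (simp add: quot_def[abs_def] zeta_t0 cong: if_cong)

lemma zeta_upper: "\<exists>C>0. \<forall>s\<in>{\<alpha>..\<beta>}. norm (\<zeta> s) \<le> C * \<bar>s - t0\<bar>"
proof -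
  have "bounded (quot ` {\<alpha>..\<beta>})"
    by (intro compact_imp_bounded compact_continuous_image continuous_on_quot) auto
  then obtain C where C: "C > 0" "\<And>s. s \<in> {\<alpha>..\<beta>} \<Longrightarrow> norm (quot s) \<le> C"
    by (auto simp: bounded_pos)
  have "norm (\<zeta> s) \<le> C * \<bar>s - t0\<bar>" if "s \<in> {\<alpha>..\<beta>}" for s
    using mult_left_mono[OF C(2)[OF that], of "\<bar>s - t0\<bar>"]
    by (simp add: zeta_eq_quot[OF that] norm_mult mult.commute flip: of_real_diff)
  then show ?thesis using C(1) by blast
qed

text \<open>Near \<open>t0\<close> the factor \<open>quot\<close> is close to 1, so the square of
  \<open>\<zeta> s\<close> has real part comparable to \<open>(s - t0)^2\<close> and adding
  \<open>\<delta>^2\<close> cannot cancel it. Away from \<open>t0\<close> the modulus of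
  \<open>\<zeta>\<close> is bounded below and a small \<open>\<delta>\<close> is too weak to cancel
  it.\<close>

lemma kernel_lower:
  "\<exists>c>0. \<exists>\<delta>1>0. \<forall>s\<in>{\<alpha>..\<beta>}. \<forall>\<delta>. 0 < \<delta> \<longrightarrow> \<delta> \<le> \<delta>1 \<longrightarrow>
     c * ((s - t0)\<^sup>2 + \<delta>\<^sup>2) \<le> norm ((\<zeta> s)\<^sup>2 + (of_real \<delta>)\<^sup>2)"
proof -
  have "continuous (at t0 within {\<alpha>..\<beta>}) quot"
    using continuous_on_quot ends by (simp add: continuous_on_eq_continuous_within)
  then obtain \<eta> where \<eta>: "\<eta> > 0" "\<And>s. s \<in> {\<alpha>..\<beta>} \<Longrightarrow> \<bar>s - t0\<bar> < \<eta> \<Longrightarrow> norm (quot s - 1) < 1/4"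
    unfolding continuous_within_eps_delta
    by (metis dist_norm quot_def real_norm_def zero_less_divide_1_iff zero_less_numeral)
  have "\<exists>s0\<in>{\<alpha>..\<beta>}. \<forall>s\<in>{\<alpha>..\<beta>}. norm (quot s0) \<le> norm (quot s)"
    by (intro continuous_attains_inf continuous_intros continuous_on_quot) (use ends in auto)
  then obtain s0 where s0: "s0 \<in> {\<alpha>..\<beta>}" "\<And>s. s \<in> {\<alpha>..\<beta>} \<Longrightarrow> norm (quot s0) \<le> norm (quot s)"
    by blast
  define m where "m = norm (quot s0)"
  have m: "m > 0" using quot_nonzero s0(1) by (auto simp: m_def)
  \<comment> \<open>At distance at least \<open>\<eta>\<close> from \<open>t0\<close> the modulus of
    \<open>\<zeta> s\<close> is at least \<open>m * \<eta>\<close>. Half of this bounds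
    \<open>\<delta>\<close>, so \<open>\<delta>^2\<close> takes away at most a quarter, which
    explains the 3/4 in \<open>c\<close>. The number \<open>B\<close> bounds
    \<open>(s - t0)^2 + \<delta>^2\<close> from above.\<close>
  define \<delta>1 where "\<delta>1 = m * \<eta> / 2"
  define B where "B = (\<beta> - \<alpha>)\<^sup>2 + \<delta>1\<^sup>2"
  define c where "c = min (7/16) (3/4 * (m * \<eta>)\<^sup>2 / B)"
  have d1: "\<delta>1 > 0" using m \<eta> by (simp add: \<delta>1_def)
  have B: "B > 0" using d1 by (simp add: B_def add_nonneg_pos)
  have c: "c > 0" using m \<eta> B by (simp add: c_def)
  have "c * ((s - t0)\<^sup>2 + \<delta>\<^sup>2) \<le> norm ((\<zeta> s)\<^sup>2 + (of_real \<delta>)\<^sup>2)"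
    if s: "s \<in> {\<alpha>..\<beta>}" and d: "0 < \<delta>" "\<delta> \<le> \<delta>1" for s \<delta>
  proof (cases "\<bar>s - t0\<bar> < \<eta>")
    case True
    define e where "e = quot s - 1"
    have e: "norm e < 1/4" using \<eta>(2)[OF s True] by (simp add: e_def)
    \<comment> \<open>With \<open>norm e < 1/4\<close> the three terms of the square give 1 - 2/4 -
      1/16 = 7/16.\<close>
    have re: "Re ((1 + e)\<^sup>2) \<ge> 7/16"
    proof -
      have "Re ((1 + e)\<^sup>2) = 1 + 2 * Re e + Re (e\<^sup>2)"
        by (simp add: power2_eq_square algebra_simps)
      moreover have "\<bar>Re e\<bar> \<le> 1/4" using abs_Re_le_cmod[of e] e by linarith
      moreover have "norm (e\<^sup>2) \<le> (1/4)\<^sup>2"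
        unfolding norm_power using e by (intro power_mono) auto
      then have "\<bar>Re (e\<^sup>2)\<bar> \<le> 1/16" using abs_Re_le_cmod[of "e\<^sup>2"] by (simp add: power2_eq_square)
      ultimately show ?thesis by linarith
    qed
    have "(\<zeta> s)\<^sup>2 = of_real ((s - t0)\<^sup>2) * (1 + e)\<^sup>2"
      by (simp add: zeta_eq_quot[OF s] e_def power_mult_distrib)
    then have "Re ((\<zeta> s)\<^sup>2 + (of_real \<delta>)\<^sup>2) = (s - t0)\<^sup>2 * Re ((1 + e)\<^sup>2) + \<delta>\<^sup>2"
      by (simp only: plus_complex.sel times_complex.sel of_real_power[symmetric] Re_complex_of_real Im_complex_of_real)
    also have "\<dots> \<ge> (s - t0)\<^sup>2 * (7/16) + \<delta>\<^sup>2 * (7/16)"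
      using mult_left_mono[OF re, of "(s - t0)\<^sup>2"] by (intro add_mono) auto
    finally have "7/16 * ((s - t0)\<^sup>2 + \<delta>\<^sup>2) \<le> Re ((\<zeta> s)\<^sup>2 + (of_real \<delta>)\<^sup>2)"
      by (simp add: algebra_simps)
    also have "\<dots> \<le> norm ((\<zeta> s)\<^sup>2 + (of_real \<delta>)\<^sup>2)" by (rule complex_Re_le_cmod)
    finally have "7/16 * ((s - t0)\<^sup>2 + \<delta>\<^sup>2) \<le> norm ((\<zeta> s)\<^sup>2 + (of_real \<delta>)\<^sup>2)" .
    moreover have "c * ((s - t0)\<^sup>2 + \<delta>\<^sup>2) \<le> 7/16 * ((s - t0)\<^sup>2 + \<delta>\<^sup>2)"
      by (rule mult_right_mono) (auto simp: c_def)
    ultimately show ?thesis by linarith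
  next
    case False
    have "m * \<eta> \<le> norm (quot s) * \<bar>s - t0\<bar>"
      using s0(2)[OF s] False m \<eta>(1) by (intro mult_mono) (auto simp: m_def)
    also have "\<dots> = norm (\<zeta> s)"
      by (simp add: zeta_eq_quot[OF s] norm_mult flip: of_real_diff)
    finally have "(m * \<eta>)\<^sup>2 \<le> (norm (\<zeta> s))\<^sup>2"
      using m \<eta>(1) by (intro power_mono) auto
    moreover have "\<delta>\<^sup>2 \<le> (m * \<eta> / 2)\<^sup>2"
      using d by (intro power_mono) (auto simp: \<delta>1_def)
    then have "\<delta>\<^sup>2 \<le> (m * \<eta>)\<^sup>2 / 4" by (simp add: power_divide)
    moreover have "norm ((\<zeta> s)\<^sup>2) - norm (- (of_real \<delta>)\<^sup>2 :: complex) \<le> norm ((\<zeta> s)\<^sup>2 - (- (of_real \<delta>)\<^sup>2))"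
      by (rule norm_triangle_ineq2)
    then have "(norm (\<zeta> s))\<^sup>2 - \<delta>\<^sup>2 \<le> norm ((\<zeta> s)\<^sup>2 + (of_real \<delta>)\<^sup>2)"
      by (simp add: norm_power)
    ultimately have *: "3/4 * (m * \<eta>)\<^sup>2 \<le> norm ((\<zeta> s)\<^sup>2 + (of_real \<delta>)\<^sup>2)"
      by linarith
    have "\<bar>s - t0\<bar>\<^sup>2 \<le> (\<beta> - \<alpha>)\<^sup>2" using s ends by (intro power_mono) auto
    moreover have "\<delta>\<^sup>2 \<le> \<delta>1\<^sup>2" using d by (intro power_mono) auto
    ultimately have "(s - t0)\<^sup>2 + \<delta>\<^sup>2 \<le> B" by (simp add: B_def)
    then have "c * ((s - t0)\<^sup>2 + \<delta>\<^sup>2) \<le> (3/4 * (m * \<eta>)\<^sup>2 / B) * B"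
      using c by (intro mult_mono) (auto simp: c_def)
    also have "\<dots> = 3/4 * (m * \<eta>)\<^sup>2" using B by simp
    finally show ?thesis using * by simp
  qed
  then show ?thesis using c d1 by blast
qed

text \<open>The substitution \<open>s = t0 + \<delta> * x\<close> turns this into dominated convergence on the line.\<close>

lemma approximate_identity:
  assumes E: "continuous_on {\<alpha>..\<beta>} E"
  shows "((\<lambda>\<delta>. integral {\<alpha>..\<beta>} (\<lambda>s. E s * (2 * of_real \<delta> * (\<zeta> s)\<^sup>2 / ((\<zeta> s)\<^sup>2 + (of_real \<delta>)\<^sup>2)\<^sup>2)))
           \<longlongrightarrow> of_real pi * E t0) (at_right 0)"
proof -
  obtain C where C: "C > 0" "\<And>s. s \<in> {\<alpha>..\<beta>} \<Longrightarrow> norm (\<zeta> s) \<le> C * \<bar>s - t0\<bar>"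
    using zeta_upper by blast
  obtain c \<delta>1 where c: "c > 0" "\<delta>1 > 0"
    and low: "\<And>s \<delta>. s \<in> {\<alpha>..\<beta>} \<Longrightarrow> 0 < \<delta> \<Longrightarrow> \<delta> \<le> \<delta>1 \<Longrightarrow>
      c * ((s - t0)\<^sup>2 + \<delta>\<^sup>2) \<le> norm ((\<zeta> s)\<^sup>2 + (of_real \<delta>)\<^sup>2)"
    using kernel_lower by blast
  have "bounded (E ` {\<alpha>..\<beta>})"
    by (intro compact_imp_bounded compact_continuous_image E) auto
  then obtain B where B: "B > 0" "\<And>s. s \<in> {\<alpha>..\<beta>} \<Longrightarrow> norm (E s) \<le> B"
    by (auto simp: bounded_pos)
  show ?thesis
  proof (rule tendsto_at_right_sequentiallyI[OF c(2)])
    fix X :: "nat \<Rightarrow> real" assume X: "\<And>i. 0 < X i" "\<And>i. X i \<le> \<delta>1" "X \<longlonglongrightarrow> 0"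
    define F where "F i s = E s * (2 * of_real (X i) * (\<zeta> s)\<^sup>2 / ((\<zeta> s)\<^sup>2 + (of_real (X i))\<^sup>2)\<^sup>2)" for i s
    \<comment> \<open>The rescaled integrand, extended by zero, so that all integrals run over the
      whole line although the rescaled intervals grow with \<open>i\<close>.\<close>
    define G where "G i x = (if t0 + X i * x \<in> {\<alpha>..\<beta>} then of_real (X i) * F i (t0 + X i * x) else 0)" for i x
    have low_pos: "norm ((\<zeta> s)\<^sup>2 + (of_real (X i))\<^sup>2) > 0" if "s \<in> {\<alpha>..\<beta>}" for i s
    proof -
      have "0 < c * ((s - t0)\<^sup>2 + (X i)\<^sup>2)" using c(1) X(1)[of i] by (simp add: add_nonneg_pos)
      then show ?thesis using low[OF that X(1,2)[of i]] by linarith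
    qed
    have contF: "continuous_on {\<alpha>..\<beta>} (F i)" for i
      unfolding F_def by (intro continuous_intros E cont) (use low_pos[of _ i] in auto)
    have GI: "(G i has_integral integral {\<alpha>..\<beta>} (F i)) UNIV" for i
    proof -
      have "(F i has_integral integral {\<alpha>..\<beta>} (F i)) (cbox \<alpha> \<beta>)"
        using integrable_continuous_real[OF contF[of i]] by (simp add: integrable_integral)
      from has_integral_affinity'[OF this X(1)[of i], of t0]
      have "((\<lambda>x. F i (X i * x + t0)) has_integral integral {\<alpha>..\<beta>} (F i) /\<^sub>R X i)
            (cbox ((\<alpha> - t0) /\<^sub>R X i) ((\<beta> - t0) /\<^sub>R X i))" by simp
      from has_integral_mult_right[OF this, of "of_real (X i)"]
      have "((\<lambda>x. of_real (X i) * F i (X i * x + t0)) has_integral integral {\<alpha>..\<beta>} (F i))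
            (cbox ((\<alpha> - t0) /\<^sub>R X i) ((\<beta> - t0) /\<^sub>R X i))"
        using X(1)[of i] by (simp add: scaleR_conv_of_real flip: mult.assoc)
      then have "((\<lambda>x. of_real (X i) * F i (t0 + X i * x)) has_integral integral {\<alpha>..\<beta>} (F i))
            (cbox ((\<alpha> - t0) /\<^sub>R X i) ((\<beta> - t0) /\<^sub>R X i))"
        by (simp only: add.commute)
      then have "((\<lambda>x. if x \<in> cbox ((\<alpha> - t0) /\<^sub>R X i) ((\<beta> - t0) /\<^sub>R X i) then of_real (X i) * F i (t0 + X i * x) else 0)
         has_integral integral {\<alpha>..\<beta>} (F i)) UNIV"
        by (rule iffD2[OF has_integral_restrict_UNIV])
      moreover have "x \<in> cbox ((\<alpha> - t0) /\<^sub>R X i) ((\<beta> - t0) /\<^sub>R X i) \<longleftrightarrow> t0 + X i * x \<in> {\<alpha>..\<beta>}" for x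
        using X(1)[of i] by (auto simp: field_simps)
      ultimately show ?thesis by (simp only: G_def[abs_def])
    qed
    \<comment> \<open>Here \<open>B\<close> bounds \<open>E\<close>, \<open>C\<close> bounds
      \<open>\<zeta>\<close> from above and \<open>c\<close> bounds the denominator from below; in
      the resulting estimate all powers of \<open>X i\<close> cancel.\<close>
    define K where "K = B * C\<^sup>2 / c\<^sup>2"
    define g where "g x = of_real (2 * x\<^sup>2 / (1 + x\<^sup>2)\<^sup>2) * E t0" for x :: real
    have gI: "(g has_integral of_real pi * E t0) UNIV"
      unfolding g_def
      by (intro has_integral_mult_left has_integral_of_real has_integral_square_over_1_plus_square_squared)
    have le: "norm (G i x) \<le> K * (2 * x\<^sup>2 / (1 + x\<^sup>2)\<^sup>2)" for i x
    proof (cases "t0 + X i * x \<in> {\<alpha>..\<beta>}")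
      case False
      then have "G i x = 0" by (simp only: G_def if_False)
      then show ?thesis using B(1) by (simp add: K_def)
    next
      case True
      define s where "s = t0 + X i * x"
      have s: "s \<in> {\<alpha>..\<beta>}" "s - t0 = X i * x" using True by (auto simp: s_def)
      have z: "(norm (\<zeta> s))\<^sup>2 \<le> (C * \<bar>X i * x\<bar>)\<^sup>2"
        using C(2)[OF s(1)] unfolding s(2) by (intro power_mono) auto
      have l: "c * (X i)\<^sup>2 * (1 + x\<^sup>2) \<le> norm ((\<zeta> s)\<^sup>2 + (of_real (X i))\<^sup>2)"
        using low[OF s(1) X(1,2)[of i]] by (simp add: s(2) power_mult_distrib algebra_simps)
      have p: "1 + x\<^sup>2 > 0" using zero_le_power2[of x] by linarith
      have l2: "(c * (X i)\<^sup>2 * (1 + x\<^sup>2))\<^sup>2 \<le> (norm ((\<zeta> s)\<^sup>2 + (of_real (X i))\<^sup>2))\<^sup>2"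
        using l c(1) p by (intro power_mono) auto
      have "norm (G i x) = X i * (norm (E s) * (2 * X i * (norm (\<zeta> s))\<^sup>2 / (norm ((\<zeta> s)\<^sup>2 + (of_real (X i))\<^sup>2))\<^sup>2))"
        using True X(1)[of i] by (simp add: G_def F_def s_def norm_mult norm_divide norm_power)
      also have "\<dots> \<le> X i * (B * (2 * X i * (C * \<bar>X i * x\<bar>)\<^sup>2 / (c * (X i)\<^sup>2 * (1 + x\<^sup>2))\<^sup>2))"
        using X(1)[of i] B(1) B(2)[OF s(1)] z l2 c(1) p
        by (intro mult_left_mono mult_mono frac_le) auto
      also have "\<dots> = K * (2 * x\<^sup>2 / (1 + x\<^sup>2)\<^sup>2)"
      proof -
        have "X i \<noteq> 0" using X(1)[of i] by simp
        then show ?thesis using c(1) p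
          by (simp add: K_def power_mult_distrib divide_simps abs_mult power4_eq_xxxx) 
            (simp add: power2_eq_square power4_eq_xxxx algebra_simps)
      qed
      finally show ?thesis .
    qed
    have lim: "(\<lambda>i. G i x) \<longlonglongrightarrow> g x" for x
    proof -
      have t: "(\<lambda>i. t0 + X i * x) \<longlonglongrightarrow> t0"
        using X(3) by (auto intro!: tendsto_eq_intros)
      have inn: "\<forall>\<^sub>F i in sequentially. t0 + X i * x \<in> {\<alpha><..<\<beta>}"
        by (rule topological_tendstoD[OF t]) (use ends in auto)
      have cq: "isCont quot t0" and cE: "isCont E t0"
        using continuous_on_quot E ends by (auto intro: continuous_on_interior)
      have q: "(\<lambda>i. quot (t0 + X i * x)) \<longlonglongrightarrow> 1"
        using isCont_tendsto_compose[OF cq t] by (simp add: quot_def)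
      have e: "(\<lambda>i. E (t0 + X i * x)) \<longlonglongrightarrow> E t0"
        using isCont_tendsto_compose[OF cE t] by simp
      have p: "(of_real x)\<^sup>2 * 1\<^sup>2 + 1 \<noteq> (0::complex)"
      proof -
        have "x\<^sup>2 + 1 \<noteq> 0" using zero_le_power2[of x] by linarith
        then have "complex_of_real (x\<^sup>2 + 1) \<noteq> 0" by (simp only: of_real_eq_0_iff) simp
        then show ?thesis by simp
      qed
      have "(\<lambda>i. E (t0 + X i * x) * (2 * ((of_real x)\<^sup>2 * (quot (t0 + X i * x))\<^sup>2) /
             ((of_real x)\<^sup>2 * (quot (t0 + X i * x))\<^sup>2 + 1)\<^sup>2))
            \<longlonglongrightarrow> E t0 * (2 * ((of_real x)\<^sup>2 * 1\<^sup>2) / ((of_real x)\<^sup>2 * 1\<^sup>2 + 1)\<^sup>2)"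
        by (intro tendsto_intros e q) (use p in auto)
      moreover have "\<forall>\<^sub>F i in sequentially. E (t0 + X i * x) * (2 * ((of_real x)\<^sup>2 * (quot (t0 + X i * x))\<^sup>2) /
             ((of_real x)\<^sup>2 * (quot (t0 + X i * x))\<^sup>2 + 1)\<^sup>2) = G i x"
        using inn
      proof eventually_elim
        case (elim i)
        let ?s = "t0 + X i * x"
        have s: "?s \<in> {\<alpha>..\<beta>}" using elim by auto
        have x0: "complex_of_real (X i) \<noteq> 0" using X(1)[of i] by simp
        have z: "(\<zeta> ?s)\<^sup>2 = (of_real (X i))\<^sup>2 * ((of_real x)\<^sup>2 * (quot ?s)\<^sup>2)"
          by (simp add: zeta_eq_quot[OF s] power_mult_distrib)
        have "G i x = of_real (X i) * (E ?s * (2 * of_real (X i) * ((of_real (X i))\<^sup>2 * ((of_real x)\<^sup>2 * (quot ?s)\<^sup>2))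
            / ((of_real (X i))\<^sup>2 * ((of_real x)\<^sup>2 * (quot ?s)\<^sup>2) + (of_real (X i))\<^sup>2)\<^sup>2))"
          using s by (simp only: G_def F_def z if_True)
        also have "((of_real (X i))\<^sup>2 * ((of_real x)\<^sup>2 * (quot ?s)\<^sup>2) + (of_real (X i))\<^sup>2)\<^sup>2
           = (of_real (X i)) ^ 4 * ((of_real x)\<^sup>2 * (quot ?s)\<^sup>2 + 1)\<^sup>2" by algebra
        finally have "G i x = of_real (X i) * (E ?s * (2 * of_real (X i) * ((of_real (X i))\<^sup>2 * ((of_real x)\<^sup>2 * (quot ?s)\<^sup>2))
            / ((of_real (X i)) ^ 4 * ((of_real x)\<^sup>2 * (quot ?s)\<^sup>2 + 1)\<^sup>2)))" .
        moreover have "c * (e * (2 * c * (c\<^sup>2 * A) / (c ^ 4 * D))) = e * (2 * A / D)" if "c \<noteq> 0" for c e A D :: complex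
          using that by (cases "D = 0") (auto simp: field_simps power4_eq_xxxx power2_eq_square)
        ultimately show ?case using x0 by presburger
      qed
      moreover have "E t0 * (2 * ((of_real x)\<^sup>2 * 1\<^sup>2) / ((of_real x)\<^sup>2 * 1\<^sup>2 + 1)\<^sup>2) = g x"
        by (simp add: g_def add.commute)
      ultimately show ?thesis using Lim_transform_eventually by simp
    qed
    have "(\<lambda>x. K * (2 * x\<^sup>2 / (1 + x\<^sup>2)\<^sup>2)) integrable_on UNIV"
      using has_integral_mult_right[OF has_integral_square_over_1_plus_square_squared, of K] by blast
    then have "(\<lambda>i. integral UNIV (G i)) \<longlonglongrightarrow> integral UNIV g"
      using GI le lim by (intro dominated_convergence(2)[where h="\<lambda>x. K * (2 * x\<^sup>2 / (1 + x\<^sup>2)\<^sup>2)"]) blast+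
    then have "(\<lambda>i. integral {\<alpha>..\<beta>} (F i)) \<longlonglongrightarrow> of_real pi * E t0"
      by (simp only: integral_unique[OF GI] integral_unique[OF gI])
    then show "(\<lambda>i. integral {\<alpha>..\<beta>} (\<lambda>s. E s * (2 * of_real (X i) * (\<zeta> s)\<^sup>2 / ((\<zeta> s)\<^sup>2 + (of_real (X i))\<^sup>2)\<^sup>2)))
      \<longlonglongrightarrow> of_real pi * E t0"
      by (simp only: F_def[abs_def])
  qed
qed

text \<open>
  Only a derivative of \<open>\<theta>\<close> is available, not a continuous one: integration by parts moves the derivative to the
  kernel and leaves the continuous difference quotient of \<open>\<theta>\<close> at \<open>t0\<close>.
\<close>

lemma Fatou_kernel_limit:
  fixes \<theta> \<theta>' :: "real \<Rightarrow> complex"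
  assumes th: "\<And>s. s \<in> {\<alpha>..\<beta>} \<Longrightarrow> (\<theta> has_vector_derivative \<theta>' s) (at s within {\<alpha>..\<beta>})"
    and z': "\<And>s. s \<in> {\<alpha>..\<beta>} \<Longrightarrow> (\<zeta> has_vector_derivative \<zeta>' s) (at s within {\<alpha>..\<beta>})"
    and cz': "continuous_on {\<alpha>..\<beta>} \<zeta>'"
  shows "((\<lambda>\<delta>. integral {\<alpha>..\<beta>} (\<lambda>s. \<theta>' s * (of_real \<delta> / ((\<zeta> s)\<^sup>2 + (of_real \<delta>)\<^sup>2))))
           \<longlongrightarrow> of_real pi * \<theta>' t0) (at_right 0)"
proof -
  obtain c \<delta>1 where c: "c > 0" "\<delta>1 > 0"
    and low: "\<And>s \<delta>. s \<in> {\<alpha>..\<beta>} \<Longrightarrow> 0 < \<delta> \<Longrightarrow> \<delta> \<le> \<delta>1 \<Longrightarrow>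
      c * ((s - t0)\<^sup>2 + \<delta>\<^sup>2) \<le> norm ((\<zeta> s)\<^sup>2 + (of_real \<delta>)\<^sup>2)"
    using kernel_lower by blast
  have t0: "t0 \<in> {\<alpha>..\<beta>}" using ends by auto
  have at0: "at t0 within {\<alpha>..\<beta>} = at t0"
    by (rule at_within_interior) (use ends in auto)
  have thc: "continuous_on {\<alpha>..\<beta>} \<theta>"
    using th has_vector_derivative_continuous unfolding continuous_on_eq_continuous_within by blast
  define dq where "dq s = (if s = t0 then \<theta>' t0 else (\<theta> s - \<theta> t0) / (s - t0))" for s
  have dqc: "continuous_on {\<alpha>..\<beta>} dq"
    unfolding dq_def[abs_def] using continuous_on_diff_quotient[OF thc] th[OF t0] at0 by simp
  have z1: "\<zeta>' t0 = 1"
    using z'[OF t0] deriv1 unfolding at0 by (rule vector_derivative_unique_at)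
  \<comment> \<open>Away from \<open>t0\<close> this is
    \<open>(\<theta> s - \<theta> t0) * \<zeta>' s / \<zeta> s\<close>. The differentiated kernel
    has one factor \<open>\<zeta> s\<close> in its numerator; trading the increment of
    \<open>\<theta>\<close> for \<open>E s * \<zeta> s\<close> supplies the second one, as
    \<open>approximate_identity\<close> requires.\<close>
  define E where "E s = dq s / quot s * \<zeta>' s" for s
  have E: "continuous_on {\<alpha>..\<beta>} E"
    unfolding E_def using quot_nonzero by (intro continuous_intros dqc continuous_on_quot cz') auto
  have E0: "E t0 = \<theta>' t0" by (simp add: E_def dq_def quot_def z1)
  have Ez: "E s * \<zeta> s = (\<theta> s - \<theta> t0) * \<zeta>' s" if "s \<in> {\<alpha>..\<beta>}" for s
    using quot_nonzero[OF that] zeta_t0 by (auto simp: E_def dq_def zeta_eq_quot[OF that])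
  define k where "k \<delta> s = of_real \<delta> / ((\<zeta> s)\<^sup>2 + (of_real \<delta>)\<^sup>2)" for \<delta> :: real and s
  \<comment> \<open>Integration by parts is applied to \<open>\<theta> - \<theta> t0\<close>, which
    has the same derivative. The terms at the two ends disappear in the limit, because
    \<open>k \<delta>\<close> tends to 0 wherever \<open>\<zeta>\<close> is nonzero.\<close>
  have eq: "integral {\<alpha>..\<beta>} (\<lambda>s. \<theta>' s * k \<delta> s)
      = (\<theta> \<beta> - \<theta> t0) * k \<delta> \<beta> - (\<theta> \<alpha> - \<theta> t0) * k \<delta> \<alpha>
      + integral {\<alpha>..\<beta>} (\<lambda>s. E s * (2 * of_real \<delta> * (\<zeta> s)\<^sup>2 / ((\<zeta> s)\<^sup>2 + (of_real \<delta>)\<^sup>2)\<^sup>2))"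
    if d: "0 < \<delta>" "\<delta> \<le> \<delta>1" for \<delta>
  proof -
    have nz: "(\<zeta> s)\<^sup>2 + (of_real \<delta>)\<^sup>2 \<noteq> 0" if "s \<in> {\<alpha>..\<beta>}" for s
    proof -
      have "0 < c * ((s - t0)\<^sup>2 + \<delta>\<^sup>2)" using c(1) d(1) by (simp add: add_nonneg_pos)
      then show ?thesis using low[OF that d] by auto
    qed
    define k' where "k' s = - (2 * of_real \<delta> * \<zeta> s * \<zeta>' s / ((\<zeta> s)\<^sup>2 + (of_real \<delta>)\<^sup>2)\<^sup>2)" for s
    have kd: "(k \<delta> has_vector_derivative k' s) (at s within {\<alpha>..\<beta>})" if s: "s \<in> {\<alpha>..\<beta>}" for s
    proof -
      have "((\<lambda>w. of_real \<delta> / (w\<^sup>2 + (of_real \<delta>)\<^sup>2)) has_field_derivative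
             - (2 * of_real \<delta> * \<zeta> s / ((\<zeta> s)\<^sup>2 + (of_real \<delta>)\<^sup>2)\<^sup>2)) (at (\<zeta> s))"
        using nz[OF s] by (auto intro!: derivative_eq_intros simp: power2_eq_square)
      from field_vector_diff_chain_within[OF z'[OF s] has_field_derivative_at_within[OF this]]
      show ?thesis by (simp add: k_def[abs_def] o_def k'_def mult.commute mult.left_commute)
    qed
    have ck': "continuous_on {\<alpha>..\<beta>} k'"
      unfolding k'_def using nz by (intro continuous_intros cont cz') auto
    have "((\<lambda>s. \<theta>' s * k \<delta> s) has_integral (\<theta> \<beta> - \<theta> t0) * k \<delta> \<beta> - (\<theta> \<alpha> - \<theta> t0) * k \<delta> \<alpha>
         - integral {\<alpha>..\<beta>} (\<lambda>s. (\<theta> s - \<theta> t0) * k' s)) {\<alpha>..\<beta>}"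
      by (rule has_integral_by_parts_complex[OF _ _ kd ck'])
        (use ends th in \<open>auto intro!: derivative_eq_intros\<close>)
    moreover have "integral {\<alpha>..\<beta>} (\<lambda>s. (\<theta> s - \<theta> t0) * k' s)
        = integral {\<alpha>..\<beta>} (\<lambda>s. - (E s * (2 * of_real \<delta> * (\<zeta> s)\<^sup>2 / ((\<zeta> s)\<^sup>2 + (of_real \<delta>)\<^sup>2)\<^sup>2)))"
    proof (rule Henstock_Kurzweil_Integration.integral_cong)
      fix s assume s: "s \<in> {\<alpha>..\<beta>}"
      have "(\<theta> s - \<theta> t0) * k' s = - (((\<theta> s - \<theta> t0) * \<zeta>' s) * \<zeta> s * (2 * of_real \<delta> / ((\<zeta> s)\<^sup>2 + (of_real \<delta>)\<^sup>2)\<^sup>2))"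
        by (simp add: k'_def)
      also have "\<dots> = - (E s * (2 * of_real \<delta> * (\<zeta> s)\<^sup>2 / ((\<zeta> s)\<^sup>2 + (of_real \<delta>)\<^sup>2)\<^sup>2))"
        by (simp add: Ez[OF s, symmetric] power2_eq_square)
      finally show "(\<theta> s - \<theta> t0) * k' s = - (E s * (2 * of_real \<delta> * (\<zeta> s)\<^sup>2 / ((\<zeta> s)\<^sup>2 + (of_real \<delta>)\<^sup>2)\<^sup>2))" .
    qed
    ultimately show ?thesis
      by (simp add: integral_unique)
  qed
  have kl: "((\<lambda>\<delta>. k \<delta> s) \<longlongrightarrow> 0) (at_right 0)" if "\<zeta> s \<noteq> 0" for s
    unfolding k_def using that by (auto intro!: tendsto_eq_intros)
  have "\<zeta> \<alpha> \<noteq> 0" "\<zeta> \<beta> \<noteq> 0" using zero_iff ends by auto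
  then have lim: "((\<lambda>\<delta>. (\<theta> \<beta> - \<theta> t0) * k \<delta> \<beta> - (\<theta> \<alpha> - \<theta> t0) * k \<delta> \<alpha>
      + integral {\<alpha>..\<beta>} (\<lambda>s. E s * (2 * of_real \<delta> * (\<zeta> s)\<^sup>2 / ((\<zeta> s)\<^sup>2 + (of_real \<delta>)\<^sup>2)\<^sup>2)))
      \<longlongrightarrow> (\<theta> \<beta> - \<theta> t0) * 0 - (\<theta> \<alpha> - \<theta> t0) * 0 + of_real pi * E t0) (at_right 0)"
    by (intro tendsto_intros kl approximate_identity[OF E])
  have "\<forall>\<^sub>F \<delta> in at_right 0. 0 < \<delta> \<and> \<delta> \<le> \<delta>1"
    using c(2) eventually_at_right[of 0 \<delta>1] by (metis (mono_tags, lifting) less_le)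
  then have "\<forall>\<^sub>F \<delta> in at_right 0. (\<theta> \<beta> - \<theta> t0) * k \<delta> \<beta> - (\<theta> \<alpha> - \<theta> t0) * k \<delta> \<alpha>
      + integral {\<alpha>..\<beta>} (\<lambda>s. E s * (2 * of_real \<delta> * (\<zeta> s)\<^sup>2 / ((\<zeta> s)\<^sup>2 + (of_real \<delta>)\<^sup>2)\<^sup>2))
      = integral {\<alpha>..\<beta>} (\<lambda>s. \<theta>' s * k \<delta> s)"
    by eventually_elim (simp add: eq)
  from Lim_transform_eventually[OF lim this] show ?thesis
    by (simp add: E0 k_def)
qed

end

section \<open>Smooth Jordan curves\<close>

lemma periodic_plus_of_int:
  fixes h :: "real \<Rightarrow> 'a"
  assumes "\<And>t. h (t + 2 * pi) = h t"
  shows "h (t + of_int n * (2 * pi)) = h t"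
proof -
  interpret periodic_fun_simple h "2 * pi" by standard (rule assms)
  show ?thesis by (rule plus_of_int)
qed

lemma mod_2pi_exists:
  fixes a s :: real
  shows "\<exists>\<sigma>. a \<le> \<sigma> \<and> \<sigma> < a + 2 * pi \<and> (\<exists>n. s = \<sigma> + of_int n * (2 * pi))"
proof -
  define n where "n = \<lfloor>(s - a) / (2 * pi)\<rfloor>"
  have "of_int n \<le> (s - a) / (2 * pi)" "(s - a) / (2 * pi) < of_int n + 1"
    unfolding n_def by linarith+
  then have "of_int n * (2 * pi) \<le> s - a" "s - a < (of_int n + 1) * (2 * pi)"
    by (simp_all add: pos_le_divide_eq pos_divide_less_eq)
  then show ?thesis
    by (intro exI[of _ "s - of_int n * (2 * pi)"] conjI exI[of _ n]) (auto simp: algebra_simps)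
qed

lemma periodic_continuous_bounded:
  fixes h :: "real \<Rightarrow> complex"
  assumes per: "\<And>t. h (t + 2 * pi) = h t" and c: "continuous_on UNIV h"
  shows "\<exists>K>0. \<forall>t. norm (h t) \<le> K"
proof -
  have "bounded (h ` {0..2*pi})"
    by (intro compact_imp_bounded compact_continuous_image continuous_on_subset[OF c]) auto
  then obtain K where K: "K > 0" "\<And>t. t \<in> {0..2*pi} \<Longrightarrow> norm (h t) \<le> K"
    by (auto simp: bounded_pos)
  have "norm (h t) \<le> K" for t
  proof -
    obtain \<sigma> n where \<sigma>: "0 \<le> \<sigma>" "\<sigma> < 2 * pi" "t = \<sigma> + of_int n * (2 * pi)"
      using mod_2pi_exists[of 0 t] by auto
    then show ?thesis using K(2)[of \<sigma>] periodic_plus_of_int[of h \<sigma> n, OF per] by simp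
  qed
  then show ?thesis using K(1) by blast
qed

text \<open>Kept apart from Jordan curves, because it is also instantiated with the offset curves,
  which are closed and C1 but are not shown to be simple.\<close>

locale C1_curve =
  fixes h h' :: "real \<Rightarrow> complex"
  assumes has_deriv: "\<And>t. (h has_vector_derivative h' t) (at t)"
    and cont_deriv: "continuous_on UNIV h'"
begin

lemma cont_h: "continuous_on S h"
  using has_deriv by (meson continuous_at_imp_continuous_on has_vector_derivative_continuous)

lemma bdry_path_deriv: "(bdry_path h has_vector_derivative 2 * pi * h' (2 * pi * x)) (at x within S)"
proof -
  have "((\<lambda>x. 2 * pi * x) has_vector_derivative 2 * pi) (at x within S)"
    by (auto intro!: derivative_eq_intros)
  from vector_diff_chain_within[OF this has_vector_derivative_at_within[OF has_deriv]]
  show ?thesis by (simp add: bdry_path_def o_def scaleR_conv_of_real)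
qed

lemma valid_bdry_path: "valid_path (bdry_path h)"
proof -
  have "bdry_path h C1_differentiable_on UNIV"
    unfolding C1_differentiable_on_def
    by (intro exI[of _ "\<lambda>x. 2 * pi * h' (2 * pi * x)"] conjI ballI bdry_path_deriv continuous_intros
      continuous_on_compose2[OF cont_deriv]) auto
  then show ?thesis
    by (simp add: C1_differentiable_imp_piecewise C1_differentiable_on_subset valid_path_def)
qed

lemma path_image_bdry_path: "path_image (bdry_path h) = h ` {0..2*pi}"
proof -
  have "(\<lambda>x. 2 * pi * x) ` {0..1} = {0..2*pi}"
    by (simp add: image_mult_atLeastAtMost)
  then have "h ` {0..2*pi} = h ` (\<lambda>x. 2 * pi * x) ` {0..1}" by (simp only:)
  also have "\<dots> = (\<lambda>x. h (2 * pi * x)) ` {0..1}" by (rule image_image)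
  finally show ?thesis by (simp only: path_image_def bdry_path_def)
qed

lemma has_contour_integral_bdry_path_iff:
  "(F has_contour_integral I) (bdry_path h) \<longleftrightarrow> ((\<lambda>s. F (h s) * h' s) has_integral I) {0..2*pi}"
proof -
  have "(F has_contour_integral I) (bdry_path h) \<longleftrightarrow>
     ((\<lambda>x. F (h (2*pi*x)) * vector_derivative (bdry_path h) (at x within {0..1})) has_integral I) {0..1}"
    by (simp add: has_contour_integral_def bdry_path_def)
  also have "\<dots> \<longleftrightarrow> ((\<lambda>x. (2 * pi) *\<^sub>R (F (h (2*pi*x)) * h' (2*pi*x))) has_integral I) {0..1}"
  proof (rule has_integral_cong)
    fix x :: real assume "x \<in> {0..1}"
    then have "vector_derivative (bdry_path h) (at x within {0..1}) = 2 * pi * h' (2 * pi * x)"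
      using vector_derivative_within_closed_interval[of 0 1 x "bdry_path h", OF _ _ bdry_path_deriv] by simp
    then show "F (h (2*pi*x)) * vector_derivative (bdry_path h) (at x within {0..1})
       = (2 * pi) *\<^sub>R (F (h (2*pi*x)) * h' (2*pi*x))"
      by (simp add: scaleR_conv_of_real)
  qed
  also have "\<dots> \<longleftrightarrow> ((\<lambda>x. F (h (2*pi*x)) * h' (2*pi*x)) has_integral I /\<^sub>R (2*pi)) {0..1}"
    by (rule has_integral_cmul_iff') simp
  also have "\<dots> \<longleftrightarrow> ((\<lambda>s. F (h s) * h' s) has_integral I) {0..2*pi}"
    using has_integral_affinity_iff[of "2*pi" "\<lambda>s. F (h s) * h' s" 0 I 0 "2*pi"] by simp
  finally show ?thesis .
qed

lemma contour_integral_bdry_path: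
  assumes "continuous_on (h ` {0..2*pi}) F"
  shows "contour_integral (bdry_path h) F = integral {0..2*pi} (\<lambda>s. F (h s) * h' s)"
proof -
  have "continuous_on {0..2*pi} (\<lambda>s. F (h s) * h' s)"
    by (intro continuous_intros continuous_on_subset[OF cont_deriv] continuous_on_compose2[OF assms] cont_h) auto
  then show ?thesis
    by (intro contour_integral_unique) 
      (simp add: has_contour_integral_bdry_path_iff integrable_continuous_real integrable_integral)
qed

lemma winding_number_bdry_path:
  assumes "w \<notin> h ` {0..2*pi}"
  shows "2 * pi * \<i> * winding_number (bdry_path h) w = integral {0..2*pi} (\<lambda>s. h' s / (h s - w))"
proof -
  have "winding_number (bdry_path h) w = 1 / (2 * pi * \<i>) * contour_integral (bdry_path h) (\<lambda>\<zeta>. 1 / (\<zeta> - w))"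
    using assms by (intro winding_number_valid_path valid_bdry_path) (simp add: path_image_bdry_path)
  also have "contour_integral (bdry_path h) (\<lambda>\<zeta>. 1 / (\<zeta> - w)) = integral {0..2*pi} (\<lambda>s. h' s / (h s - w))"
    using assms by (subst contour_integral_bdry_path) (auto intro!: continuous_intros)
  finally show ?thesis by simp
qed

end

section \<open>Uniform estimates along a periodic Jordan parametrization\<close>

locale smooth_jordan_curve =
  fixes g :: "real \<Rightarrow> complex"
  assumes sjp: "smooth_jordan_param g"
begin

abbreviation "g' \<equiv> vderiv g"
abbreviation "g'' \<equiv> vderiv (vderiv g)"

lemma C1_on_UNIV_vderiv: 
  assumes "h C1_differentiable_on UNIV"
  shows "(h has_vector_derivative vderiv h t) (at t)" "continuous_on S (vderiv h)"
  using assms unfolding C1_differentiable_on_eq vderiv_def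
  by (auto simp: vector_derivative_works intro: continuous_on_subset)

lemma dg: "(g has_vector_derivative g' t) (at t)"
  and dg': "(g' has_vector_derivative g'' t) (at t)"
  and cont_g': "continuous_on S g'"
  and cont_g'': "continuous_on S g''"
  using sjp by (auto simp: smooth_jordan_param_def C3_def intro!: C1_on_UNIV_vderiv)

sublocale C1_curve g g'
  by standard (rule dg cont_g')+

lemmas cont_g = cont_h

lemma per_g: "g (t + 2 * pi) = g t"
  using sjp by (simp add: smooth_jordan_param_def)

lemma g'_nz: "g' t \<noteq> 0"
  using sjp by (simp add: smooth_jordan_param_def)

lemma vderiv_periodic:
  assumes "\<And>t. h (t + 2 * pi) = h t" "\<And>t. (h has_vector_derivative vderiv h t) (at t)"
  shows "vderiv h (t + 2 * pi) = vderiv h t"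
proof -
  have "((\<lambda>t. t + 2 * pi) has_vector_derivative 1) (at t)"
    by (auto intro!: derivative_eq_intros)
  from vector_diff_chain_at[OF this assms(2)]
  have "(h has_vector_derivative vderiv h (t + 2 * pi)) (at t)"
    using assms(1) by (simp add: o_def)
  then show ?thesis using assms(2) vector_derivative_unique_at by blast
qed

lemma per_g': "g' (t + 2 * pi) = g' t"
  by (rule vderiv_periodic[OF per_g dg])

lemma per_g'': "g'' (t + 2 * pi) = g'' t"
  by (rule vderiv_periodic[OF per_g' dg'])

lemma path_g: "path (bdry_path g)" "simple_path (bdry_path g)" "pathfinish (bdry_path g) = pathstart (bdry_path g)"
  using sjp per_g[of 0] valid_bdry_path valid_path_imp_path
  by (auto simp: smooth_jordan_param_def pathfinish_def pathstart_def bdry_path_def)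

lemma range_g: "range g = g ` {0..2*pi}"
proof -
  have "g s \<in> g ` {0..2*pi}" for s
    using mod_2pi_exists[of 0 s] periodic_plus_of_int[of g, OF per_g] by force
  then show ?thesis by auto
qed

lemma path_image_g: "path_image (bdry_path g) = range g"
  by (simp add: path_image_bdry_path range_g)

text \<open>The hypothesis \<open>simple_path\<close> concerns a single period. Reducing both
  parameters to it shows that they differ by a multiple of \<open>2 * pi\<close>, and the strict
  bound leaves only the multiple 0.\<close>

lemma inj_mod: "g s = g t \<Longrightarrow> \<bar>s - t\<bar> < 2 * pi \<Longrightarrow> s = t"
proof -
  assume eq: "g s = g t" and lt: "\<bar>s - t\<bar> < 2 * pi"
  obtain \<sigma> n where \<sigma>: "0 \<le> \<sigma>" "\<sigma> < 2 * pi" "s = \<sigma> + of_int n * (2 * pi)"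
    using mod_2pi_exists[of 0 s] by auto
  obtain \<tau> m where \<tau>: "0 \<le> \<tau>" "\<tau> < 2 * pi" "t = \<tau> + of_int m * (2 * pi)"
    using mod_2pi_exists[of 0 t] by auto
  have "g \<sigma> = g \<tau>"
    using eq \<sigma>(3) \<tau>(3) periodic_plus_of_int[of g, OF per_g] by simp
  then have "bdry_path g (\<sigma> / (2*pi)) = bdry_path g (\<tau> / (2*pi))"
    by (simp add: bdry_path_def)
  moreover have "\<sigma> / (2*pi) \<in> {0..1}" "\<tau> / (2*pi) \<in> {0..1}" "\<sigma> / (2*pi) \<noteq> 1" "\<tau> / (2*pi) \<noteq> 1"
    using \<sigma> \<tau> by auto
  ultimately have "\<sigma> / (2*pi) = \<tau> / (2*pi)"
    using path_g(2) unfolding simple_path_def loop_free_def by blast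
  then have st: "\<sigma> = \<tau>" by simp
  have "s - t = of_int (n - m) * (2 * pi)"
    by (simp add: \<sigma>(3) \<tau>(3) st left_diff_distrib)
  then have "\<bar>of_int (n - m) :: real\<bar> * (2 * pi) < 1 * (2 * pi)"
    using lt by (simp add: abs_mult del: of_int_diff)
  then have "\<bar>of_int (n - m) :: real\<bar> < 1" by (rule mult_right_less_imp_less) simp
  then have "n = m" by linarith
  then show "s = t" using st \<sigma> \<tau> by simp
qed

text \<open>Brings every point of the curve within the range
  \<open>\<bar>\<sigma>\<bar> \<le> pi\<close> in which the chord estimates hold.\<close>

lemma representative: "\<exists>\<sigma>. \<bar>\<sigma>\<bar> \<le> pi \<and> (\<exists>n. s = t + \<sigma> + of_int n * (2 * pi)) \<and> g s = g (t + \<sigma>)"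
proof -
  obtain \<sigma> n where \<sigma>: "t - pi \<le> \<sigma>" "\<sigma> < t + pi" "s = \<sigma> + of_int n * (2 * pi)"
    using mod_2pi_exists[of "t - pi" s] by auto
  then show ?thesis
    using periodic_plus_of_int[of g \<sigma> n, OF per_g]
    by (intro exI[of _ "\<sigma> - t"]) auto
qed

lemma deriv_lower: "\<exists>m>0. \<forall>t. m \<le> norm (g' t)"
proof -
  have "\<exists>K>0. \<forall>t. norm (inverse (g' t)) \<le> K"
    by (rule periodic_continuous_bounded) (use g'_nz per_g' in \<open>auto intro!: continuous_intros cont_g'\<close>)
  then obtain K where K: "K > 0" "\<And>t. norm (inverse (g' t)) \<le> K" by blast
  have "1 / K \<le> norm (g' t)" for t
    using K(1) K(2)[of t] g'_nz[of t] by (simp add: norm_inverse norm_divide field_simps)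
  then show ?thesis using K(1) by (intro exI[of _ "1/K"]) auto
qed

lemma deriv_upper: "\<exists>K>0. \<forall>t. norm (g' t) \<le> K"
  by (rule periodic_continuous_bounded[OF per_g' cont_g'])

lemma taylor: "\<exists>B>0. \<forall>t \<sigma>. norm (g (t + \<sigma>) - g t - \<sigma> * g' t) \<le> B * \<sigma>\<^sup>2"
proof -
  obtain B where B: "B > 0" "\<And>t. norm (g'' t) \<le> B"
    using periodic_continuous_bounded[OF per_g'' cont_g''] by blast
  have lip: "norm (g' s - g' t) \<le> B * \<bar>s - t\<bar>" for s t
    using differentiable_bound[of UNIV g' "\<lambda>t h. h *\<^sub>R g'' t" B s t] dg' B(2)
    by (auto simp: has_vector_derivative_def onorm_scaleR_left onorm_id bounded_linear_ident)
  have "norm (g (t + \<sigma>) - g t - \<sigma> * g' t) \<le> B * \<sigma>\<^sup>2" for t \<sigma>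
  proof -
    have "norm (g (t + \<sigma>) - g t - ((t + \<sigma>) - t) *\<^sub>R g' t) \<le> norm ((t + \<sigma>) - t) * (B * \<bar>\<sigma>\<bar>)"
    proof (rule vector_differentiable_bound_linearization[where S="closed_segment t (t + \<sigma>)"])
      show "(g has_vector_derivative g' x) (at x within closed_segment t (t + \<sigma>))" for x
        by (rule has_vector_derivative_at_within[OF dg])
      show "norm (g' x - g' t) \<le> B * \<bar>\<sigma>\<bar>" if "x \<in> closed_segment t (t + \<sigma>)" for x
      proof -
        have "\<bar>x - t\<bar> \<le> \<bar>\<sigma>\<bar>" using that by (auto simp: closed_segment_eq_real_ivl split: if_splits)
        then show ?thesis using lip[of x t] B(1) by (meson order_trans mult_left_mono less_imp_le)
      qed
    qed auto
    then show ?thesis by (simp add: scaleR_conv_of_real power2_eq_square algebra_simps flip: abs_mult)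
  qed
  then show ?thesis using B(1) by blast
qed

text \<open>For small \<open>\<sigma>\<close> the linear term of \<open>taylor\<close> dominates,
  since the velocity is bounded below. For the remaining \<open>\<sigma>\<close> the chord length is
  continuous on a compact set and, by \<open>inj_mod\<close>, never zero; periodicity reduces
  \<open>t\<close> to one period.\<close>

lemma chord_arc: "\<exists>c>0. \<forall>t \<sigma>. \<bar>\<sigma>\<bar> \<le> pi \<longrightarrow> c * \<bar>\<sigma>\<bar> \<le> norm (g (t + \<sigma>) - g t)"
proof -
  obtain m where m: "m > 0" "\<And>t. m \<le> norm (g' t)" using deriv_lower by blast
  obtain B where B: "B > 0" "\<And>t \<sigma>. norm (g (t + \<sigma>) - g t - \<sigma> * g' t) \<le> B * \<sigma>\<^sup>2" using taylor by blast
  \<comment> \<open>Below this threshold the quadratic error costs at most half of the linear term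
    \<open>m * \<bar>\<sigma>\<bar>\<close>.\<close>
  define \<eta> where "\<eta> = m / (2 * B)"
  have \<eta>: "\<eta> > 0" using m B by (simp add: \<eta>_def)
  define S where "S = {0..2*pi} \<times> ({-pi..pi} - {-\<eta><..<\<eta>})"
  have "compact S" unfolding S_def by (intro compact_Times compact_diff) auto
  have near: "m / 2 * \<bar>\<sigma>\<bar> \<le> norm (g (t + \<sigma>) - g t)" if "\<bar>\<sigma>\<bar> < \<eta>" for t \<sigma>
  proof -
    have "B * \<bar>\<sigma>\<bar> \<le> m / 2" using that B(1) by (simp add: \<eta>_def field_simps)
    from mult_right_mono[OF this, of "\<bar>\<sigma>\<bar>"] have "B * \<sigma>\<^sup>2 \<le> m / 2 * \<bar>\<sigma>\<bar>"
      by (simp add: power2_eq_square mult.assoc flip: abs_mult)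
    moreover have "norm (of_real \<sigma> * g' t) - norm (g (t + \<sigma>) - g t) \<le> norm (g (t + \<sigma>) - g t - \<sigma> * g' t)"
      by (metis norm_minus_commute norm_triangle_ineq2)
    moreover have "m * \<bar>\<sigma>\<bar> \<le> norm (of_real \<sigma> * g' t)"
      using mult_right_mono[OF m(2)[of t], of "\<bar>\<sigma>\<bar>"] by (simp add: norm_mult mult.commute)
    ultimately show ?thesis using B(2)[of t \<sigma>] by linarith
  qed
  \<comment> \<open>If \<open>\<eta> > pi\<close>, the set \<open>S\<close> is empty and has no
    minimum, hence the case distinction.\<close>
  have "\<exists>\<mu>>0. \<forall>(t,\<sigma>)\<in>S. \<mu> \<le> norm (g (t + \<sigma>) - g t)"
  proof (cases "S = {}")
    case False
    have "continuous_on S (\<lambda>x. norm (g (fst x + snd x) - g (fst x)))"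
      by (intro continuous_intros continuous_on_compose2[OF cont_g[of UNIV]]) auto
    from continuous_attains_inf[OF \<open>compact S\<close> False this] obtain x where
      x: "x \<in> S" "\<And>y. y \<in> S \<Longrightarrow> norm (g (fst x + snd x) - g (fst x)) \<le> norm (g (fst y + snd y) - g (fst y))"
      by blast
    have "g (fst x + snd x) \<noteq> g (fst x)"
      using inj_mod[of "fst x + snd x" "fst x"] x(1) \<eta> pi_gt_zero by (auto simp: S_def)
    then show ?thesis using x(2) by (intro exI[of _ "norm (g (fst x + snd x) - g (fst x))"]) auto
  qed (auto intro: exI[of _ 1])
  then obtain \<mu> where \<mu>: "\<mu> > 0" "\<And>t \<sigma>. (t,\<sigma>) \<in> S \<Longrightarrow> \<mu> \<le> norm (g (t + \<sigma>) - g t)" by blast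
  define c where "c = min (m/2) (\<mu> / pi)"
  have "c * \<bar>\<sigma>\<bar> \<le> norm (g (t + \<sigma>) - g t)" if "\<bar>\<sigma>\<bar> \<le> pi" for t \<sigma>
  proof (cases "\<bar>\<sigma>\<bar> < \<eta>")
    case True
    have "c \<le> m / 2" unfolding c_def by (rule min.cobounded1)
    from mult_right_mono[OF this, of "\<bar>\<sigma>\<bar>"] have "c * \<bar>\<sigma>\<bar> \<le> m / 2 * \<bar>\<sigma>\<bar>" by simp
    then show ?thesis using near[OF True, of t] by linarith
  next
    case False
    obtain \<tau> n where \<tau>: "0 \<le> \<tau>" "\<tau> < 2 * pi" "t = \<tau> + of_int n * (2 * pi)"
      using mod_2pi_exists[of 0 t] by auto
    have "g t = g \<tau>" "g (t + \<sigma>) = g (\<tau> + \<sigma>)"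
      using \<tau>(3) periodic_plus_of_int[of g \<tau> n, OF per_g] periodic_plus_of_int[of g "\<tau> + \<sigma>" n, OF per_g]
      by (simp_all add: algebra_simps)
    moreover have "(\<tau>, \<sigma>) \<in> S" using \<tau> that False by (auto simp: S_def)
    ultimately have "\<mu> \<le> norm (g (t + \<sigma>) - g t)" using \<mu>(2) by simp
    moreover have "c * \<bar>\<sigma>\<bar> \<le> \<mu> / pi * pi" using that \<mu>(1) m(1) by (intro mult_mono) (auto simp: c_def)
    ultimately show ?thesis by simp
  qed
  moreover have "c > 0" using m \<mu> by (simp add: c_def)
  ultimately show ?thesis by blast
qed

text \<open>After division by the velocity the linear term of the chord is the real number
  \<open>\<sigma>\<close>, so the imaginary part consists of the quadratic error alone.\<close>

lemma normalized_bounds: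
  "\<exists>c>0. \<exists>B>0. \<forall>t \<sigma>. \<bar>\<sigma>\<bar> \<le> pi \<longrightarrow> c * \<bar>\<sigma>\<bar> \<le> norm ((g (t + \<sigma>) - g t) / g' t)
      \<and> \<bar>Im ((g (t + \<sigma>) - g t) / g' t)\<bar> \<le> B * \<sigma>\<^sup>2"
proof -
  obtain m where m: "m > 0" "\<And>t. m \<le> norm (g' t)" using deriv_lower by blast
  obtain K where K: "K > 0" "\<And>t. norm (g' t) \<le> K" using deriv_upper by blast
  obtain B where B: "B > 0" "\<And>t \<sigma>. norm (g (t + \<sigma>) - g t - \<sigma> * g' t) \<le> B * \<sigma>\<^sup>2" using taylor by blast
  obtain c where c: "c > 0" "\<And>t \<sigma>. \<bar>\<sigma>\<bar> \<le> pi \<Longrightarrow> c * \<bar>\<sigma>\<bar> \<le> norm (g (t + \<sigma>) - g t)"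
    using chord_arc by blast
  have "(c / K) * \<bar>\<sigma>\<bar> \<le> norm ((g (t + \<sigma>) - g t) / g' t)
      \<and> \<bar>Im ((g (t + \<sigma>) - g t) / g' t)\<bar> \<le> (B / m) * \<sigma>\<^sup>2" if s: "\<bar>\<sigma>\<bar> \<le> pi" for t \<sigma>
  proof
    have "(c * \<bar>\<sigma>\<bar>) / K \<le> norm (g (t + \<sigma>) - g t) / norm (g' t)"
      using c s K m(1) m(2)[of t] by (intro frac_le) auto
    then show "(c / K) * \<bar>\<sigma>\<bar> \<le> norm ((g (t + \<sigma>) - g t) / g' t)" by (simp add: norm_divide)
    have "\<bar>Im ((g (t + \<sigma>) - g t) / g' t)\<bar> = \<bar>Im ((g (t + \<sigma>) - g t) / g' t - \<sigma>)\<bar>" by simp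
    also have "\<dots> \<le> norm ((g (t + \<sigma>) - g t) / g' t - \<sigma>)" by (rule abs_Im_le_cmod)
    also have "(g (t + \<sigma>) - g t) / g' t - \<sigma> = (g (t + \<sigma>) - g t - \<sigma> * g' t) / g' t"
      using g'_nz[of t] by (simp add: field_simps)
    also have "norm \<dots> \<le> (B * \<sigma>\<^sup>2) / m"
      unfolding norm_divide using B m by (intro frac_le) auto
    finally show "\<bar>Im ((g (t + \<sigma>) - g t) / g' t)\<bar> \<le> (B / m) * \<sigma>\<^sup>2" by simp
  qed
  then show ?thesis using c(1) K(1) B(1) m(1) by (intro exI[of _ "c/K"] exI[of _ "B/m"] conjI) auto
qed

text \<open>
  The uniform two-sided touching disc condition: \<open>norm (\<zeta> - \<i> * \<rho>) \<ge> \<rho>\<close> as soon as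
  \<open>(norm \<zeta>)\<^sup>2 \<ge> 2 * \<rho> * Im \<zeta>\<close>, and \<open>Im \<zeta>\<close> is quadratically small.
\<close>

lemma touching_discs:
  "\<exists>\<rho>0>0. \<forall>t \<rho>. \<bar>\<rho>\<bar> \<le> \<rho>0 \<longrightarrow> ball (g t + \<i> * \<rho> * g' t) (\<bar>\<rho>\<bar> * norm (g' t)) \<inter> range g = {}"
proof -
  obtain c B where c: "c > 0" and B: "B > 0" and bd: "\<And>t \<sigma>. \<bar>\<sigma>\<bar> \<le> pi \<Longrightarrow> c * \<bar>\<sigma>\<bar> \<le> norm ((g (t + \<sigma>) - g t) / g' t)"
    "\<And>t \<sigma>. \<bar>\<sigma>\<bar> \<le> pi \<Longrightarrow> \<bar>Im ((g (t + \<sigma>) - g t) / g' t)\<bar> \<le> B * \<sigma>\<^sup>2"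
    using normalized_bounds by blast
  \<comment> \<open>The threshold is such that
    \<open>2 * \<bar>\<rho>\<bar> * B * \<sigma>^2\<close> is at most
    \<open>c^2 * \<sigma>^2\<close>, hence at most the squared normalized chord.\<close>
  have "\<bar>\<rho>\<bar> * norm (g' t) \<le> norm (g t + \<i> * \<rho> * g' t - g s)" if r: "\<bar>\<rho>\<bar> \<le> c\<^sup>2 / (2 * B)" for t \<rho> s
  proof -
    obtain \<sigma> where \<sigma>: "\<bar>\<sigma>\<bar> \<le> pi" "g s = g (t + \<sigma>)" using representative by blast
    define \<zeta> where "\<zeta> = (g (t + \<sigma>) - g t) / g' t"
    have "(c * \<bar>\<sigma>\<bar>)\<^sup>2 \<le> (norm \<zeta>)\<^sup>2" using bd(1)[OF \<sigma>(1)] c by (intro power_mono) (auto simp: \<zeta>_def)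
    moreover have "2 * \<rho> * Im \<zeta> \<le> 2 * \<bar>\<rho>\<bar> * \<bar>Im \<zeta>\<bar>" by (simp flip: abs_mult)
    moreover have "2 * \<bar>\<rho>\<bar> * \<bar>Im \<zeta>\<bar> \<le> (c\<^sup>2 / B) * (B * \<sigma>\<^sup>2)"
      using r B bd(2)[OF \<sigma>(1), of t] by (intro mult_mono) (auto simp: \<zeta>_def)
    ultimately have "2 * \<rho> * Im \<zeta> \<le> (norm \<zeta>)\<^sup>2" using B by (simp add: power_mult_distrib)
    moreover have "(norm (\<i> * \<rho> - \<zeta>))\<^sup>2 = (norm \<zeta>)\<^sup>2 - 2 * \<rho> * Im \<zeta> + \<rho>\<^sup>2"
      unfolding cmod_power2 by (simp add: power2_diff)
    ultimately have "\<bar>\<rho>\<bar>\<^sup>2 \<le> (norm (\<i> * \<rho> - \<zeta>))\<^sup>2"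
      by simp
    then have "\<bar>\<rho>\<bar> \<le> norm (\<i> * \<rho> - \<zeta>)" by (rule power2_le_imp_le) simp
    then have "\<bar>\<rho>\<bar> * norm (g' t) \<le> norm ((\<i> * \<rho> - \<zeta>) * g' t)" by (simp add: norm_mult mult_right_mono)
    also have "(\<i> * \<rho> - \<zeta>) * g' t = g t + \<i> * \<rho> * g' t - g s"
      using g'_nz[of t] by (simp add: \<zeta>_def \<sigma>(2) field_simps)
    finally show ?thesis .
  qed
  then have "ball (g t + \<i> * \<rho> * g' t) (\<bar>\<rho>\<bar> * norm (g' t)) \<inter> range g = {}" if "\<bar>\<rho>\<bar> \<le> c\<^sup>2 / (2 * B)" for t \<rho>
    using that by (force simp: dist_norm simp flip: not_less)
  moreover have "c\<^sup>2 / (2 * B) > 0" using c B by simp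
  ultimately show ?thesis by blast
qed

text \<open>At a nearest parameter the squared distance is stationary, so \<open>x - g t\<close> is
  orthogonal to \<open>g' t\<close>, that is, an imaginary multiple of it. The sign of
  \<open>\<delta>\<close> tells the side.\<close>

lemma nearest_point_normal:
  "\<exists>t \<delta>. x = g t + \<i> * of_real \<delta> * g' t \<and> (\<forall>s. \<bar>\<delta>\<bar> * norm (g' t) \<le> norm (x - g s))"
proof -
  have "\<exists>t\<in>{0..2*pi}. \<forall>s\<in>{0..2*pi}. norm (x - g t) \<le> norm (x - g s)"
    by (intro continuous_attains_inf continuous_intros cont_g) auto
  then obtain t where t: "\<And>s. s \<in> {0..2*pi} \<Longrightarrow> norm (x - g t) \<le> norm (x - g s)" by blast
  have min: "norm (x - g t) \<le> norm (x - g s)" for s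
  proof -
    obtain s' where "s' \<in> {0..2*pi}" "g s = g s'" using range_g by blast
    then show ?thesis using t by simp
  qed
  have "((\<lambda>s. (x - g s) \<bullet> (x - g s)) has_derivative (\<lambda>h. (- 2 * ((x - g t) \<bullet> g' t)) * h)) (at t)"
    using dg[of t] unfolding has_vector_derivative_def
    by (auto intro!: derivative_eq_intros simp: inner_commute)
  then have "DERIV (\<lambda>s. (x - g s) \<bullet> (x - g s)) t :> - 2 * ((x - g t) \<bullet> g' t)"
    by (simp only: has_field_derivative_def)
  then have "- 2 * ((x - g t) \<bullet> g' t) = 0"
  proof (rule DERIV_local_min[where d=1])
    show "\<forall>y. \<bar>t - y\<bar> < 1 \<longrightarrow> (x - g t) \<bullet> (x - g t) \<le> (x - g y) \<bullet> (x - g y)"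
      using min by (simp add: dot_square_norm power_mono)
  qed simp
  then have "Re ((x - g t) / g' t) = 0"
    by (simp add: Re_divide inner_complex_def flip: add_divide_distrib) algebra
  then have im: "(x - g t) / g' t = \<i> * of_real (Im ((x - g t) / g' t))"
    by (simp add: complex_eq_iff)
  then have "x = g t + \<i> * of_real (Im ((x - g t) / g' t)) * g' t"
    using g'_nz[of t] by (simp add: field_simps)
  moreover have "\<bar>Im ((x - g t) / g' t)\<bar> * norm (g' t) = norm (x - g t)"
  proof -
    have "norm ((x - g t) / g' t) = norm (\<i> * of_real (Im ((x - g t) / g' t)))"
      using arg_cong[OF im, of norm] .
    also have "\<dots> = \<bar>Im ((x - g t) / g' t)\<bar>" by (simp add: norm_mult)
    finally show ?thesis using g'_nz[of t] by (simp add: norm_divide divide_eq_eq)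
  qed
  ultimately show ?thesis using min
    by (intro exI[of _ t] exI[of _ "Im ((x - g t) / g' t)"]) simp
qed

section \<open>Normalized coordinates and Cauchy kernels at points on a normal\<close>

definition \<zeta> where "\<zeta> t0 s = (g s - g t0) / g' t0"

lemma \<zeta>_deriv: "(\<zeta> t0 has_vector_derivative g' s / g' t0) (at s within S)"
proof -
  have "((\<lambda>s. (g s - g t0) * inverse (g' t0)) has_vector_derivative (g' s - 0) * inverse (g' t0)) (at s within S)"
    by (intro has_vector_derivative_mult_left has_vector_derivative_diff has_vector_derivative_const
        has_vector_derivative_at_within[OF dg])
  then show ?thesis by (simp add: \<zeta>_def[abs_def] divide_inverse)
qed

lemma normalized_arc_\<zeta>:
  assumes "0 < t0" "t0 < 2 * pi"
  shows "normalized_arc 0 (2 * pi) t0 (\<zeta> t0)"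
proof
  show "continuous_on {0..2*pi} (\<zeta> t0)"
    unfolding \<zeta>_def[abs_def] using g'_nz by (auto intro!: continuous_intros cont_g)
  show "(\<zeta> t0 has_vector_derivative 1) (at t0)"
    using \<zeta>_deriv[of t0 t0] g'_nz by simp
  show "\<zeta> t0 s = 0 \<longleftrightarrow> s = t0" if "s \<in> {0..2*pi}" for s
    using inj_mod[of s t0] that assms g'_nz by (auto simp: \<zeta>_def)
qed (use assms in auto)

text \<open>In the coordinate \<open>\<zeta> t0\<close> the two points on the normal become
  \<open>\<i> * d\<close> and \<open>- \<i> * d\<close>, and the difference of their Cauchy kernels
  is the complex Poisson kernel of \<open>Fatou_kernel_limit\<close>.\<close>

lemma two_sided_cauchy_kernel_diff:
  assumes "d \<noteq> 0" "g s \<noteq> g t0 + \<i> * d * g' t0" "g s \<noteq> g t0 - \<i> * d * g' t0"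
  shows "1 / (g s - (g t0 + \<i> * of_real d * g' t0)) - 1 / (g s - (g t0 - \<i> * of_real d * g' t0))
     = 2 * \<i> / g' t0 * (of_real d / ((\<zeta> t0 s)\<^sup>2 + (of_real d)\<^sup>2))"
    (is "1 / (?x - (?p + ?e)) - 1 / (?x - (?p - ?e)) = _")
proof -
  have "(?x - ?p)\<^sup>2 - ?e\<^sup>2 = (?x - (?p + ?e)) * (?x - (?p - ?e))" by algebra
  then have "1 / (?x - (?p + ?e)) - 1 / (?x - (?p - ?e)) = 2 * ?e / ((?x - ?p)\<^sup>2 - ?e\<^sup>2)"
    using assms by (simp only:) (simp add: divide_simps)
  also have "(?x - ?p)\<^sup>2 - ?e\<^sup>2 = (g' t0)\<^sup>2 * ((\<zeta> t0 s)\<^sup>2 + (of_real d)\<^sup>2)"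
    using g'_nz[of t0] by (simp add: \<zeta>_def power_divide power_mult_distrib distrib_left)
  finally show ?thesis using g'_nz[of t0] by (simp add: power2_eq_square)
qed

text \<open>A regularization of twice the Cauchy kernel at the boundary point itself; its imaginary
  part leads to \<open>Nstar\<close>.\<close>

lemma two_sided_cauchy_kernel_sum:
  assumes "d \<noteq> 0" "g s \<noteq> g t0 + \<i> * d * g' t0" "g s \<noteq> g t0 - \<i> * d * g' t0"
  shows "1 / (g s - (g t0 + \<i> * of_real d * g' t0)) + 1 / (g s - (g t0 - \<i> * of_real d * g' t0))
     = 2 / g' t0 * (\<zeta> t0 s / ((\<zeta> t0 s)\<^sup>2 + (of_real d)\<^sup>2))"
    (is "1 / (?x - (?p + ?e)) + 1 / (?x - (?p - ?e)) = _")
proof -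
  have "(?x - ?p)\<^sup>2 - ?e\<^sup>2 = (?x - (?p + ?e)) * (?x - (?p - ?e))" by algebra
  then have "1 / (?x - (?p + ?e)) + 1 / (?x - (?p - ?e)) = 2 * (?x - ?p) / ((?x - ?p)\<^sup>2 - ?e\<^sup>2)"
    using assms by (simp only:) (simp add: divide_simps)
  also have "(?x - ?p)\<^sup>2 - ?e\<^sup>2 = (g' t0)\<^sup>2 * ((\<zeta> t0 s)\<^sup>2 + (of_real d)\<^sup>2)"
    using g'_nz[of t0] by (simp add: \<zeta>_def power_divide power_mult_distrib distrib_left)
  also have "?x - ?p = g' t0 * \<zeta> t0 s" using g'_nz[of t0] by (simp add: \<zeta>_def)
  finally show ?thesis using g'_nz[of t0] by (simp add: power2_eq_square)
qed

lemma off_curve: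
  assumes "ball (g t + \<i> * \<rho> * g' t) (\<bar>\<rho>\<bar> * norm (g' t)) \<inter> range g = {}" "\<rho> \<noteq> 0"
  shows "g t + \<i> * \<rho> * g' t \<notin> range g"
proof -
  have "0 < \<bar>\<rho>\<bar> * norm (g' t)" using assms(2) g'_nz by simp
  then have "g t + \<i> * \<rho> * g' t \<in> ball (g t + \<i> * \<rho> * g' t) (\<bar>\<rho>\<bar> * norm (g' t))" by simp
  then show ?thesis using assms(1) by blast
qed

lemma normal_off_curve: "\<exists>\<rho>0>0. \<forall>t \<rho>. \<bar>\<rho>\<bar> \<le> \<rho>0 \<and> \<rho> \<noteq> 0 \<longrightarrow> g t + \<i> * of_real \<rho> * g' t \<notin> range g"
proof -
  obtain \<rho>0 where "\<rho>0 > 0" "\<And>t \<rho>. \<bar>\<rho>\<bar> \<le> \<rho>0 \<Longrightarrow> ball (g t + \<i> * \<rho> * g' t) (\<bar>\<rho>\<bar> * norm (g' t)) \<inter> range g = {}"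
    using touching_discs by blast
  then show ?thesis using off_curve by (intro exI[of _ \<rho>0]) simp
qed

text \<open>The case \<open>\<theta> = \<zeta>\<close> of the kernel limit; the difference of the winding numbers is an integer.\<close>

lemma winding_number_jump:
  "\<forall>\<^sub>F \<delta> in at_right 0. winding_number (bdry_path g) (g pi + \<i> * of_real \<delta> * g' pi)
     - winding_number (bdry_path g) (g pi - \<i> * of_real \<delta> * g' pi) = 1"
proof -
  obtain \<rho>0 where \<rho>0: "\<rho>0 > 0" "\<And>t \<rho>. \<bar>\<rho>\<bar> \<le> \<rho>0 \<Longrightarrow> \<rho> \<noteq> 0 \<Longrightarrow> g t + \<i> * of_real \<rho> * g' t \<notin> range g"
    using normal_off_curve by blast
  \<comment> \<open>The parameter \<open>pi\<close> is just a fixed interior point of the interval;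
    the jump propagates along the whole curve by connectedness in
    \<open>strip_sides\<close>.\<close>
  interpret arc: normalized_arc 0 "2 * pi" pi "\<zeta> pi"
    by (rule normalized_arc_\<zeta>) auto
  define n where "n w = winding_number (bdry_path g) w" for w
  have "((\<lambda>\<delta>. integral {0..2*pi} (\<lambda>s. g' s / g' pi * (of_real \<delta> / ((\<zeta> pi s)\<^sup>2 + (of_real \<delta>)\<^sup>2))))
       \<longlongrightarrow> of_real pi * (g' pi / g' pi)) (at_right 0)"
    by (rule arc.Fatou_kernel_limit[where \<theta>="\<zeta> pi" and \<zeta>'="\<lambda>s. g' s / g' pi"])
       (use g'_nz in \<open>auto intro!: \<zeta>_deriv continuous_intros cont_g'\<close>)
  from tendsto_mult_left[OF this, of "1 / pi"]
  have lim: "((\<lambda>\<delta>. 1 / pi * integral {0..2*pi} (\<lambda>s. g' s / g' pi * (of_real \<delta> / ((\<zeta> pi s)\<^sup>2 + (of_real \<delta>)\<^sup>2))))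
     \<longlongrightarrow> 1) (at_right 0)"
    using g'_nz by simp
  have ev: "\<forall>\<^sub>F \<delta> in at_right (0::real). 0 < \<delta> \<and> \<delta> \<le> \<rho>0"
    using \<rho>0(1) eventually_at_right[of 0 \<rho>0] by (metis (mono_tags, lifting) less_le)
  have off: "g pi + \<i> * of_real \<delta> * g' pi \<notin> range g" "g pi - \<i> * of_real \<delta> * g' pi \<notin> range g" 
    if "0 < \<delta> \<and> \<delta> \<le> \<rho>0" for \<delta>
    using that \<rho>0(2)[of \<delta> pi] \<rho>0(2)[of "-\<delta>" pi] by auto
  have eq: "1 / pi * integral {0..2*pi} (\<lambda>s. g' s / g' pi * (of_real \<delta> / ((\<zeta> pi s)\<^sup>2 + (of_real \<delta>)\<^sup>2)))
     = n (g pi + \<i> * of_real \<delta> * g' pi) - n (g pi - \<i> * of_real \<delta> * g' pi)" (is "_ = n ?a - n ?b")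
    if d: "0 < \<delta> \<and> \<delta> \<le> \<rho>0" for \<delta>
  proof -
    have nz: "g s \<noteq> ?a" "g s \<noteq> ?b" for s using off[OF d] by (metis rangeI)+
    have "2 * pi * \<i> * (n ?a - n ?b) = integral {0..2*pi} (\<lambda>s. g' s / (g s - ?a)) - integral {0..2*pi} (\<lambda>s. g' s / (g s - ?b))"
      using winding_number_bdry_path[of ?a] winding_number_bdry_path[of ?b] off[OF d]
      by (simp add: n_def range_g right_diff_distrib)
    also have "\<dots> = integral {0..2*pi} (\<lambda>s. g' s / (g s - ?a) - g' s / (g s - ?b))"
      using nz by (intro Henstock_Kurzweil_Integration.integral_diff[symmetric] integrable_continuous_real 
          continuous_intros cont_g cont_g') auto
    also have "\<dots> = integral {0..2*pi} (\<lambda>s. 2 * \<i> * (g' s / g' pi * (of_real \<delta> / ((\<zeta> pi s)\<^sup>2 + (of_real \<delta>)\<^sup>2))))"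
    proof (rule Henstock_Kurzweil_Integration.integral_cong)
      fix s
      have "g' s / (g s - ?a) - g' s / (g s - ?b) = g' s * (1 / (g s - ?a) - 1 / (g s - ?b))"
        by (simp add: right_diff_distrib)
      also have "\<dots> = g' s * (2 * \<i> / g' pi * (of_real \<delta> / ((\<zeta> pi s)\<^sup>2 + (of_real \<delta>)\<^sup>2)))"
        using two_sided_cauchy_kernel_diff[of \<delta> s pi] nz[of s] d by simp
      finally show "g' s / (g s - ?a) - g' s / (g s - ?b) = 2 * \<i> * (g' s / g' pi * (of_real \<delta> / ((\<zeta> pi s)\<^sup>2 + (of_real \<delta>)\<^sup>2)))"
        by simp
    qed
    also have "\<dots> = 2 * \<i> * integral {0..2*pi} (\<lambda>s. g' s / g' pi * (of_real \<delta> / ((\<zeta> pi s)\<^sup>2 + (of_real \<delta>)\<^sup>2)))"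
      by (rule integral_mult_right)
    finally have I: "2 * pi * \<i> * (n ?a - n ?b) = 2 * \<i> * integral {0..2*pi} (\<lambda>s. g' s / g' pi * (of_real \<delta> / ((\<zeta> pi s)\<^sup>2 + (of_real \<delta>)\<^sup>2)))" .
    have "X = Y / pi" if "2 * pi * \<i> * X = 2 * \<i> * Y" for X Y :: complex
      using that by (simp add: field_simps)
    from this[OF I] show ?thesis by simp
  qed
  have "((\<lambda>\<delta>. n (g pi + \<i> * of_real \<delta> * g' pi) - n (g pi - \<i> * of_real \<delta> * g' pi)) \<longlongrightarrow> 1) (at_right 0)"
    by (rule Lim_transform_eventually[OF lim]) (rule eventually_mono[OF ev], rule eq)
  then have "\<forall>\<^sub>F \<delta> in at_right 0. dist (n (g pi + \<i> * of_real \<delta> * g' pi) - n (g pi - \<i> * of_real \<delta> * g' pi)) 1 < 1"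
    by (rule tendstoD) simp
  with ev show ?thesis
  proof eventually_elim
    case (elim \<delta>)
    have "n (g pi + \<i> * of_real \<delta> * g' pi) - n (g pi - \<i> * of_real \<delta> * g' pi) - 1 \<in> \<int>"
      using off[OF elim(1)] by (auto simp: n_def intro!: Ints_diff integer_winding_number path_g simp: path_image_g)
    from Ints_cases[OF this] obtain k where k: "n (g pi + \<i> * of_real \<delta> * g' pi) - n (g pi - \<i> * of_real \<delta> * g' pi) - 1 = of_int k"
      by blast
    then have "\<bar>of_int k :: real\<bar> < 1" using elim(2) by (simp add: dist_norm)
    then have "k = 0" by linarith
    then show ?case using k by (simp add: n_def)
  qed
qed

end

section \<open>Sides of the boundary and winding numbers\<close>

lemma uniform_positive_bound:
  fixes P :: "nat \<Rightarrow> real \<Rightarrow> bool"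
  assumes "\<And>j. j \<le> M \<Longrightarrow> \<exists>d>0. P j d"
    and anti: "\<And>j d e. P j d \<Longrightarrow> 0 < e \<Longrightarrow> e \<le> d \<Longrightarrow> P j e"
  shows "\<exists>d>0. \<forall>j\<le>M. P j d"
proof -
  obtain D where D: "\<And>j. j \<le> M \<Longrightarrow> D j > 0 \<and> P j (D j)" using assms(1) by metis
  define d where "d = Min (D ` {..M})"
  have "d > 0" unfolding d_def using D by (subst Min_gr_iff) auto
  moreover have "P j d" if "j \<le> M" for j
    using that D[OF that] \<open>d > 0\<close> anti[of j "D j" d] by (auto simp: d_def intro!: Min_le)
  ultimately show ?thesis by blast
qed

section \<open>Position of the region relative to its boundary curves\<close>

locale mc_region =
  fixes \<Omega> :: "complex set" and M :: nat and z :: "nat \<Rightarrow> real \<Rightarrow> complex"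
  assumes mcr: "bounded_mc_region \<Omega> M z"
begin

abbreviation "z' j \<equiv> vderiv (z j)"
abbreviation "z'' j \<equiv> vderiv (vderiv (z j))"
abbreviation "wn j \<equiv> winding_number (bdry_path (z j))"
abbreviation "touching_discs_clear d \<equiv> \<forall>j\<le>M. \<forall>t \<rho>. \<bar>\<rho>\<bar> \<le> d \<longrightarrow>
  ball (z j t + \<i> * of_real \<rho> * z' j t) (\<bar>\<rho>\<bar> * norm (z' j t)) \<inter> frontier \<Omega> = {}"

lemma open_\<Omega>: "open \<Omega>" and connected_\<Omega>: "connected \<Omega>" and bounded_\<Omega>: "bounded \<Omega>" and nonempty_\<Omega>: "\<Omega> \<noteq> {}"
  using mcr by (auto simp: bounded_mc_region_def)

lemma curve: "j \<le> M \<Longrightarrow> smooth_jordan_curve (z j)"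
  using mcr by (auto simp: bounded_mc_region_def smooth_jordan_curve_def)

lemma path_image_z: "j \<le> M \<Longrightarrow> path_image (bdry_path (z j)) = range (z j)"
  by (rule smooth_jordan_curve.path_image_g[OF curve])

lemma frontier_eq: "frontier \<Omega> = (\<Union>j\<le>M. range (z j))"
  using mcr path_image_z by (auto simp: bounded_mc_region_def)

lemma disjoint_curves: "j \<le> M \<Longrightarrow> k \<le> M \<Longrightarrow> j \<noteq> k \<Longrightarrow> range (z j) \<inter> range (z k) = {}"
proof -
  assume jk: "j \<le> M" "k \<le> M" "j \<noteq> k"
  then have "path_image (bdry_path (z j)) \<inter> path_image (bdry_path (z k)) = {}"
    using mcr unfolding bounded_mc_region_def by blast
  then show ?thesis using jk by (simp add: path_image_z)
qed

lemma inside_outer: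
  assumes "1 \<le> j" "j \<le> M"
  shows "range (z j) \<subseteq> inside (range (z 0))"
proof -
  have "path_image (bdry_path (z j)) \<subseteq> inside (path_image (bdry_path (z 0)))"
    using mcr assms unfolding bounded_mc_region_def by (meson atLeastAtMost_iff)
  then show ?thesis using assms by (simp add: path_image_z)
qed

lemma winding_outer:
  assumes "w \<in> inside (range (z 0))"
  shows "wn 0 w = 1"
proof -
  have "\<forall>w\<in>inside (path_image (bdry_path (z 0))). wn 0 w = 1"
    using mcr unfolding bounded_mc_region_def by blast
  then show ?thesis using assms by (simp add: path_image_z)
qed

lemma winding_inner:
  assumes "1 \<le> j" "j \<le> M" "w \<in> inside (range (z j))"
  shows "wn j w = - 1"
proof -
  have "\<forall>w\<in>inside (path_image (bdry_path (z j))). wn j w = - 1"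
    using mcr assms(1,2) unfolding bounded_mc_region_def by (meson atLeastAtMost_iff)
  then show ?thesis using assms by (simp add: path_image_z)
qed

lemma jordan:
  assumes "j \<le> M"
  shows "open (inside (range (z j)))" "connected (inside (range (z j)))"
    "open (outside (range (z j)))" "connected (outside (range (z j)))"
    "\<not> bounded (outside (range (z j)))" "bounded (inside (range (z j)))"
    "frontier (inside (range (z j))) = range (z j)" "frontier (outside (range (z j))) = range (z j)"
  using Jordan_inside_outside[of "bdry_path (z j)"] smooth_jordan_curve.path_g[OF curve[OF assms]]
  unfolding path_image_z[OF assms] by auto

lemma range_in_frontier: "j \<le> M \<Longrightarrow> z j t \<in> frontier \<Omega>"
  by (auto simp: frontier_eq)

lemma \<Omega>_frontier_disjoint: "\<Omega> \<inter> frontier \<Omega> = {}"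
  using frontier_disjoint_eq[of \<Omega>] open_\<Omega> by (simp add: Int_commute)

lemma compact_range: "j \<le> M \<Longrightarrow> compact (range (z j))"
  using smooth_jordan_curve.path_g(1)[OF curve] path_image_z by (metis compact_path_image)

lemma winding_number_const:
  assumes "j \<le> M" "connected S" "S \<inter> range (z j) = {}" "x \<in> S" "y \<in> S"
  shows "wn j x = wn j y"
  using assms smooth_jordan_curve.path_g[OF curve[OF assms(1)]]
  by (intro winding_number_eq[where S=S]) (auto simp: path_image_z)

lemma winding_number_outside: "j \<le> M \<Longrightarrow> w \<in> outside (range (z j)) \<Longrightarrow> wn j w = 0"
  using smooth_jordan_curve.path_g[OF curve] by (intro winding_number_zero_in_outside) (auto simp: path_image_z)

text \<open>The outside of the outer curve is connected and misses the whole frontier, so it is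
  either contained in \<open>\<Omega>\<close> or disjoint from it. Being unbounded, it is not
  contained.\<close>

lemma \<Omega>_inside_outer: "\<Omega> \<subseteq> inside (range (z 0))"
proof -
  let ?O = "outside (range (z 0))"
  have "frontier \<Omega> \<inter> ?O = {}"
  proof -
    have "range (z j) \<inter> ?O = {}" if "j \<le> M" for j
    proof (cases "j = 0")
      case True then show ?thesis using outside_no_overlap by blast
    next
      case False
      then have "range (z j) \<subseteq> inside (range (z 0))" using inside_outer[of j] that by simp
      then show ?thesis using inside_Int_outside[of "range (z 0)"] by blast
    qed
    then show ?thesis by (auto simp: frontier_eq)
  qed
  moreover have "\<not> ?O \<subseteq> \<Omega>"
    using bounded_\<Omega> jordan(5)[of 0] bounded_subset by blast
  ultimately have "?O \<inter> \<Omega> = {}"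
    using connected_Int_frontier[of ?O \<Omega>] jordan(4)[of 0] by blast
  moreover have "\<Omega> \<inter> range (z 0) = {}"
    using \<Omega>_frontier_disjoint frontier_eq by blast
  ultimately show ?thesis using inside_Un_outside[of "range (z 0)"] by blast
qed

text \<open>If \<open>\<Omega>\<close> met the inside of an inner curve, it would lie there
  entirely, and so would the outer curve as part of its frontier. But the outside of the outer curve
  is unbounded and misses the inner curve, so neither it nor its frontier, the outer curve, reaches
  that inside.\<close>

lemma \<Omega>_outside_inner:
  assumes j: "1 \<le> j" "j \<le> M"
  shows "\<Omega> \<subseteq> outside (range (z j))"
proof -
  let ?I = "inside (range (z j))" and ?O = "outside (range (z 0))"
  have dj: "\<Omega> \<inter> range (z j) = {}"
    using \<Omega>_frontier_disjoint frontier_eq j by blast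
  have "\<Omega> \<inter> ?I = {}"
  proof (rule ccontr)
    assume "\<Omega> \<inter> ?I \<noteq> {}"
    then have "\<Omega> \<subseteq> ?I"
      using connected_Int_frontier[OF connected_\<Omega>, of ?I] jordan(7)[OF j(2)] dj by blast
    then have "closure \<Omega> \<subseteq> ?I \<union> range (z j)"
      using closure_mono[of \<Omega> ?I] jordan(1,7)[OF j(2)] closure_Un_frontier[of ?I] by blast
    then have z0: "range (z 0) \<subseteq> ?I"
      using disjoint_curves[of 0 j] j range_in_frontier[of 0] by (auto simp: frontier_def)
    have "?O \<inter> range (z j) = {}"
      using inside_outer[OF j] inside_Int_outside[of "range (z 0)"] by blast
    then have "?O \<inter> ?I = {}"
      using connected_Int_frontier[of ?O ?I] jordan(4,5)[of 0] jordan(6,7)[OF j(2)] bounded_subset by blast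
    then have "closure ?O \<inter> ?I = {}"
      using jordan(1)[OF j(2)] by (metis inf_commute open_Int_closure_eq_empty)
    moreover have "range (z 0) \<subseteq> closure ?O" using jordan(8)[of 0] by (auto simp: frontier_def)
    ultimately show False using z0 by blast
  qed
  then show ?thesis using dj inside_Un_outside[of "range (z j)"] by blast
qed

text \<open>For the curve itself this is \<open>touching_discs\<close>. The other curves stay at a
  distance \<open>r\<close> by compactness, and \<open>\<bar>\<rho>\<bar> \<le> r / (2 * K)\<close>
  makes the diameter of the disc at most \<open>r\<close>.\<close>

lemma touching_discs_frontier:
  "\<exists>d>0. touching_discs_clear d"
proof (rule uniform_positive_bound)
  fix j assume j: "j \<le> M"
  interpret smooth_jordan_curve "z j" by (rule curve[OF j])
  obtain \<rho>0 where \<rho>0: "\<rho>0 > 0" "\<And>t \<rho>. \<bar>\<rho>\<bar> \<le> \<rho>0 \<Longrightarrow> ball (z j t + \<i> * of_real \<rho> * z' j t) (\<bar>\<rho>\<bar> * norm (z' j t)) \<inter> range (z j) = {}"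
    using touching_discs by blast
  obtain K where K: "K > 0" "\<And>t. norm (z' j t) \<le> K" using deriv_upper by blast
  define R where "R = (\<Union>k\<in>{..M} - {j}. range (z k))"
  have "compact R" unfolding R_def by (intro compact_UN) (auto intro: compact_range)
  moreover have "range (z j) \<inter> R = {}" using disjoint_curves[OF j] by (fastforce simp: R_def)
  ultimately obtain r where r: "r > 0" "\<And>x y. x \<in> range (z j) \<Longrightarrow> y \<in> R \<Longrightarrow> r \<le> dist x y"
    using separate_compact_closed[of "range (z j)" R] compact_range[OF j] compact_imp_closed by blast
  have "ball (z j t + \<i> * of_real \<rho> * z' j t) (\<bar>\<rho>\<bar> * norm (z' j t)) \<inter> frontier \<Omega> = {}"
    if "\<bar>\<rho>\<bar> \<le> min \<rho>0 (r / (2 * K))" for t \<rho>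
  proof -
    let ?c = "z j t + \<i> * of_real \<rho> * z' j t"
    have "y \<notin> R" if y: "y \<in> ball ?c (\<bar>\<rho>\<bar> * norm (z' j t))" for y
    proof
      assume "y \<in> R"
      then have "r \<le> dist (z j t) y" using r by blast
      also have "\<dots> \<le> dist (z j t) ?c + dist ?c y" by (rule dist_triangle)
      also have "dist (z j t) ?c = \<bar>\<rho>\<bar> * norm (z' j t)" by (simp add: dist_norm norm_mult)
      also have "\<bar>\<rho>\<bar> * norm (z' j t) + dist ?c y < 2 * (\<bar>\<rho>\<bar> * norm (z' j t))" using y by simp
      also have "\<dots> \<le> 2 * (r / (2 * K) * K)"
        using that K r \<open>\<bar>\<rho>\<bar> \<le> min \<rho>0 (r / (2 * K))\<close> by (intro mult_left_mono mult_mono) auto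
      also have "\<dots> = r" using K(1) by simp
      finally show False by simp
    qed
    moreover have "frontier \<Omega> = range (z j) \<union> R" using j by (auto simp: frontier_eq R_def)
    ultimately show ?thesis using \<rho>0(2)[of \<rho> t] \<open>\<bar>\<rho>\<bar> \<le> min \<rho>0 (r / (2 * K))\<close> by auto
  qed
  then show "\<exists>d>0. \<forall>t \<rho>. \<bar>\<rho>\<bar> \<le> d \<longrightarrow> ball (z j t + \<i> * of_real \<rho> * z' j t) (\<bar>\<rho>\<bar> * norm (z' j t)) \<inter> frontier \<Omega> = {}"
    using \<rho>0(1) r(1) K(1) by (intro exI[of _ "min \<rho>0 (r / (2 * K))"]) simp
qed force

lemma normal_off_frontier:
  assumes d: "touching_discs_clear d"
    and j: "j \<le> M" and r: "\<rho> \<noteq> 0" "\<bar>\<rho>\<bar> \<le> d"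
  shows "z j t + \<i> * of_real \<rho> * z' j t \<notin> frontier \<Omega>"
proof -
  have "0 < \<bar>\<rho>\<bar> * norm (z' j t)" using r smooth_jordan_curve.g'_nz[OF curve[OF j]] by simp
  then have "z j t + \<i> * of_real \<rho> * z' j t \<in> ball (z j t + \<i> * of_real \<rho> * z' j t) (\<bar>\<rho>\<bar> * norm (z' j t))" by simp
  then show ?thesis using d j r by blast
qed

section \<open>One-sided strips along the boundary curves\<close>

definition strip :: "nat \<Rightarrow> real set \<Rightarrow> complex set" where
  "strip j D = (\<lambda>(t, \<delta>). z j t + \<i> * of_real \<delta> * z' j t) ` (UNIV \<times> D)"

lemma strip_I: "\<delta> \<in> D \<Longrightarrow> z j t + \<i> * of_real \<delta> * z' j t \<in> strip j D"
  by (force simp: strip_def)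

lemma connected_strip:
  assumes "j \<le> M" "connected D"
  shows "connected (strip j D)"
proof -
  interpret smooth_jordan_curve "z j" by (rule curve[OF assms(1)])
  show ?thesis unfolding strip_def case_prod_beta
    by (intro connected_continuous_image continuous_intros continuous_on_compose2[OF cont_g[of UNIV]]
        continuous_on_compose2[OF cont_g'[of UNIV]] connected_Times assms(2)) auto
qed

text \<open>By \<open>nearest_point_normal\<close> every point off the curve lies on a normal, at a
  parameter \<open>\<delta>\<close> with \<open>\<bar>\<delta>\<bar> * norm (z' j s)\<close> no
  larger than its distance from the curve. A lower bound \<open>m\<close> for the velocity turns the
  radius \<open>m * d\<close> into \<open>\<bar>\<delta>\<bar> < d\<close>.\<close>

lemma near_curve_in_strips:
  assumes j: "j \<le> M" and d: "d > 0"
  shows "\<exists>e>0. \<forall>t x. dist x (z j t) < e \<longrightarrow> x \<notin> range (z j) \<longrightarrow> x \<in> strip j {0<..d} \<union> strip j {-d..<0}"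
proof -
  interpret smooth_jordan_curve "z j" by (rule curve[OF j])
  obtain m where m: "m > 0" "\<And>t. m \<le> norm (z' j t)" using deriv_lower by blast
  have "x \<in> strip j {0<..d} \<union> strip j {-d..<0}" if x: "dist x (z j t) < m * d" "x \<notin> range (z j)" for x t
  proof -
    obtain s \<delta> where s: "x = z j s + \<i> * of_real \<delta> * z' j s" "\<And>u. \<bar>\<delta>\<bar> * norm (z' j s) \<le> norm (x - z j u)"
      using nearest_point_normal by blast
    have "m * \<bar>\<delta>\<bar> \<le> \<bar>\<delta>\<bar> * norm (z' j s)" using mult_right_mono[OF m(2), of "\<bar>\<delta>\<bar>" s] by (simp add: mult.commute)
    also have "\<dots> < m * d" using s(2)[of t] x(1) by (simp add: dist_norm)
    finally have "\<bar>\<delta>\<bar> < d" using m(1) by simp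
    moreover have "\<delta> \<noteq> 0" using s(1) x(2) by auto
    ultimately have "\<delta> \<in> {0<..d} \<union> {-d..<0}" by auto
    then show ?thesis unfolding s(1) using strip_I by blast
  qed
  then show ?thesis using m(1) d by (intro exI[of _ "m * d"]) auto
qed

text \<open>Here the orientation enters. Both strips are connected and miss the frontier, and the
  winding number is larger by 1 on the positive one. If the negative strip met
  \<open>\<Omega>\<close>, the positive one would have winding number 2 for the outer curve, which
  is impossible for a simple curve, and 1 for an inner curve, whose only values are 0 and -1. Since
  points of \<open>\<Omega>\<close> come arbitrarily close to the curve, they must lie in the
  positive strip.\<close>

lemma strip_sides:
  assumes d0: "d > 0"
    and d: "touching_discs_clear d"
    and j: "j \<le> M"
  shows "strip j {0<..d} \<subseteq> \<Omega>" "strip j {-d..<0} \<inter> closure \<Omega> = {}"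
proof -
  interpret smooth_jordan_curve "z j" by (rule curve[OF j])
  let ?P = "strip j {0<..d}" and ?N = "strip j {-d..<0}"
  let ?n = "wn j"
  have fP: "?P \<inter> frontier \<Omega> = {}" and fN: "?N \<inter> frontier \<Omega> = {}"
    using normal_off_frontier[OF d j] by (auto simp: strip_def)
  have cP: "connected ?P" and cN: "connected ?N" by (intro connected_strip j connected_Ioc connected_Ico)+
  have rP: "?P \<inter> range (z j) = {}" and rN: "?N \<inter> range (z j) = {}"
    using fP fN j by (auto simp: frontier_eq)
  have jump: "?n x = ?n y + 1" if "x \<in> ?P" "y \<in> ?N" for x y
  proof -
    have "\<forall>\<^sub>F \<delta> in at_right (0::real). 0 < \<delta> \<and> \<delta> \<le> d"
      using d0 by (intro eventually_at_rightI[where b=d]) auto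
    from eventually_happens[OF eventually_conj[OF this winding_number_jump]]
    obtain \<delta> where \<delta>: "0 < \<delta>" "\<delta> \<le> d" "?n (z j pi + \<i> * of_real \<delta> * z' j pi) - ?n (z j pi - \<i> * of_real \<delta> * z' j pi) = 1"
      by auto
    have "z j pi + \<i> * of_real \<delta> * z' j pi \<in> ?P" using \<delta> by (intro strip_I) auto
    moreover have "z j pi - \<i> * of_real \<delta> * z' j pi \<in> ?N"
      using \<delta> strip_I[of "-\<delta>" "{-d..<0}" j pi] by auto
    ultimately have "?n x - ?n y = 1"
      using \<delta>(3) winding_number_const[OF j cP rP that(1)] winding_number_const[OF j cN rN that(2)] by metis
    then show ?thesis by (simp add: algebra_simps)
  qed
  have cases: "?n x \<in> {-1,0,1}" if "x \<notin> range (z j)" for x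
    using simple_closed_path_winding_number_cases[of "bdry_path (z j)" x] path_g that path_image_g by auto
  have Pne: "z j pi + \<i> * of_real d * z' j pi \<in> ?P" (is "?p \<in> _") using d0 by (intro strip_I) auto
  have N: "?N \<inter> \<Omega> = {}"
  proof (rule ccontr)
    assume "?N \<inter> \<Omega> \<noteq> {}"
    then obtain x where x: "x \<in> ?N" "x \<in> \<Omega>" by blast
    have np: "?n ?p = ?n x + 1" using jump Pne x(1) by blast
    have pj: "?p \<notin> range (z j)" using rP Pne by blast
    show False
    proof (cases "j = 0")
      case True
      then have "?n x = 1" using \<Omega>_inside_outer x(2) winding_outer by blast
      then show False using np cases[OF pj] by auto
    next
      case False
      then have "x \<in> outside (range (z j))" using \<Omega>_outside_inner[of j] j x(2) by auto
      then have "?n ?p = 1" using np winding_number_outside[OF j] by simp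
      moreover have "?p \<in> inside (range (z j)) \<or> ?p \<in> outside (range (z j))"
        using pj inside_Un_outside[of "range (z j)"] by blast
      ultimately show False
        using winding_inner[of j ?p] winding_number_outside[OF j, of ?p] False j by auto
    qed
  qed
  show "?N \<inter> closure \<Omega> = {}" using N fN by (auto simp: closure_Un_frontier)
  obtain e where e: "e > 0" "\<And>t x. dist x (z j t) < e \<Longrightarrow> x \<notin> range (z j) \<Longrightarrow> x \<in> ?P \<union> ?N"
    using near_curve_in_strips[OF j d0] by blast
  have "z j 0 \<in> closure \<Omega>" using range_in_frontier[OF j] by (auto simp: frontier_def)
  then obtain x where x: "x \<in> \<Omega>" "dist x (z j 0) < e" using e(1) closure_approachable by blast
  have "x \<notin> range (z j)" using x(1) \<Omega>_frontier_disjoint j by (auto simp: frontier_eq)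
  then have "x \<in> ?P \<inter> \<Omega>" using e(2) x N by blast
  then show "?P \<subseteq> \<Omega>" using connected_Int_frontier[OF cP, of \<Omega>] fP by blast
qed

lemma sum_winding_inside:
  assumes "w \<in> \<Omega>"
  shows "(\<Sum>j\<le>M. wn j w) = 1"
proof -
  have "(\<Sum>j\<le>M. wn j w) = (\<Sum>j\<le>M. if j = 0 then 1 else 0)"
  proof (rule sum.cong)
    fix j assume "j \<in> {..M}"
    then show "wn j w = (if j = 0 then 1 else 0)"
      using winding_outer[of w] \<Omega>_inside_outer winding_number_outside[of j w] \<Omega>_outside_inner[of j] assms
      by (cases "j = 0") auto
  qed simp
  then show ?thesis by simp
qed

text \<open>The sum is constant on connected sets that miss the frontier. From \<open>w\<close> one
  moves within a disc to a point near the closure, which lies in a negative strip, then along that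
  strip, and finally across the curve into \<open>\<Omega>\<close>. Only the crossed curve changes
  its winding number, by 1, and in \<open>\<Omega>\<close> the sum is 1.\<close>

lemma sum_winding_outside:
  assumes w: "w \<notin> closure \<Omega>"
  shows "(\<Sum>j\<le>M. wn j w) = 0"
proof -
  obtain d where d0: "d > 0"
    and d: "touching_discs_clear d"
    using touching_discs_frontier by blast
  obtain y where y: "y \<in> closure \<Omega>" "\<And>x. x \<in> closure \<Omega> \<Longrightarrow> dist w y \<le> dist w x"
    using distance_attains_inf[of "closure \<Omega>" w] nonempty_\<Omega> by auto
  define B where "B = ball w (dist w y)"
  have wy: "dist w y > 0" using w y(1) by auto
  have B: "B \<inter> closure \<Omega> = {}" "w \<in> B" using y(2) wy by (force simp: B_def)+
  have yB: "y \<in> closure B" using wy by (simp add: B_def)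
  have "y \<notin> \<Omega>"
    using open_\<Omega> B(1) yB by (metis closure_subset disjoint_iff inf_commute open_Int_closure_eq_empty subsetD)
  then have "y \<in> frontier \<Omega>" using y(1) open_\<Omega> by (simp add: frontier_def interior_open)
  then obtain j t where j: "j \<le> M" "y = z j t" by (auto simp: frontier_eq)
  interpret smooth_jordan_curve "z j" by (rule curve[OF j(1)])
  let ?P = "strip j {0<..d}" and ?N = "strip j {-d..<0}"
  note sides = strip_sides[OF d0 d j(1)]
  obtain e where e: "e > 0" "\<And>t x. dist x (z j t) < e \<Longrightarrow> x \<notin> range (z j) \<Longrightarrow> x \<in> ?P \<union> ?N"
    using near_curve_in_strips[OF j(1) d0] by blast
  obtain x where x: "x \<in> B" "dist x y < e" using yB e(1) closure_approachable by blast
  have fr: "frontier \<Omega> \<subseteq> closure \<Omega>" by (simp add: frontier_def)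
  have Bfr: "B \<inter> range (z k) = {}" if "k \<le> M" for k
    using B(1) fr range_in_frontier[OF that] by blast
  have xN: "x \<in> ?N"
    using e(2)[of x t] x Bfr[OF j(1)] sides(1) B(1) closure_subset[of \<Omega>] by (auto simp: j(2))
  \<comment> \<open>The jump is known at the parameter \<open>pi\<close>, so the crossing takes
    place there, in a disc that avoids all other curves.\<close>
  let ?U = "- (\<Union>k\<in>{..M} - {j}. range (z k))"
  have oU: "open ?U"
    by (intro open_Compl closed_UN) (auto intro: compact_range compact_imp_closed)
  have "z j pi \<notin> range (z k)" if "k \<in> {..M} - {j}" for k
    using disjoint_curves[OF j(1), of k] that by blast
  then have "z j pi \<in> ?U" by blast
  then obtain r where r: "r > 0" "ball (z j pi) r \<subseteq> ?U" by (rule openE[OF oU])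
  have "\<forall>\<^sub>F \<delta> in at_right (0::real). 0 < \<delta> \<and> \<delta> \<le> d \<and> \<delta> < r / norm (z' j pi)"
  proof -
    have "0 < min d (r / norm (z' j pi))" using d0 r(1) g'_nz by simp
    then show ?thesis
      by (rule eventually_at_rightI[rotated]) (simp only: greaterThanLessThan_iff min_less_iff_conj less_imp_le simp_thms)
  qed
  from eventually_happens[OF eventually_conj[OF this winding_number_jump]]
  obtain \<delta> where \<delta>: "0 < \<delta>" "\<delta> \<le> d" "\<delta> < r / norm (z' j pi)"
    "wn j (z j pi + \<i> * of_real \<delta> * z' j pi)
      - wn j (z j pi - \<i> * of_real \<delta> * z' j pi) = 1"
    by auto
  let ?a = "z j pi + \<i> * of_real \<delta> * z' j pi" and ?b = "z j pi - \<i> * of_real \<delta> * z' j pi"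
  have bN: "?b \<in> ?N" using \<delta> strip_I[of "-\<delta>" "{-d..<0}" j pi] by auto
  have aP: "?a \<in> ?P" using \<delta> by (intro strip_I) auto
  have "\<delta> * norm (z' j pi) < r" using \<delta>(3) g'_nz by (simp add: field_simps)
  then have abr: "?a \<in> ball (z j pi) r" "?b \<in> ball (z j pi) r"
    using \<delta>(1) by (simp_all add: dist_norm norm_mult)
  have "(\<Sum>k\<le>M. wn k w) = (\<Sum>k\<le>M. wn k x)"
  proof (rule sum.cong[OF refl])
    fix k assume "k \<in> {..M}"
    then show "wn k w = wn k x"
      using Bfr[of k] B(2) x(1) by (intro winding_number_const[of k B]) (auto simp: B_def)
  qed
  also have "\<dots> = (\<Sum>k\<le>M. wn k ?b)"
  proof (rule sum.cong[OF refl])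
    fix k assume "k \<in> {..M}"
    then show "wn k x = wn k ?b"
      using xN bN sides(2) range_in_frontier[of k] fr
      by (intro winding_number_const[of k ?N] connected_strip j(1) connected_Ico) auto
  qed
  also have "\<dots> = (\<Sum>k\<le>M. wn k ?a - (if k = j then 1 else 0))"
  proof (rule sum.cong[OF refl])
    fix k assume k: "k \<in> {..M}"
    show "wn k ?b = wn k ?a - (if k = j then 1 else 0)"
    proof (cases "k = j")
      case True then show ?thesis using \<delta>(4) by (simp add: algebra_simps)
    next
      case False
      then have "wn k ?b = wn k ?a"
        using k r(2) abr by (intro winding_number_const[of k "ball (z j pi) r"]) auto
      then show ?thesis using False by simp
    qed
  qed
  also have "\<dots> = 0"
    using sum_winding_inside[of ?a] sides(1) aP j(1) by (auto simp: sum_subtractf)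
  finally show ?thesis .
qed

end

section \<open>Cauchy's theorem on offset curves\<close>

text \<open>The global Cauchy theorem speaks of one closed path. Finitely many loops are strung
  together by connecting paths inside \<open>S\<close>, each run through in both directions so that
  its contribution cancels.\<close>

lemma combine_closed_paths:
  assumes "finite A" and S: "open S" "connected S" "S \<noteq> {}"
    and "\<And>j. j \<in> A \<Longrightarrow> valid_path (\<gamma> j) \<and> pathfinish (\<gamma> j) = pathstart (\<gamma> j) \<and> path_image (\<gamma> j) \<subseteq> S"
  shows "\<exists>P. valid_path P \<and> pathfinish P = pathstart P \<and> path_image P \<subseteq> S \<and>
    (\<forall>h. h holomorphic_on S \<longrightarrow> contour_integral P h = (\<Sum>j\<in>A. contour_integral (\<gamma> j) h))"
  using assms(1,5)
proof (induction A)
  case empty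
  obtain x where "x \<in> S" using S(3) by blast
  then show ?case
    by (intro exI[of _ "linepath x x"] conjI allI impI valid_path_linepath)
      (simp_all only: pathstart_linepath pathfinish_linepath path_image_linepath closed_segment_idem
        contour_integral_trivial sum.empty insert_subset empty_subsetI simp_thms)
next
  case (insert i A)
  then obtain P where P: "valid_path P" "pathfinish P = pathstart P" "path_image P \<subseteq> S"
    "\<And>h. h holomorphic_on S \<Longrightarrow> contour_integral P h = (\<Sum>j\<in>A. contour_integral (\<gamma> j) h)"
    by auto
  have \<gamma>: "valid_path (\<gamma> i)" "pathfinish (\<gamma> i) = pathstart (\<gamma> i)" "path_image (\<gamma> i) \<subseteq> S"
    using insert.prems by auto
  have "pathfinish P \<in> S" "pathstart (\<gamma> i) \<in> S"
    using P(3) \<gamma>(3) pathfinish_in_path_image pathstart_in_path_image by blast+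
  then obtain c where c: "polynomial_function c" "path_image c \<subseteq> S" "pathstart c = pathfinish P" "pathfinish c = pathstart (\<gamma> i)"
    using connected_open_polynomial_connected[OF S(1,2)] by blast
  have vc: "valid_path c" by (rule valid_path_polynomial_function[OF c(1)])
  define Q where "Q = P +++ (c +++ (\<gamma> i +++ reversepath c))"
  have "valid_path Q" "pathfinish Q = pathstart Q" "path_image Q \<subseteq> S"
    using P \<gamma> c vc by (auto simp: Q_def path_image_join)
  moreover have "contour_integral Q h = (\<Sum>j\<in>insert i A. contour_integral (\<gamma> j) h)" if h: "h holomorphic_on S" for h
  proof -
    have int: "h contour_integrable_on g" if "valid_path g" "path_image g \<subseteq> S" for g
      by (rule contour_integrable_holomorphic_simple[OF h S(1) that])
    have "contour_integral Q h = contour_integral P h + (contour_integral c h + (contour_integral (\<gamma> i) h + contour_integral (reversepath c) h))"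
      unfolding Q_def using P \<gamma> c vc
      by (simp add: int path_image_join)
    then show ?thesis
      using insert.hyps P(4)[OF h] by (simp add: contour_integral_reversepath[OF vc])
  qed
  ultimately show ?case by blast
qed

text \<open>For \<open>w\<close> outside \<open>S\<close> the function
  \<open>1 / (\<zeta> - w)\<close> is holomorphic on \<open>S\<close>. So the combined loop inherits
  not only the integral of \<open>h\<close> but also the total winding number about
  \<open>w\<close>, which is zero.\<close>

theorem Cauchy_theorem_cycle:
  assumes "finite A" and S: "open S" "connected S" 
    and \<gamma>: "\<And>j. j \<in> A \<Longrightarrow> valid_path (\<gamma> j) \<and> pathfinish (\<gamma> j) = pathstart (\<gamma> j) \<and> path_image (\<gamma> j) \<subseteq> S"
    and zero: "\<And>w. w \<notin> S \<Longrightarrow> (\<Sum>j\<in>A. winding_number (\<gamma> j) w) = 0"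
    and h: "h holomorphic_on S"
  shows "(\<Sum>j\<in>A. contour_integral (\<gamma> j) h) = 0"
proof (cases "S = {}")
  case True
  then have "A = {}" using \<gamma> by fastforce
  then show ?thesis by simp
next
  case False
  obtain P where P: "valid_path P" "pathfinish P = pathstart P" "path_image P \<subseteq> S"
    "\<And>h. h holomorphic_on S \<Longrightarrow> contour_integral P h = (\<Sum>j\<in>A. contour_integral (\<gamma> j) h)"
    using combine_closed_paths[of A S \<gamma>, OF assms(1) S False \<gamma>] by auto
  have "winding_number P w = 0" if w: "w \<notin> S" for w
  proof -
    have hol: "(\<lambda>\<zeta>. 1 / (\<zeta> - w)) holomorphic_on S" using w by (intro holomorphic_intros) auto
    have eq: "winding_number g w = 1 / (2 * pi * \<i>) * contour_integral g (\<lambda>\<zeta>. 1 / (\<zeta> - w))"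
      if "valid_path g" "path_image g \<subseteq> S" for g
      using that w by (intro winding_number_valid_path) auto
    have "winding_number P w = (\<Sum>j\<in>A. 1 / (2 * pi * \<i>) * contour_integral (\<gamma> j) (\<lambda>\<zeta>. 1 / (\<zeta> - w)))"
      using P by (simp add: eq hol sum_distrib_left)
    also have "\<dots> = (\<Sum>j\<in>A. winding_number (\<gamma> j) w)"
      by (rule sum.cong) (use \<gamma> in \<open>auto simp: eq\<close>)
    finally show ?thesis using zero[OF w] by simp
  qed
  then have "contour_integral P h = 0"
    using Cauchy_theorem_global[OF S(1) h P(1-3)] contour_integral_unique by blast
  then show ?thesis using P(4)[OF h] by simp
qed

section \<open>Removing the poles of the logarithmic derivative\<close>

lemma log_derivative_near_zero:
  assumes g: "g holomorphic_on ball w r" "\<And>x. x \<in> ball w r \<Longrightarrow> g x \<noteq> 0"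
    and f: "\<And>x. x \<in> ball w r \<Longrightarrow> f x = g x * (x - w) ^ n"
    and x: "x \<in> ball w r" "x \<noteq> w"
  shows "deriv f x / f x = deriv g x / g x + of_nat n / (x - w)"
proof -
  have "(g has_field_derivative deriv g x) (at x)"
    by (rule holomorphic_derivI[OF g(1) open_ball x(1)])
  then have "((\<lambda>x. g x * (x - w) ^ n) has_field_derivative
      deriv g x * (x - w) ^ n + g x * (of_nat n * (x - w) ^ (n - 1))) (at x)"
    by (auto intro!: derivative_eq_intros)
  then have "(f has_field_derivative deriv g x * (x - w) ^ n + g x * (of_nat n * (x - w) ^ (n - 1))) (at x)"
    by (rule has_field_derivative_transform_within_open[OF _ open_ball x(1)]) (simp add: f)
  then have "deriv f x = deriv g x * (x - w) ^ n + g x * (of_nat n * (x - w) ^ (n - 1))"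
    by (rule DERIV_imp_deriv)
  \<comment> \<open>For \<open>n = 0\<close> both sides are zero, whatever the truncated exponent
    \<open>n - 1\<close>.\<close>
  also have "of_nat n * (x - w) ^ (n - 1) = of_nat n / (x - w) * (x - w) ^ n"
    using x(2) by (cases n) auto
  also have "deriv g x * (x - w) ^ n + g x * (of_nat n / (x - w) * (x - w) ^ n)
      = (deriv g x / g x + of_nat n / (x - w)) * f x"
    using g(2)[OF x(1)] by (simp add: f[OF x(1)] field_simps)
  finally show ?thesis using g(2)[OF x(1)] x(2) by (simp add: f[OF x(1)])
qed

text \<open>At a zero of \<open>f\<close> the logarithmic derivative has a simple pole whose residue
  is the multiplicity, and the list \<open>a\<close> contains the zero exactly that often.
  Subtracting the pole terms leaves removable singularities.\<close>

lemma log_derivative_extension: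
  fixes f :: "complex \<Rightarrow> complex" and M :: nat and a :: "nat \<Rightarrow> complex"
  assumes holf: "f holomorphic_on S" and S: "open S" "connected S" and nc: "\<exists>w\<in>S. f w \<noteq> 0"
    and zeros: "\<And>w. w \<in> S \<Longrightarrow> int (card {j. j \<le> M \<and> a j = w}) = zorder f w"
  shows "\<And>w. w \<in> S \<Longrightarrow> f w = 0 \<longleftrightarrow> w \<in> a ` {..M}"
    and "\<exists>G. G holomorphic_on S \<and> (\<forall>w\<in>S. w \<notin> a ` {..M} \<longrightarrow> deriv f w / f w = G w + (\<Sum>k\<le>M. 1 / (w - a k)))"
proof -
  show fz: "f w = 0 \<longleftrightarrow> w \<in> a ` {..M}" if w: "w \<in> S" for w
  proof -
    have fin: "finite {j. j \<le> M \<and> a j = w}" by (rule finite_subset[of _ "{..M}"]) auto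
    have "if f w = 0 then zorder f w > 0 else zorder f w = 0"
      using zorder_exist_zero[OF holf S w nc] by blast
    then have "f w = 0 \<longleftrightarrow> card {j. j \<le> M \<and> a j = w} > 0" using zeros[OF w] by (auto split: if_splits)
    also have "\<dots> \<longleftrightarrow> {j. j \<le> M \<and> a j = w} \<noteq> {}" using fin by (auto simp: card_gt_0_iff)
    finally show ?thesis by auto
  qed
  define q where "q w = deriv f w / f w - (\<Sum>k\<le>M. 1 / (w - a k))" for w
  define A where "A = a ` {..M} \<inter> S"
  have "finite A" by (simp add: A_def)
  have lim: "\<exists>l. (q \<longlongrightarrow> l) (at w)" if w: "w \<in> A" for w
  proof -
    have wS: "w \<in> S" using w by (simp add: A_def)
    define n where "n = nat (zorder f w)"
    have n: "n = card {j. j \<le> M \<and> a j = w}" using zeros[OF wS] by (simp add: n_def)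
    obtain r where r: "r > 0" "zor_poly f w holomorphic_on cball w r"
      "\<And>x. x \<in> cball w r \<Longrightarrow> f x = zor_poly f w x * (x - w) ^ n \<and> zor_poly f w x \<noteq> 0"
      using zorder_exist_zero[OF holf S wS nc] unfolding n_def by blast
    define g where "g = zor_poly f w"
    have g: "g holomorphic_on ball w r" "\<And>x. x \<in> ball w r \<Longrightarrow> g x \<noteq> 0"
      "\<And>x. x \<in> ball w r \<Longrightarrow> f x = g x * (x - w) ^ n"
      using r holomorphic_on_subset[OF r(2) ball_subset_cball] by (auto simp: g_def)
    \<comment> \<open>These are the indices with a pole elsewhere. The other terms number
      \<open>n\<close> and cancel the principal part at \<open>w\<close>.\<close>
    define Q where "Q = {k. k \<le> M \<and> a k \<noteq> w}"
    have qx: "q x = deriv g x / g x - (\<Sum>k\<in>Q. 1 / (x - a k))" if x: "x \<in> ball w r" "x \<noteq> w" for x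
    proof -
      have "{..M} = {k. k \<le> M \<and> a k = w} \<union> Q" by (auto simp: Q_def)
      then have "(\<Sum>k\<le>M. 1 / (x - a k)) = (\<Sum>k\<in>{k. k \<le> M \<and> a k = w} \<union> Q. 1 / (x - a k))" by simp
      also have "\<dots> = (\<Sum>k\<in>{k. k \<le> M \<and> a k = w}. 1 / (x - a k)) + (\<Sum>k\<in>Q. 1 / (x - a k))"
        by (rule sum.union_disjoint) (auto simp: Q_def)
      also have "(\<Sum>k\<in>{k. k \<le> M \<and> a k = w}. 1 / (x - a k)) = of_nat n / (x - w)"
        by (simp add: n)
      finally show ?thesis
        using log_derivative_near_zero[OF g x] by (simp add: q_def)
    qed
    have "isCont (\<lambda>x. deriv g x / g x - (\<Sum>k\<in>Q. 1 / (x - a k))) w"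
    proof -
      have "continuous_on (ball w r) g" "continuous_on (ball w r) (deriv g)"
        using g(1) holomorphic_on_imp_continuous_on holomorphic_deriv by blast+
      then have "isCont g w" "isCont (deriv g) w" 
        using r(1) by (auto simp: continuous_on_eq_continuous_at)
      then show ?thesis using g(2)[of w] r(1) by (intro continuous_intros) (auto simp: Q_def)
    qed
    then have "((\<lambda>x. deriv g x / g x - (\<Sum>k\<in>Q. 1 / (x - a k))) \<longlongrightarrow> deriv g w / g w - (\<Sum>k\<in>Q. 1 / (w - a k))) (at w)"
      by (simp add: isCont_def)
    then have "(q \<longlongrightarrow> deriv g w / g w - (\<Sum>k\<in>Q. 1 / (w - a k))) (at w)"
      by (rule Lim_transform_within_open[where s="ball w r"]) (use r(1) qx in auto)
    then show ?thesis by blast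
  qed
  then obtain l where l: "\<And>w. w \<in> A \<Longrightarrow> (q \<longlongrightarrow> l w) (at w)" by metis
  define G where "G w = (if w \<in> A then l w else q w)" for w
  have "G holomorphic_on S"
  proof (rule no_isolated_singularity'[OF _ _ S(1) \<open>finite A\<close>])
    fix w assume w: "w \<in> A"
    have "(G \<longlongrightarrow> l w) (at w)"
    proof (rule Lim_transform_within_open[where s="- (A - {w})", OF l[OF w]])
      show "open (- (A - {w}))" using \<open>finite A\<close> by (intro open_Compl finite_imp_closed) auto
    qed (auto simp: G_def)
    then show "(G \<longlongrightarrow> G w) (at w within S)"
      using w tendsto_within_subset[of G _ w UNIV S] by (simp add: G_def)
  next
    have "open (S - A)" using S(1) \<open>finite A\<close> finite_imp_closed by blast
    have "q holomorphic_on S - A"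
      unfolding q_def using fz holomorphic_on_subset[OF holf, of "S - A"] \<open>open (S - A)\<close>
      by (intro holomorphic_intros holomorphic_deriv) (auto simp: A_def)
    then show "G holomorphic_on S - A"
      by (rule holomorphic_transform) (simp add: G_def)
  qed
  then show "\<exists>G. G holomorphic_on S \<and> (\<forall>w\<in>S. w \<notin> a ` {..M} \<longrightarrow> deriv f w / f w = G w + (\<Sum>k\<le>M. 1 / (w - a k)))"
    by (intro exI[of _ G]) (auto simp: G_def q_def A_def)
qed

section \<open>Curves offset into the region\<close>

locale mc_tube = mc_region +
  fixes d :: real
  assumes d_pos: "d > 0"
    and discs: "touching_discs_clear d"
begin

text \<open>The shift \<open>\<epsilon>\<close> is measured in units of the velocity: the distance
  from \<open>z j t\<close> is \<open>\<bar>\<epsilon>\<bar> * norm (z' j t)\<close>. Small positive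
  values lead into \<open>\<Omega>\<close>, negative ones out of its closure.\<close>

definition off :: "nat \<Rightarrow> real \<Rightarrow> real \<Rightarrow> complex" where
  "off j \<epsilon> t = z j t + \<i> * of_real \<epsilon> * z' j t"

definition off' :: "nat \<Rightarrow> real \<Rightarrow> real \<Rightarrow> complex" where
  "off' j \<epsilon> t = z' j t + \<i> * of_real \<epsilon> * z'' j t"

lemma off_0 [simp]: "off j 0 t = z j t" and off'_0 [simp]: "off' j 0 t = z' j t"
  by (simp_all add: off_def off'_def)

lemma off_in: "j \<le> M \<Longrightarrow> 0 < \<epsilon> \<Longrightarrow> \<epsilon> \<le> d \<Longrightarrow> off j \<epsilon> t \<in> \<Omega>"
  using strip_sides(1)[OF d_pos discs] strip_I[of \<epsilon> "{0<..d}" j t] by (force simp: off_def)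

lemma off_out: "j \<le> M \<Longrightarrow> - d \<le> \<epsilon> \<Longrightarrow> \<epsilon> < 0 \<Longrightarrow> off j \<epsilon> t \<notin> closure \<Omega>"
  using strip_sides(2)[OF d_pos discs] strip_I[of \<epsilon> "{-d..<0}" j t] by (force simp: off_def)

lemma off_in_closure: "j \<le> M \<Longrightarrow> 0 \<le> \<epsilon> \<Longrightarrow> \<epsilon> \<le> d \<Longrightarrow> off j \<epsilon> t \<in> closure \<Omega>"
  using off_in[of j \<epsilon> t] closure_subset range_in_frontier[of j t] by (cases "\<epsilon> = 0") (auto simp: frontier_def)

lemma curve_off: "j \<le> M \<Longrightarrow> C1_curve (off j \<epsilon>) (off' j \<epsilon>)"
proof -
  assume j: "j \<le> M"
  interpret smooth_jordan_curve "z j" by (rule curve[OF j])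
  show ?thesis
  proof
    have "((\<lambda>t. z j t + (\<i> * of_real \<epsilon>) * z' j t) has_vector_derivative z' j t + (\<i> * of_real \<epsilon>) * z'' j t) (at t)" for t
      by (intro has_vector_derivative_add has_vector_derivative_mult_right dg dg')
    then show "(off j \<epsilon> has_vector_derivative off' j \<epsilon> t) (at t)" for t
      by (simp add: off_def[abs_def] off'_def)
    show "continuous_on UNIV (off' j \<epsilon>)"
      unfolding off'_def[abs_def] by (intro continuous_intros cont_g' cont_g'')
  qed
qed

lemma off_continuous: "j \<le> M \<Longrightarrow> continuous_on X (\<lambda>x. off j (fst x) (snd x))"
  and off'_continuous: "j \<le> M \<Longrightarrow> continuous_on X (\<lambda>x. off' j (fst x) (snd x))"
proof -
  assume j: "j \<le> M"
  interpret smooth_jordan_curve "z j" by (rule curve[OF j])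
  show "continuous_on X (\<lambda>x. off j (fst x) (snd x))"
    unfolding off_def
    by (intro continuous_intros continuous_on_compose2[OF cont_g[of UNIV]] continuous_on_compose2[OF cont_g'[of UNIV]]) auto
  show "continuous_on X (\<lambda>x. off' j (fst x) (snd x))"
    unfolding off'_def
    by (intro continuous_intros continuous_on_compose2[OF cont_g''[of UNIV]] continuous_on_compose2[OF cont_g'[of UNIV]]) auto
qed

lemma path_off:
  assumes "j \<le> M"
  shows "valid_path (bdry_path (off j \<epsilon>))" "pathfinish (bdry_path (off j \<epsilon>)) = pathstart (bdry_path (off j \<epsilon>))"
proof -
  interpret smooth_jordan_curve "z j" by (rule curve[OF assms])
  show "valid_path (bdry_path (off j \<epsilon>))" by (rule C1_curve.valid_bdry_path[OF curve_off[OF assms]])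
  show "pathfinish (bdry_path (off j \<epsilon>)) = pathstart (bdry_path (off j \<epsilon>))"
    using per_g[of 0] per_g'[of 0] by (simp add: pathfinish_def pathstart_def bdry_path_def off_def)
qed

lemma path_image_off:
  assumes "j \<le> M" "0 < \<epsilon>" "\<epsilon> \<le> d"
  shows "path_image (bdry_path (off j \<epsilon>)) \<subseteq> \<Omega>"
  using off_in[OF assms] by (auto simp: path_image_def bdry_path_def)

text \<open>Off the closure, the linear homotopy from a boundary curve to its offset stays in the
  closure and hence misses \<open>w\<close>, which reduces the claim to
  \<open>sum_winding_outside\<close>. A frontier point lies on a boundary curve itself, so there the
  value 0 is carried over from the exterior normal by continuity of the winding numbers of the
  offset curves.\<close>

lemma sum_winding_off_outside:
  assumes e: "0 < \<epsilon>" "\<epsilon> \<le> d" and w: "w \<notin> \<Omega>"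
  shows "(\<Sum>j\<le>M. winding_number (bdry_path (off j \<epsilon>)) w) = 0"
proof -
  define N where "N w = (\<Sum>j\<le>M. winding_number (bdry_path (off j \<epsilon>)) w)" for w
  have out: "N w = 0" if w: "w \<notin> closure \<Omega>" for w
  proof -
    have "winding_number (bdry_path (off j \<epsilon>)) w = wn j w" if j: "j \<le> M" for j
    proof (rule winding_number_loops_linear_eq)
      interpret smooth_jordan_curve "z j" by (rule curve[OF j])
      show "path (bdry_path (z j))" "pathfinish (bdry_path (z j)) = pathstart (bdry_path (z j))" by (rule path_g)+
      show "path (bdry_path (off j \<epsilon>))" "pathfinish (bdry_path (off j \<epsilon>)) = pathstart (bdry_path (off j \<epsilon>))"
        using path_off[OF j] valid_path_imp_path by auto
      fix t :: real
      have "x \<in> closure \<Omega>" if seg: "x \<in> closed_segment (bdry_path (z j) t) (bdry_path (off j \<epsilon>) t)" for x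
      proof -
        obtain u where u: "0 \<le> u" "u \<le> 1" "x = (1 - u) *\<^sub>R bdry_path (z j) t + u *\<^sub>R bdry_path (off j \<epsilon>) t"
          using seg by (auto simp: in_segment)
        have "x = off j (u * \<epsilon>) (2 * pi * t)"
          unfolding u(3) by (simp add: bdry_path_def off_def scaleR_conv_of_real algebra_simps)
        moreover have "u * \<epsilon> \<le> d" using mult_left_le_one_le[of \<epsilon> u] u e by linarith
        moreover have "0 \<le> u * \<epsilon>" using u e by simp
        ultimately show ?thesis using off_in_closure[OF j, of "u * \<epsilon>"] by simp
      qed
      then show "w \<notin> closed_segment (bdry_path (z j) t) (bdry_path (off j \<epsilon>) t)" using w by blast
    qed
    then show ?thesis using sum_winding_outside[OF w] by (simp add: N_def)
  qed
  have "N w = 0"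
  proof (cases "w \<in> closure \<Omega>")
    case False then show ?thesis by (rule out)
  next
    case True
    then have "w \<in> frontier \<Omega>" using w open_\<Omega> by (simp add: frontier_def interior_open)
    then obtain j t where j: "j \<le> M" "w = z j t" by (auto simp: frontier_eq)
    have "continuous (at w) (winding_number (bdry_path (off k \<epsilon>)))" if "k \<le> M" for k
      using path_off(1)[OF that, of \<epsilon>] path_image_off[OF that e] w
      by (intro continuous_at_winding_number valid_path_imp_path) auto
    then have "isCont N w" unfolding N_def by (intro continuous_intros) auto
    moreover have "((\<lambda>\<delta>. off j \<delta> t) \<longlongrightarrow> off j 0 t) (at_left 0)"
      unfolding off_def by (intro tendsto_intros)
    then have "((\<lambda>\<delta>. off j \<delta> t) \<longlongrightarrow> w) (at_left 0)" by (simp add: j(2))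
    ultimately have "((\<lambda>\<delta>. N (off j \<delta> t)) \<longlongrightarrow> N w) (at_left 0)"
      by (rule isCont_tendsto_compose)
    moreover have "\<forall>\<^sub>F \<delta> in at_left 0. N (off j \<delta> t) = 0"
      by (rule eventually_at_leftI[of "-d"]) (use d_pos out off_out[OF j(1)] in auto)
    then have "((\<lambda>\<delta>. N (off j \<delta> t)) \<longlongrightarrow> 0) (at_left 0)" by (rule tendsto_eventually)
    ultimately show ?thesis using tendsto_unique[OF trivial_limit_at_left_real] by blast
  qed
  then show ?thesis by (simp add: N_def)
qed

lemma Cauchy_off:
  assumes e: "0 < \<epsilon>" "\<epsilon> \<le> d" and h: "h holomorphic_on \<Omega>"
  shows "(\<Sum>j\<le>M. integral {0..2*pi} (\<lambda>s. h (off j \<epsilon> s) * off' j \<epsilon> s)) = 0"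
proof -
  have "(\<Sum>j\<le>M. contour_integral (bdry_path (off j \<epsilon>)) h) = 0"
    using path_off path_image_off[OF _ e] sum_winding_off_outside[OF e]
    by (intro Cauchy_theorem_cycle[OF _ open_\<Omega> connected_\<Omega> _ _ h]) auto
  moreover have "contour_integral (bdry_path (off j \<epsilon>)) h = integral {0..2*pi} (\<lambda>s. h (off j \<epsilon> s) * off' j \<epsilon> s)"
    if "j \<le> M" for j
    using off_in[OF that e] 
    by (intro C1_curve.contour_integral_bdry_path[OF curve_off[OF that]]
        continuous_on_subset[OF holomorphic_on_imp_continuous_on[OF h]]) auto
  ultimately show ?thesis by simp
qed

end

section \<open>The logarithmic derivative on the boundary\<close>

locale mc_boundary = mc_tube +
  fixes f :: "complex \<Rightarrow> complex" and a :: "nat \<Rightarrow> complex" and \<theta> :: "nat \<times> real \<Rightarrow> real"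
  assumes holf: "f holomorphic_on \<Omega>" and f_ball: "f ` \<Omega> \<subseteq> ball 0 1"
    and a0: "a 0 \<in> \<Omega>" "deriv f (a 0) \<noteq> 0"
    and zeros: "lists_zeros \<Omega> M f a"
    and bc: "boundary_correspondence \<Omega> M z f \<theta>"
begin

abbreviation "A \<equiv> a ` {..M}"
abbreviation "\<theta>' j s \<equiv> derivJ \<theta> (j, s)"

lemma A_subset: "A \<subseteq> \<Omega>"
  using zeros by (auto simp: lists_zeros_def)

lemma finite_A: "finite A" by simp

lemma f_not_zero: "\<exists>w\<in>\<Omega>. f w \<noteq> 0"
proof (rule ccontr)
  assume "\<not> ?thesis"
  then have "(f has_field_derivative 0) (at (a 0))"
    by (intro has_field_derivative_transform_within_open[OF DERIV_const[of 0] open_\<Omega> a0(1)]) simp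
  then show False using a0(2) DERIV_imp_deriv by blast
qed

lemma zero_iff: "w \<in> \<Omega> \<Longrightarrow> f w = 0 \<longleftrightarrow> w \<in> A"
  and log_deriv_ext: "\<exists>G. G holomorphic_on \<Omega> \<and> (\<forall>w\<in>\<Omega>. w \<notin> A \<longrightarrow> deriv f w / f w = G w + (\<Sum>k\<le>M. 1 / (w - a k)))"
proof -
  have "\<And>w. w \<in> \<Omega> \<Longrightarrow> int (card {j. j \<le> M \<and> a j = w}) = zorder f w"
    using zeros by (auto simp: lists_zeros_def)
  note * = log_derivative_extension[OF holf open_\<Omega> connected_\<Omega> f_not_zero this]
  show "w \<in> \<Omega> \<Longrightarrow> f w = 0 \<longleftrightarrow> w \<in> A" using *(1) by blast
  show "\<exists>G. G holomorphic_on \<Omega> \<and> (\<forall>w\<in>\<Omega>. w \<notin> A \<longrightarrow> deriv f w / f w = G w + (\<Sum>k\<le>M. 1 / (w - a k)))"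
    using *(2) by blast
qed

lemma \<theta>_deriv:
  assumes "j \<le> M" "s \<in> {0..2*pi}"
  shows "((\<lambda>s. \<theta> (j, s)) has_real_derivative \<theta>' j s) (at s within {0..2*pi})"
proof -
  have "(\<lambda>t. \<theta> (j, t)) differentiable (at s within {0..2*pi})"
    using bc assms by (auto simp: boundary_correspondence_def differentiable_on_def)
  then show ?thesis
    by (simp add: derivJ_def vector_derivative_works has_real_derivative_iff_has_vector_derivative)
qed

lemma \<theta>_complex_deriv:
  assumes "j \<le> M" "s \<in> {0..2*pi}"
  shows "((\<lambda>s. complex_of_real (\<theta> (j, s))) has_vector_derivative of_real (\<theta>' j s)) (at s within {0..2*pi})"
  using \<theta>_deriv[OF assms] unfolding has_real_derivative_iff_has_vector_derivative
  by (rule bounded_linear.has_vector_derivative[OF bounded_linear_of_real])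

lemma continuous_\<theta>: "j \<le> M \<Longrightarrow> continuous_on {0..2*pi} (\<lambda>s. \<theta> (j, s))"
  by (rule DERIV_continuous_on, rule \<theta>_deriv)

text \<open>Replaces the arbitrary values of \<open>f\<close> off \<open>\<Omega>\<close> by
  boundary limits, so that continuity on the closure makes sense.\<close>

definition F :: "complex \<Rightarrow> complex" where
  "F w = (if w \<in> \<Omega> then f w else Lim (at w within \<Omega>) f)"

lemma at_within_nontrivial: "p \<in> frontier \<Omega> \<Longrightarrow> at p within \<Omega> \<noteq> bot"
  using open_\<Omega> by (auto simp: frontier_def interior_open closure_def trivial_limit_within)

lemma F_z:
  assumes "j \<le> M" "t \<in> {0..2*pi}"
  shows "F (z j t) = exp (\<i> * of_real (\<theta> (j, t)))"
    and "(f \<longlongrightarrow> F (z j t)) (at (z j t) within \<Omega>)"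
proof -
  have lim: "(f \<longlongrightarrow> exp (\<i> * of_real (\<theta> (j, t)))) (at (z j t) within \<Omega>)"
    using bc assms by (force simp: boundary_correspondence_def J_set_def zJ_def)
  have "z j t \<notin> \<Omega>" using range_in_frontier[OF assms(1)] \<Omega>_frontier_disjoint by blast
  then show *: "F (z j t) = exp (\<i> * of_real (\<theta> (j, t)))"
    using tendsto_Lim[OF at_within_nontrivial[OF range_in_frontier[OF assms(1)]] lim] by (simp add: F_def)
  show "(f \<longlongrightarrow> F (z j t)) (at (z j t) within \<Omega>)" using lim by (simp add: *)
qed

lemma frontier_param:
  assumes "p \<in> frontier \<Omega>"
  obtains j t where "j \<le> M" "t \<in> {0..2*pi}" "p = z j t"
proof -
  obtain j where j: "j \<le> M" "p \<in> range (z j)" using assms by (auto simp: frontier_eq)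
  then have "p \<in> z j ` {0..2*pi}" using smooth_jordan_curve.range_g[OF curve] by blast
  then show ?thesis using that j(1) by blast
qed

lemma norm_F_frontier: "p \<in> frontier \<Omega> \<Longrightarrow> norm (F p) = 1"
  by (erule frontier_param) (simp add: F_z)

text \<open>At a frontier point the assumption controls only the values inside
  \<open>\<Omega>\<close>. Values at nearby frontier points are limits of such inner values and
  inherit the estimate with a weak inequality; hence \<open>e/2\<close>.\<close>

lemma continuous_on_F: "continuous_on (closure \<Omega>) F"
  unfolding continuous_on_eq_continuous_within
proof
  fix p assume p: "p \<in> closure \<Omega>"
  show "continuous (at p within closure \<Omega>) F"
  proof (cases "p \<in> \<Omega>")
    case True
    have "continuous_on \<Omega> F"
      using holomorphic_on_imp_continuous_on[OF holf] by (rule continuous_on_eq) (simp add: F_def)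
    then show ?thesis
      using True open_\<Omega> continuous_at_imp_continuous_at_within by (auto simp: continuous_on_eq_continuous_at)
  next
    case False
    then have pf: "p \<in> frontier \<Omega>" using p open_\<Omega> by (simp add: frontier_def interior_open)
    have lim: "(f \<longlongrightarrow> F q) (at q within \<Omega>)" if "q \<in> frontier \<Omega>" for q
      using that by (rule frontier_param) (simp add: F_z(2))
    show ?thesis unfolding continuous_within_eps_delta
    proof (intro allI impI)
      fix e :: real assume e: "e > 0"
      obtain \<delta> where \<delta>: "\<delta> > 0" "\<And>w. w \<in> \<Omega> \<Longrightarrow> 0 < dist w p \<Longrightarrow> dist w p < \<delta> \<Longrightarrow> dist (f w) (F p) < e/2"
        using lim[OF pf] e unfolding Lim_within by (metis half_gt_zero)
      have "dist (F q) (F p) < e" if q: "q \<in> closure \<Omega>" "dist q p < \<delta>" for q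
      proof (cases "q \<in> \<Omega>")
        case True
        then have "q \<noteq> p" using False by auto
        then show ?thesis using \<delta>(2)[of q] True q e by (simp add: F_def)
      next
        case q': False
        then have qf: "q \<in> frontier \<Omega>" using q open_\<Omega> by (simp add: frontier_def interior_open)
        have "\<forall>\<^sub>F w in at q within \<Omega>. w \<in> ball p \<delta> \<and> w \<in> \<Omega>"
        proof (rule eventually_conj)
          have "\<forall>\<^sub>F w in at q. w \<in> ball p \<delta>"
            using q(2) by (intro eventually_at_in_open') (auto simp: dist_commute)
          then show "\<forall>\<^sub>F w in at q within \<Omega>. w \<in> ball p \<delta>" 
            using at_le[of \<Omega> UNIV q] filter_leD by auto
        qed (auto simp: eventually_at_filter)
        then have "\<forall>\<^sub>F w in at q within \<Omega>. dist (F p) (f w) \<le> e/2"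
        proof eventually_elim
          case (elim w)
          then have "w \<noteq> p" using False by auto
          then show ?case using \<delta>(2)[of w] elim by (simp add: dist_commute less_imp_le)
        qed
        then have "dist (F p) (F q) \<le> e/2"
          by (rule Lim_dist_ubound[OF at_within_nontrivial[OF qf] lim[OF qf]])
        then show ?thesis using e by (simp add: dist_commute)
      qed
      then show "\<exists>d>0. \<forall>x'\<in>closure \<Omega>. dist x' p < d \<longrightarrow> dist (F x') (F p) < e" using \<delta>(1) by blast
    qed
  qed
qed

lemma off_close: "r > 0 \<Longrightarrow> \<exists>e>0. \<forall>j\<le>M. \<forall>t \<epsilon>. \<bar>\<epsilon>\<bar> \<le> e \<longrightarrow> dist (off j \<epsilon> t) (z j t) < r"
proof (rule uniform_positive_bound)
  fix j assume r: "r > 0" and j: "j \<le> M"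
  obtain K where K: "K > 0" "\<And>t. norm (z' j t) \<le> K"
    using smooth_jordan_curve.deriv_upper[OF curve[OF j]] by blast
  have "dist (off j \<epsilon> t) (z j t) < r" if "\<bar>\<epsilon>\<bar> \<le> r / (2 * K)" for t \<epsilon>
  proof -
    have "dist (off j \<epsilon> t) (z j t) = \<bar>\<epsilon>\<bar> * norm (z' j t)" by (simp add: dist_norm off_def norm_mult)
    also have "\<dots> \<le> r / (2 * K) * K" using that K r by (intro mult_mono) auto
    also have "\<dots> < r" using K r by simp
    finally show ?thesis .
  qed
  then show "\<exists>e>0. \<forall>t \<epsilon>. \<bar>\<epsilon>\<bar> \<le> e \<longrightarrow> dist (off j \<epsilon> t) (z j t) < r"
    using K r by (intro exI[of _ "r / (2 * K)"]) auto
qed auto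

text \<open>
  Close to the boundary, \<open>f (off j \<epsilon> t)\<close> differs little from \<open>exp (\<i> * \<theta> (j, t))\<close>, so that the
  principal logarithm of the quotient yields a logarithm of \<open>f\<close> along the offset curve.
\<close>

definition logf :: "nat \<Rightarrow> real \<Rightarrow> real \<Rightarrow> complex" where
  "logf j \<epsilon> t = \<i> * of_real (\<theta> (j, t)) + Ln (F (off j \<epsilon> t) * exp (- \<i> * of_real (\<theta> (j, t))))"

lemma logf_0: "j \<le> M \<Longrightarrow> t \<in> {0..2*pi} \<Longrightarrow> logf j 0 t = \<i> * of_real (\<theta> (j, t))"
  by (simp add: logf_def F_z flip: exp_add)

text \<open>By uniform continuity on the compact closure the product stays within distance 1 of its
  boundary value 1, that is, in the right half-plane, on which the principal logarithm is
  holomorphic.\<close>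

lemma logf_domain:
  "\<exists>e>0. e \<le> d \<and> (\<forall>j\<le>M. \<forall>t\<in>{0..2*pi}. \<forall>\<epsilon>\<in>{0..e}. F (off j \<epsilon> t) * exp (- \<i> * of_real (\<theta> (j, t))) \<notin> \<real>\<^sub>\<le>\<^sub>0)"
proof -
  have "compact (closure \<Omega>)" using bounded_\<Omega> by simp
  then have "uniformly_continuous_on (closure \<Omega>) F"
    by (rule compact_uniformly_continuous[OF continuous_on_F])
  then obtain r where r: "r > 0" "\<And>x y. x \<in> closure \<Omega> \<Longrightarrow> y \<in> closure \<Omega> \<Longrightarrow> dist y x < r \<Longrightarrow> dist (F y) (F x) < 1"
    unfolding uniformly_continuous_on_def by (metis zero_less_one)
  obtain e where e: "e > 0" "\<And>j t \<epsilon>. j \<le> M \<Longrightarrow> \<bar>\<epsilon>\<bar> \<le> e \<Longrightarrow> dist (off j \<epsilon> t) (z j t) < r"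
    using off_close[OF r(1)] by blast
  have "F (off j \<epsilon> t) * exp (- \<i> * of_real (\<theta> (j, t))) \<notin> \<real>\<^sub>\<le>\<^sub>0"
    if j: "j \<le> M" and t: "t \<in> {0..2*pi}" and \<epsilon>: "\<epsilon> \<in> {0..min e d}" for j t \<epsilon>
  proof -
    let ?E = "exp (- \<i> * of_real (\<theta> (j, t)))"
    have "dist (F (off j \<epsilon> t)) (F (z j t)) < 1"
      using e(2)[OF j, of \<epsilon> t] off_in_closure[OF j, of \<epsilon> t] off_in_closure[OF j, of 0 t] \<epsilon> d_pos by (intro r(2)) auto
    then have "norm (F (off j \<epsilon> t) - exp (\<i> * of_real (\<theta> (j, t)))) * norm ?E < 1"
      by (simp add: dist_norm F_z(1)[OF j t])
    then have "norm ((F (off j \<epsilon> t) - exp (\<i> * of_real (\<theta> (j, t)))) * ?E) < 1"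
      by (simp only: norm_mult)
    moreover have "(F (off j \<epsilon> t) - exp (\<i> * of_real (\<theta> (j, t)))) * ?E = F (off j \<epsilon> t) * ?E - 1"
      by (simp add: left_diff_distrib flip: exp_add)
    ultimately have "norm (F (off j \<epsilon> t) * ?E - 1) < 1" by simp
    then have "\<bar>Re (F (off j \<epsilon> t) * ?E - 1)\<bar> < 1" using abs_Re_le_cmod order_le_less_trans by blast
    then have "Re (F (off j \<epsilon> t) * ?E) > 0" by simp
    then show ?thesis by (auto simp: complex_nonpos_Reals_iff)
  qed
  then show ?thesis using e(1) d_pos by (intro exI[of _ "min e d"]) auto
qed

text \<open>The contribution of \<open>\<theta>'\<close> from the first summand of
  \<open>logf\<close> cancels against that of the exponential inside \<open>Ln\<close>; only the
  logarithmic derivative of \<open>f\<close> along the curve remains.\<close>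

lemma logf_deriv:
  assumes j: "j \<le> M" and t: "t \<in> {0..2*pi}" and \<epsilon>: "0 < \<epsilon>" "\<epsilon> \<le> d"
    and dom: "F (off j \<epsilon> t) * exp (- \<i> * of_real (\<theta> (j, t))) \<notin> \<real>\<^sub>\<le>\<^sub>0"
  shows "(logf j \<epsilon> has_vector_derivative deriv f (off j \<epsilon> t) / f (off j \<epsilon> t) * off' j \<epsilon> t) (at t within {0..2*pi})"
proof -
  let ?T = "at t within {0..2*pi}" and ?E = "exp (- \<i> * of_real (\<theta> (j, t)))"
  have Fo: "F (off j \<epsilon> t) = f (off j \<epsilon> t)" for t using off_in[OF j \<epsilon>] by (simp add: F_def)
  interpret C1_curve "off j \<epsilon>" "off' j \<epsilon>" by (rule curve_off[OF j])
  have "(f has_field_derivative deriv f (off j \<epsilon> t)) (at (off j \<epsilon> t))"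
    by (rule holomorphic_derivI[OF holf open_\<Omega> off_in[OF j \<epsilon>]])
  from field_vector_diff_chain_within[OF has_vector_derivative_at_within[OF has_deriv] has_field_derivative_at_within[OF this]]
  have 1: "((\<lambda>t. f (off j \<epsilon> t)) has_vector_derivative off' j \<epsilon> t * deriv f (off j \<epsilon> t)) ?T"
    by (simp add: o_def)
  have i\<theta>: "((\<lambda>t. \<i> * of_real (\<theta> (j, t))) has_vector_derivative \<i> * of_real (\<theta>' j t)) ?T"
    by (intro has_vector_derivative_mult_right \<theta>_complex_deriv j t)
  have "((\<lambda>t. - \<i> * of_real (\<theta> (j, t))) has_vector_derivative - \<i> * of_real (\<theta>' j t)) ?T"
    by (intro has_vector_derivative_mult_right \<theta>_complex_deriv j t)
  from field_vector_diff_chain_within[OF this has_field_derivative_at_within[OF DERIV_exp]]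
  have 2: "((\<lambda>t. exp (- \<i> * of_real (\<theta> (j, t)))) has_vector_derivative (- \<i> * of_real (\<theta>' j t)) * ?E) ?T"
    by (simp add: o_def)
  have dom': "f (off j \<epsilon> t) * ?E \<notin> \<real>\<^sub>\<le>\<^sub>0" using dom by (simp add: Fo)
  from field_vector_diff_chain_within[OF has_vector_derivative_mult[OF 1 2] has_field_derivative_at_within[OF has_field_derivative_Ln[OF dom']]]
  have 3: "((\<lambda>t. Ln (f (off j \<epsilon> t) * exp (- \<i> * of_real (\<theta> (j, t))))) has_vector_derivative
    (f (off j \<epsilon> t) * ((- \<i> * of_real (\<theta>' j t)) * ?E) + off' j \<epsilon> t * deriv f (off j \<epsilon> t) * ?E) * inverse (f (off j \<epsilon> t) * ?E)) ?T"
    by (simp add: o_def)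
  have nz: "f (off j \<epsilon> t) \<noteq> 0" using dom' by auto
  have "\<i> * of_real (\<theta>' j t) + (f (off j \<epsilon> t) * ((- \<i> * of_real (\<theta>' j t)) * ?E) + off' j \<epsilon> t * deriv f (off j \<epsilon> t) * ?E) * inverse (f (off j \<epsilon> t) * ?E)
     = deriv f (off j \<epsilon> t) / f (off j \<epsilon> t) * off' j \<epsilon> t"
    using nz by (simp add: field_simps)
  with has_vector_derivative_add[OF i\<theta> 3] show ?thesis
    by (simp add: logf_def[abs_def] Fo)
qed

lemma integral_log_derivative_off:
  assumes e: "e \<le> d" and dom: "\<forall>j\<le>M. \<forall>t\<in>{0..2*pi}. \<forall>\<epsilon>\<in>{0..e}. F (off j \<epsilon> t) * exp (- \<i> * of_real (\<theta> (j, t))) \<notin> \<real>\<^sub>\<le>\<^sub>0"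
    and U: "open U" "\<phi> holomorphic_on U" and oU: "\<And>j t \<epsilon>. j \<le> M \<Longrightarrow> \<epsilon> \<in> {0..e} \<Longrightarrow> off j \<epsilon> t \<in> U"
    and j: "j \<le> M"
  defines "P \<equiv> \<lambda>\<epsilon>. logf j \<epsilon> (2*pi) * \<phi> (off j \<epsilon> (2*pi)) - logf j \<epsilon> 0 * \<phi> (off j \<epsilon> 0)
      - integral {0..2*pi} (\<lambda>t. logf j \<epsilon> t * (deriv \<phi> (off j \<epsilon> t) * off' j \<epsilon> t))"
  shows "continuous_on {0..e} P"
    and "\<And>\<epsilon>. 0 < \<epsilon> \<Longrightarrow> \<epsilon> \<le> e \<Longrightarrow>
      ((\<lambda>t. deriv f (off j \<epsilon> t) / f (off j \<epsilon> t) * off' j \<epsilon> t * \<phi> (off j \<epsilon> t)) has_integral P \<epsilon>) {0..2*pi}"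
    and "0 \<le> e \<Longrightarrow> ((\<lambda>t. \<i> * of_real (\<theta>' j t) * \<phi> (z j t)) has_integral P 0) {0..2*pi}"
proof -
  let ?R = "{0..e} \<times> {0..2*pi}"
  have c\<phi>: "continuous_on U \<phi>" and cd\<phi>: "continuous_on U (deriv \<phi>)"
    using U holomorphic_on_imp_continuous_on holomorphic_deriv by blast+
  have c\<phi>o: "continuous_on ?R (\<lambda>x. \<phi> (off j (fst x) (snd x)))"
    by (rule continuous_on_compose2[OF c\<phi> off_continuous[OF j]]) (use oU[OF j] in auto)
  have cdo: "continuous_on ?R (\<lambda>x. deriv \<phi> (off j (fst x) (snd x)))"
    by (rule continuous_on_compose2[OF cd\<phi> off_continuous[OF j]]) (use oU[OF j] in auto)
  have c\<theta>: "continuous_on ?R (\<lambda>x. \<theta> (j, snd x))"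
    by (rule continuous_on_compose2[OF continuous_\<theta>[OF j]]) (auto intro!: continuous_intros)
  have cF: "continuous_on ?R (\<lambda>x. F (off j (fst x) (snd x)))"
    by (rule continuous_on_compose2[OF continuous_on_F off_continuous[OF j]]) (use off_in_closure[OF j] e in auto)
  have cl: "continuous_on ?R (\<lambda>x. logf j (fst x) (snd x))"
    unfolding logf_def using dom j by (intro continuous_intros c\<theta> cF) auto
  have slice: "continuous_on {0..e} (\<lambda>\<epsilon>. h (\<epsilon>, t))" if "continuous_on ?R h" "t \<in> {0..2*pi}" for h :: "real \<times> real \<Rightarrow> complex" and t
    by (rule continuous_on_compose2[OF that(1)]) (use that(2) in \<open>auto intro!: continuous_intros\<close>)
  have int: "continuous_on {0..e} (\<lambda>\<epsilon>. integral (cbox 0 (2*pi)) (\<lambda>t. logf j \<epsilon> t * (deriv \<phi> (off j \<epsilon> t) * off' j \<epsilon> t)))"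
    by (rule integral_continuous_on_param)
      (use cl cdo in \<open>auto simp: case_prod_beta intro!: continuous_intros off'_continuous j\<close>)
  show "continuous_on {0..e} P"
    unfolding P_def
    by (intro continuous_on_diff continuous_on_mult int[unfolded box_real]
        slice[OF cl, unfolded fst_conv snd_conv] slice[OF c\<phi>o, unfolded fst_conv snd_conv]) auto
  have chain: "((\<lambda>t. \<phi> (off j \<epsilon> t)) has_vector_derivative deriv \<phi> (off j \<epsilon> t) * off' j \<epsilon> t) (at t within {0..2*pi})"
    if "\<epsilon> \<in> {0..e}" for \<epsilon> t
  proof -
    have "(\<phi> has_field_derivative deriv \<phi> (off j \<epsilon> t)) (at (off j \<epsilon> t))"
      by (rule holomorphic_derivI[OF U(2,1) oU[OF j that]])
    from field_vector_diff_chain_within[OF has_vector_derivative_at_within[OF C1_curve.has_deriv[OF curve_off[OF j]]] has_field_derivative_at_within[OF this]]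
    show ?thesis by (simp add: o_def mult.commute)
  qed
  have cont: "continuous_on {0..2*pi} (\<lambda>t. deriv \<phi> (off j \<epsilon> t) * off' j \<epsilon> t)" if "\<epsilon> \<in> {0..e}" for \<epsilon>
    by (intro continuous_intros continuous_on_compose2[OF cd\<phi> C1_curve.cont_h[OF curve_off[OF j]]]
        continuous_on_subset[OF C1_curve.cont_deriv[OF curve_off[OF j]]]) (use oU[OF j that] in auto)
  show "((\<lambda>t. deriv f (off j \<epsilon> t) / f (off j \<epsilon> t) * off' j \<epsilon> t * \<phi> (off j \<epsilon> t)) has_integral P \<epsilon>) {0..2*pi}"
    if \<epsilon>: "0 < \<epsilon>" "\<epsilon> \<le> e" for \<epsilon>
    unfolding P_def
    by (rule has_integral_by_parts_complex[OF _ logf_deriv chain cont]) (use \<epsilon> e j dom in auto)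
  show "((\<lambda>t. \<i> * of_real (\<theta>' j t) * \<phi> (z j t)) has_integral P 0) {0..2*pi}" if "0 \<le> e"
  proof -
    have "((\<lambda>t. \<i> * of_real (\<theta>' j t) * \<phi> (z j t)) has_integral
      \<i> * of_real (\<theta> (j, 2*pi)) * \<phi> (z j (2*pi)) - \<i> * of_real (\<theta> (j, 0)) * \<phi> (z j 0)
      - integral {0..2*pi} (\<lambda>t. \<i> * of_real (\<theta> (j, t)) * (deriv \<phi> (off j 0 t) * off' j 0 t))) {0..2*pi}"
      using chain[of 0] cont[of 0] that
      by (intro has_integral_by_parts_complex has_vector_derivative_mult_right \<theta>_complex_deriv j) auto
    moreover have "integral {0..2*pi} (\<lambda>t. \<i> * of_real (\<theta> (j, t)) * (deriv \<phi> (off j 0 t) * off' j 0 t))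
       = integral {0..2*pi} (\<lambda>t. logf j 0 t * (deriv \<phi> (off j 0 t) * off' j 0 t))"
      by (rule Henstock_Kurzweil_Integration.integral_cong) (simp add: logf_0 j)
    ultimately show ?thesis by (simp add: P_def logf_0 j)
  qed
qed

text \<open>By \<open>Cauchy_off\<close> the integrals of \<open>H\<close> along the offset curves
  add up to 0 for every small positive \<open>\<epsilon>\<close>, and both parts of the integrand
  have integrals continuous at 0. The constant \<open>c\<close> makes room for subtracting a value
  that cancels a pole of \<open>\<phi>\<close>.\<close>

lemma boundary_identity:
  assumes U: "open U" "frontier \<Omega> \<subseteq> U" "\<phi> holomorphic_on U" and H: "H holomorphic_on \<Omega>"
    and H_eq: "\<And>\<zeta>. \<zeta> \<in> \<Omega> \<Longrightarrow> \<zeta> \<in> U \<Longrightarrow> \<zeta> \<notin> A \<Longrightarrow> H \<zeta> = \<phi> \<zeta> * (deriv f \<zeta> / f \<zeta> - ((\<Sum>k\<le>M. 1 / (\<zeta> - a k)) + c))"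
  shows "(\<Sum>j\<le>M. integral {0..2*pi} (\<lambda>s. \<i> * of_real (\<theta>' j s) * \<phi> (z j s)))
       = (\<Sum>j\<le>M. integral {0..2*pi} (\<lambda>s. \<phi> (z j s) * ((\<Sum>k\<le>M. 1 / (z j s - a k)) + c) * z' j s))"
proof -
  obtain e0 where e0: "e0 > 0" "e0 \<le> d"
    "\<forall>j\<le>M. \<forall>t\<in>{0..2*pi}. \<forall>\<epsilon>\<in>{0..e0}. F (off j \<epsilon> t) * exp (- \<i> * of_real (\<theta> (j, t))) \<notin> \<real>\<^sub>\<le>\<^sub>0"
    using logf_domain by blast
  \<comment> \<open>The offset curves must avoid the zeros of \<open>f\<close> too, so the compact
    frontier is thickened within \<open>U - A\<close>.\<close>
  have "open (U - A)" using U(1) finite_A finite_imp_closed by blast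
  moreover have "frontier \<Omega> \<subseteq> U - A" using U(2) A_subset \<Omega>_frontier_disjoint by blast
  moreover have "compact (frontier \<Omega>)" using bounded_\<Omega> by (rule compact_frontier_bounded)
  ultimately obtain r where r: "r > 0" "(\<Union>x\<in>frontier \<Omega>. ball x r) \<subseteq> U - A"
    using compact_subset_open_imp_ball_epsilon_subset by metis
  obtain e1 where e1: "e1 > 0" "\<And>j t \<epsilon>. j \<le> M \<Longrightarrow> \<bar>\<epsilon>\<bar> \<le> e1 \<Longrightarrow> dist (off j \<epsilon> t) (z j t) < r"
    using off_close[OF r(1)] by blast
  define e where "e = min e0 e1"
  have e: "e > 0" "e \<le> d" "e \<le> e0" "e \<le> e1" using e0 e1 by (auto simp: e_def)
  have oU: "off j \<epsilon> t \<in> U - A" if "j \<le> M" "\<epsilon> \<in> {0..e}" for j t \<epsilon>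
  proof -
    have "off j \<epsilon> t \<in> ball (z j t) r" using e1(2)[OF that(1), of \<epsilon> t] that(2) e by (auto simp: dist_commute)
    then show ?thesis using r(2) range_in_frontier[OF that(1)] by blast
  qed
  have dom: "\<forall>j\<le>M. \<forall>t\<in>{0..2*pi}. \<forall>\<epsilon>\<in>{0..e}. F (off j \<epsilon> t) * exp (- \<i> * of_real (\<theta> (j, t))) \<notin> \<real>\<^sub>\<le>\<^sub>0"
    using e0(3) e(3) by auto
  define P where "P j \<epsilon> = logf j \<epsilon> (2*pi) * \<phi> (off j \<epsilon> (2*pi)) - logf j \<epsilon> 0 * \<phi> (off j \<epsilon> 0)
      - integral {0..2*pi} (\<lambda>t. logf j \<epsilon> t * (deriv \<phi> (off j \<epsilon> t) * off' j \<epsilon> t))" for j \<epsilon>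
  have oU': "\<And>j t \<epsilon>. j \<le> M \<Longrightarrow> \<epsilon> \<in> {0..e} \<Longrightarrow> off j \<epsilon> t \<in> U" using oU by blast
  note P = integral_log_derivative_off[OF e(2) dom U(1,3) oU', folded P_def]
  define q where "q \<zeta> = \<phi> \<zeta> * ((\<Sum>k\<le>M. 1 / (\<zeta> - a k)) + c)" for \<zeta>
  have cq: "continuous_on (U - A) q"
    unfolding q_def using holomorphic_on_imp_continuous_on[OF U(3)]
    by (intro continuous_intros) (auto intro: continuous_on_subset)
  define R where "R j \<epsilon> = integral {0..2*pi} (\<lambda>s. q (off j \<epsilon> s) * off' j \<epsilon> s)" for j \<epsilon>
  have cR: "continuous_on {0..e} (R j)" if j: "j \<le> M" for j
  proof -
    have "continuous_on ({0..e} \<times> cbox 0 (2*pi)) (\<lambda>x. q (off j (fst x) (snd x)) * off' j (fst x) (snd x))"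
      by (intro continuous_on_mult continuous_on_compose2[OF cq off_continuous[OF j]] off'_continuous j image_subsetI oU[OF j]) auto
    then have "continuous_on {0..e} (\<lambda>\<epsilon>. integral (cbox 0 (2*pi)) (\<lambda>s. q (off j \<epsilon> s) * off' j \<epsilon> s))"
      by (intro integral_continuous_on_param) (simp add: case_prod_beta)
    then show ?thesis by (simp add: R_def[abs_def])
  qed
  define S where "S \<epsilon> = (\<Sum>j\<le>M. P j \<epsilon> - R j \<epsilon>)" for \<epsilon>
  have cS: "continuous_on {0..e} S"
    unfolding S_def using P(1) cR by (intro continuous_intros) auto
  have S0: "S \<epsilon> = 0" if \<epsilon>: "\<epsilon> \<in> {0<..e}" for \<epsilon>
  proof -
    have \<epsilon>': "0 < \<epsilon>" "\<epsilon> \<le> d" using \<epsilon> e by auto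
    have "P j \<epsilon> - R j \<epsilon> = integral {0..2*pi} (\<lambda>s. H (off j \<epsilon> s) * off' j \<epsilon> s)" if j: "j \<le> M" for j
    proof -
      have "(\<lambda>s. q (off j \<epsilon> s) * off' j \<epsilon> s) integrable_on {0..2*pi}"
        by (intro integrable_continuous_real continuous_on_mult continuous_on_compose2[OF cq C1_curve.cont_h[OF curve_off[OF j]]]
          continuous_on_subset[OF C1_curve.cont_deriv[OF curve_off[OF j]]] image_subsetI oU[OF j]) (use \<epsilon> in auto)
      then have "((\<lambda>s. q (off j \<epsilon> s) * off' j \<epsilon> s) has_integral R j \<epsilon>) {0..2*pi}"
        by (simp add: R_def integrable_integral)
      moreover have "((\<lambda>t. deriv f (off j \<epsilon> t) / f (off j \<epsilon> t) * off' j \<epsilon> t * \<phi> (off j \<epsilon> t)) has_integral P j \<epsilon>) {0..2*pi}"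
        using P(2)[of j \<epsilon>] j \<epsilon> by auto
      ultimately have "((\<lambda>t. deriv f (off j \<epsilon> t) / f (off j \<epsilon> t) * off' j \<epsilon> t * \<phi> (off j \<epsilon> t) - q (off j \<epsilon> t) * off' j \<epsilon> t)
          has_integral P j \<epsilon> - R j \<epsilon>) {0..2*pi}" by (rule has_integral_diff[rotated])
      moreover have "deriv f (off j \<epsilon> t) / f (off j \<epsilon> t) * off' j \<epsilon> t * \<phi> (off j \<epsilon> t) - q (off j \<epsilon> t) * off' j \<epsilon> t
          = H (off j \<epsilon> t) * off' j \<epsilon> t" for t
      proof -
        have H: "H (off j \<epsilon> t) = \<phi> (off j \<epsilon> t) * (deriv f (off j \<epsilon> t) / f (off j \<epsilon> t) - ((\<Sum>k\<le>M. 1 / (off j \<epsilon> t - a k)) + c))"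
          using oU[OF j, of \<epsilon> t] off_in[OF j \<epsilon>', of t] \<epsilon> by (intro H_eq) auto
        have "X * w * p - p * Y * w = p * (X - Y) * w" for X Y w p :: complex by (simp add: algebra_simps)
        then show ?thesis unfolding H q_def .
      qed
      ultimately show ?thesis by (simp add: integral_unique)
    qed
    then have "S \<epsilon> = (\<Sum>j\<le>M. integral {0..2*pi} (\<lambda>s. H (off j \<epsilon> s) * off' j \<epsilon> s))" by (simp add: S_def)
    also have "\<dots> = 0" by (rule Cauchy_off[OF \<epsilon>' H])
    finally show ?thesis .
  qed
  have "S 0 = 0"
  proof (rule continuous_constant_on_closure[of "{0<..e}" S])
    show "continuous_on (closure {0<..e}) S" using cS e(1) by simp
  qed (use S0 e(1) in auto)
  then have "(\<Sum>j\<le>M. P j 0) = (\<Sum>j\<le>M. R j 0)" by (simp add: S_def sum_subtractf)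
  moreover have "P j 0 = integral {0..2*pi} (\<lambda>s. \<i> * of_real (\<theta>' j s) * \<phi> (z j s))" if "j \<le> M" for j
    using P(3)[of j] that e(1) by (simp add: integral_unique)
  ultimately show "(\<Sum>j\<le>M. integral {0..2*pi} (\<lambda>s. \<i> * of_real (\<theta>' j s) * \<phi> (z j s)))
       = (\<Sum>j\<le>M. integral {0..2*pi} (\<lambda>s. \<phi> (z j s) * ((\<Sum>k\<le>M. 1 / (z j s - a k)) + c) * z' j s))"
    by (simp add: R_def q_def)
qed

end

section \<open>Cauchy transforms and degrees\<close>

text \<open>If \<open>y'\<close> exceeded \<open>- \<kappa>\<close> near 0, so would
  \<open>y x / x\<close> by the mean value theorem. To be applied to the logarithm of the modulus of
  \<open>f\<close> along the inner normal.\<close>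

lemma derivative_limit_le:
  fixes y y' :: "real \<Rightarrow> real"
  assumes e: "e > 0" and c: "continuous_on {0..e} y" and y0: "y 0 = 0"
    and dy: "\<And>x. 0 < x \<Longrightarrow> x < e \<Longrightarrow> (y has_real_derivative y' x) (at x)"
    and lim: "(y' \<longlongrightarrow> l) (at_right 0)"
    and le: "\<And>x. 0 < x \<Longrightarrow> x < e \<Longrightarrow> y x \<le> - \<kappa> * x"
  shows "l \<le> - \<kappa>"
proof (rule ccontr)
  assume "\<not> ?thesis"
  then have "\<forall>\<^sub>F x in at_right 0. - \<kappa> < y' x" using lim by (intro order_tendstoD) auto
  then obtain b where b: "b > 0" "\<And>x. 0 < x \<Longrightarrow> x < b \<Longrightarrow> - \<kappa> < y' x"
    by (auto simp: eventually_at_right_field)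
  define x where "x = min b e / 2"
  have x: "0 < x" "x < b" "x < e" using b(1) e by (auto simp: x_def)
  have "\<exists>D \<xi>. 0 < \<xi> \<and> \<xi> < x \<and> DERIV y \<xi> :> D \<and> y x - y 0 = (x - 0) * D"
  proof (rule MVT[OF x(1)])
    show "continuous_on {0..x} y" using c by (rule continuous_on_subset) (use x in auto)
    show "y differentiable (at u)" if "0 < u" "u < x" for u
      using dy[of u] that x by (auto simp: real_differentiable_def)
  qed
  then obtain D \<xi> where \<xi>: "0 < \<xi>" "\<xi> < x" "DERIV y \<xi> :> D" "y x = x * D" using y0 by auto
  have "D = y' \<xi>" using DERIV_unique[OF \<xi>(3) dy[of \<xi>]] \<xi>(1,2) x by auto
  then have "x * - \<kappa> < x * D" using b(2)[of \<xi>] \<xi> x by (intro mult_strict_left_mono) auto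
  then have "x * - \<kappa> < y x" by (simp only: \<xi>(4))
  then show False using le[OF x(1,3)] by (simp add: mult.commute)
qed

lemma (in smooth_jordan_curve) has_integral_winding_number:
  assumes "u \<notin> range g"
  shows "((\<lambda>s. g' s / (g s - u)) has_integral 2 * pi * \<i> * winding_number (bdry_path g) u) {0..2*pi}"
proof -
  have int: "(\<lambda>s. g' s / (g s - u)) integrable_on {0..2*pi}"
    using assms by (intro integrable_continuous_real continuous_intros cont_g cont_g') auto
  have eq: "2 * pi * \<i> * winding_number (bdry_path g) u = integral {0..2*pi} (\<lambda>s. g' s / (g s - u))"
    by (rule winding_number_bdry_path) (use assms in blast)
  show ?thesis unfolding eq by (rule integrable_integral[OF int])
qed

context mc_boundary
begin

lemma off_curve_range: "j \<le> M \<Longrightarrow> w \<notin> frontier \<Omega> \<Longrightarrow> w \<notin> range (z j)"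
  by (auto simp: frontier_eq)

lemma integral_partial_fraction:
  assumes j: "j \<le> M" and w: "w \<notin> range (z j)" and b: "b \<notin> range (z j)" and wb: "w \<noteq> b"
  shows "((\<lambda>s. 1 / (z j s - w) * (1 / (z j s - b)) * z' j s) has_integral
    2 * pi * \<i> / (w - b) * (wn j w - wn j b)) {0..2*pi}"
proof -
  interpret smooth_jordan_curve "z j" by (rule curve[OF j])
  have nz: "z j s - w \<noteq> 0" "z j s - b \<noteq> 0" for s using w b by auto
  have "1 / (z j s - w) * (1 / (z j s - b)) * z' j s = 1 / (w - b) * (z' j s / (z j s - w) - z' j s / (z j s - b))" for s
  proof -
    have "X / P - X / Q = X * (Q - P) / (P * Q)" if "P \<noteq> 0" "Q \<noteq> 0" for X P Q :: complex
      using that by (simp add: field_simps)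
    from this[OF nz[of s], of "z' j s"] wb show ?thesis by simp
  qed
  moreover have "((\<lambda>s. 1 / (w - b) * (z' j s / (z j s - w) - z' j s / (z j s - b))) has_integral
     1 / (w - b) * (2 * pi * \<i> * wn j w - 2 * pi * \<i> * wn j b)) {0..2*pi}"
    by (intro has_integral_mult_right has_integral_diff has_integral_winding_number w b)
  ultimately show ?thesis by (simp add: right_diff_distrib)
qed

text \<open>The Cauchy transform of the measure \<open>\<theta>' ds\<close> on one curve; it
  integrates against \<open>ds\<close>, so there is no factor \<open>z'\<close>.\<close>

definition CT :: "nat \<Rightarrow> complex \<Rightarrow> complex" where
  "CT j w = integral {0..2*pi} (\<lambda>s. of_real (\<theta>' j s) / (z j s - w))"

text \<open>Away from the curve the derivative can be moved to the smooth kernel. This yields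
  integrability and, in \<open>CT_continuous\<close>, continuity in \<open>w\<close> without any
  bound for \<open>\<theta>'\<close>.\<close>

lemma CT_by_parts:
  assumes j: "j \<le> M" and w: "w \<notin> range (z j)"
  shows "((\<lambda>s. of_real (\<theta>' j s) / (z j s - w)) has_integral
    of_real (\<theta> (j, 2*pi)) / (z j (2*pi) - w) - of_real (\<theta> (j, 0)) / (z j 0 - w)
    + integral {0..2*pi} (\<lambda>s. of_real (\<theta> (j, s)) * (z' j s / (z j s - w)\<^sup>2))) {0..2*pi}"
proof -
  interpret smooth_jordan_curve "z j" by (rule curve[OF j])
  have nz: "z j s - w \<noteq> 0" for s using w by auto
  have d: "((\<lambda>s. 1 / (z j s - w)) has_vector_derivative - (z' j s / (z j s - w)\<^sup>2)) (at s within {0..2*pi})" for s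
  proof -
    have "((\<lambda>u. 1 / (u - w)) has_field_derivative - (1 / (z j s - w)\<^sup>2)) (at (z j s))"
      using nz[of s] by (auto intro!: derivative_eq_intros simp: power2_eq_square)
    from field_vector_diff_chain_within[OF has_vector_derivative_at_within[OF dg] has_field_derivative_at_within[OF this]]
    show ?thesis by (simp add: o_def)
  qed
  have "continuous_on {0..2*pi} (\<lambda>s. - (z' j s / (z j s - w)\<^sup>2))"
    using nz by (intro continuous_intros cont_g cont_g') auto
  from has_integral_by_parts_complex[OF _ \<theta>_complex_deriv[OF j] d this]
  show ?thesis by simp
qed

lemma CT_integrable: "j \<le> M \<Longrightarrow> w \<notin> range (z j) \<Longrightarrow> (\<lambda>s. of_real (\<theta>' j s) / (z j s - w)) integrable_on {0..2*pi}"
  using CT_by_parts by blast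

lemma CT_continuous:
  assumes j: "j \<le> M" and w: "w \<notin> range (z j)"
  shows "isCont (CT j) w"
proof -
  interpret smooth_jordan_curve "z j" by (rule curve[OF j])
  let ?U = "- range (z j)"
  have op: "open ?U" using compact_range[OF j] compact_imp_closed by blast
  have "continuous_on (?U \<times> cbox 0 (2*pi)) (\<lambda>x. of_real (\<theta> (j, snd x)) * (z' j (snd x) / (z j (snd x) - fst x)\<^sup>2))"
    by (intro continuous_intros continuous_on_compose2[OF continuous_\<theta>[OF j]] continuous_on_compose2[OF cont_g[of UNIV]]
        continuous_on_compose2[OF cont_g'[of UNIV]]) auto
  then have "continuous_on ?U (\<lambda>w. integral (cbox 0 (2*pi)) (\<lambda>s. of_real (\<theta> (j, s)) * (z' j s / (z j s - w)\<^sup>2)))"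
    by (intro integral_continuous_on_param) (simp add: case_prod_beta)
  then have "continuous_on ?U (\<lambda>w. of_real (\<theta> (j, 2*pi)) / (z j (2*pi) - w) - of_real (\<theta> (j, 0)) / (z j 0 - w)
    + integral {0..2*pi} (\<lambda>s. of_real (\<theta> (j, s)) * (z' j s / (z j s - w)\<^sup>2)))"
    by (intro continuous_intros) auto
  then have "continuous_on ?U (CT j)"
  proof (rule continuous_on_eq)
    fix x assume "x \<in> ?U"
    then have "x \<notin> range (z j)" by simp
    from integral_unique[OF CT_by_parts[OF j this]]
    show "of_real (\<theta> (j, 2*pi)) / (z j (2*pi) - x) - of_real (\<theta> (j, 0)) / (z j 0 - x)
      + integral {0..2*pi} (\<lambda>s. of_real (\<theta> (j, s)) * (z' j s / (z j s - x)\<^sup>2)) = CT j x"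
      by (simp only: CT_def)
  qed
  then show ?thesis using w op by (simp add: continuous_on_eq_continuous_at)
qed

lemma sum_winding: "w \<notin> frontier \<Omega> \<Longrightarrow> (\<Sum>j\<le>M. wn j w) = (if w \<in> \<Omega> then 1 else 0)"
  using sum_winding_inside sum_winding_outside closure_Un_frontier[of \<Omega>] by auto

lemma A_off_frontier: "k \<le> M \<Longrightarrow> a k \<notin> frontier \<Omega>"
  using A_subset \<Omega>_frontier_disjoint by blast

text \<open>This is \<open>boundary_identity\<close> for the Cauchy kernel at \<open>w\<close>.
  Partial fractions turn its right-hand side into winding numbers about \<open>w\<close> and the
  zeros, whose sums over all curves are known.\<close>

lemma Cauchy_transform_sum:
  assumes w: "w \<notin> frontier \<Omega>" "w \<notin> A"
  shows "(\<Sum>j\<le>M. CT j w) = 2 * pi * ((if w \<in> \<Omega> then deriv f w / f w else 0) - (\<Sum>k\<le>M. 1 / (w - a k)))"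
proof -
  obtain G where G: "G holomorphic_on \<Omega>" "\<And>w. w \<in> \<Omega> \<Longrightarrow> w \<notin> A \<Longrightarrow> deriv f w / f w = G w + (\<Sum>k\<le>M. 1 / (w - a k))"
    using log_deriv_ext by blast
  \<comment> \<open>For \<open>w\<close> in \<open>\<Omega>\<close> the kernel has a pole there;
    subtracting \<open>G w\<close> makes the quotient a holomorphic divided difference.\<close>
  define c where "c = (if w \<in> \<Omega> then G w else 0)"
  define H where "H \<zeta> = (if \<zeta> = w then deriv G w else (G \<zeta> - c) / (\<zeta> - w))" for \<zeta>
  have H: "H holomorphic_on \<Omega>"
  proof (cases "w \<in> \<Omega>")
    case True
    then show ?thesis using pole_lemma_open[OF G(1) open_\<Omega>, of w] by (simp add: H_def[abs_def] c_def cong: if_cong)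
  next
    case False
    then have "(\<lambda>\<zeta>. (G \<zeta> - c) / (\<zeta> - w)) holomorphic_on \<Omega>" by (intro holomorphic_intros G) auto
    then show ?thesis by (rule holomorphic_transform) (use False in \<open>auto simp: H_def\<close>)
  qed
  have "(\<Sum>j\<le>M. integral {0..2*pi} (\<lambda>s. \<i> * of_real (\<theta>' j s) * (1 / (z j s - w))))
     = (\<Sum>j\<le>M. integral {0..2*pi} (\<lambda>s. 1 / (z j s - w) * ((\<Sum>k\<le>M. 1 / (z j s - a k)) + c) * z' j s))"
  proof (rule boundary_identity[where U="- {w}" and \<phi>="\<lambda>\<zeta>. 1 / (\<zeta> - w)", OF _ _ _ H])
    fix \<zeta> assume "\<zeta> \<in> \<Omega>" "\<zeta> \<in> - {w}" "\<zeta> \<notin> A"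
    then show "H \<zeta> = 1 / (\<zeta> - w) * (deriv f \<zeta> / f \<zeta> - ((\<Sum>k\<le>M. 1 / (\<zeta> - a k)) + c))"
      by (simp add: H_def G(2))
  qed (use w in \<open>auto intro!: holomorphic_intros\<close>)
  also have "(\<Sum>j\<le>M. integral {0..2*pi} (\<lambda>s. \<i> * of_real (\<theta>' j s) * (1 / (z j s - w)))) = \<i> * (\<Sum>j\<le>M. CT j w)"
    by (simp add: CT_def sum_distrib_left mult.assoc flip: integral_mult_right)
  also have "(\<Sum>j\<le>M. integral {0..2*pi} (\<lambda>s. 1 / (z j s - w) * ((\<Sum>k\<le>M. 1 / (z j s - a k)) + c) * z' j s))
     = (\<Sum>j\<le>M. (\<Sum>k\<le>M. 2 * pi * \<i> / (w - a k) * (wn j w - wn j (a k)))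
        + c * (2 * pi * \<i> * wn j w))"
  proof (rule sum.cong[OF refl])
    fix j assume "j \<in> {..M}"
    then have j: "j \<le> M" by simp
    interpret smooth_jordan_curve "z j" by (rule curve[OF j])
    have wr: "w \<notin> range (z j)" by (rule off_curve_range[OF j w(1)])
    have "((\<lambda>s. (\<Sum>k\<le>M. 1 / (z j s - w) * (1 / (z j s - a k)) * z' j s) + c * (z' j s / (z j s - w))) has_integral
      (\<Sum>k\<le>M. 2 * pi * \<i> / (w - a k) * (wn j w - wn j (a k)))
        + c * (2 * pi * \<i> * wn j w)) {0..2*pi}"
      using w(2) by (intro has_integral_add has_integral_sum has_integral_mult_right integral_partial_fraction has_integral_winding_number j wr
        off_curve_range[OF j A_off_frontier]) auto
    moreover have "(\<Sum>k\<le>M. 1 / (z j s - w) * (1 / (z j s - a k)) * z' j s) + c * (z' j s / (z j s - w))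
      = 1 / (z j s - w) * ((\<Sum>k\<le>M. 1 / (z j s - a k)) + c) * z' j s" for s
      by (simp add: distrib_left distrib_right sum_distrib_left sum_distrib_right sum_divide_distrib)
    ultimately show "integral {0..2*pi} (\<lambda>s. 1 / (z j s - w) * ((\<Sum>k\<le>M. 1 / (z j s - a k)) + c) * z' j s)
      = (\<Sum>k\<le>M. 2 * pi * \<i> / (w - a k) * (wn j w - wn j (a k)))
        + c * (2 * pi * \<i> * wn j w)"
      by (simp add: integral_unique)
  qed
  also have "\<dots> = (\<Sum>k\<le>M. 2 * pi * \<i> / (w - a k) * ((\<Sum>j\<le>M. wn j w) - (\<Sum>j\<le>M. wn j (a k))))
      + c * (2 * pi * \<i> * (\<Sum>j\<le>M. wn j w))"
    by (subst sum.distrib, subst sum.swap) (simp add: sum_distrib_left sum_subtractf right_diff_distrib)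
  \<comment> \<open>Inside \<open>\<Omega>\<close> the pole terms vanish and only
    \<open>c = G w\<close> is left, which contains the sum of the poles with a minus sign; outside,
    \<open>c\<close> is 0 and the pole terms have factor -1.\<close>
  also have "\<dots> = (\<Sum>k\<le>M. 2 * pi * \<i> / (w - a k) * ((if w \<in> \<Omega> then 1 else 0) - 1)) + c * (2 * pi * \<i> * (if w \<in> \<Omega> then 1 else 0))"
  proof -
    have "(\<Sum>j\<le>M. wn j (a k)) = 1" if "k \<in> {..M}" for k
      using sum_winding_inside A_subset that by blast
    then show ?thesis by (simp only: sum_winding[OF w(1)] cong: sum.cong)
  qed
  also have "\<dots> = \<i> * (2 * pi * ((if w \<in> \<Omega> then deriv f w / f w else 0) - (\<Sum>k\<le>M. 1 / (w - a k))))"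
    using w(2) by (auto simp: c_def G(2) sum_distrib_left sum_negf algebra_simps)
  finally show ?thesis by (simp only: mult_cancel_left) simp
qed

text \<open>The argument principle, as the case of \<open>boundary_identity\<close> with kernel 1
  and \<open>c = 0\<close>: each of the \<open>M + 1\<close> listed zeros has total winding number
  1.\<close>

lemma total_degree: "(\<Sum>j\<le>M. \<theta> (j, 2*pi) - \<theta> (j, 0)) = 2 * pi * (real M + 1)"
proof -
  obtain G where G: "G holomorphic_on \<Omega>" "\<And>w. w \<in> \<Omega> \<Longrightarrow> w \<notin> A \<Longrightarrow> deriv f w / f w = G w + (\<Sum>k\<le>M. 1 / (w - a k))"
    using log_deriv_ext by blast
  have "(\<Sum>j\<le>M. integral {0..2*pi} (\<lambda>s. \<i> * of_real (\<theta>' j s) * 1))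
     = (\<Sum>j\<le>M. integral {0..2*pi} (\<lambda>s. 1 * ((\<Sum>k\<le>M. 1 / (z j s - a k)) + 0) * z' j s))"
    by (rule boundary_identity[where U=UNIV and \<phi>="\<lambda>\<zeta>. 1", OF _ _ _ G(1)]) (auto simp: G(2))
  also have "(\<Sum>j\<le>M. integral {0..2*pi} (\<lambda>s. \<i> * of_real (\<theta>' j s) * 1)) = (\<Sum>j\<le>M. \<i> * (of_real (\<theta> (j, 2*pi)) - of_real (\<theta> (j, 0))))"
  proof (rule sum.cong[OF refl])
    fix j assume "j \<in> {..M}"
    then have "((\<lambda>s. complex_of_real (\<theta>' j s)) has_integral of_real (\<theta> (j, 2*pi)) - of_real (\<theta> (j, 0))) {0..2*pi}"
      by (intro fundamental_theorem_of_calculus \<theta>_complex_deriv) auto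
    from integral_unique[OF has_integral_mult_right[OF this, of \<i>]]
    show "integral {0..2*pi} (\<lambda>s. \<i> * of_real (\<theta>' j s) * 1) = \<i> * (of_real (\<theta> (j, 2*pi)) - of_real (\<theta> (j, 0)))"
      by (simp only: mult_1_right)
  qed
  also have "(\<Sum>j\<le>M. integral {0..2*pi} (\<lambda>s. 1 * ((\<Sum>k\<le>M. 1 / (z j s - a k)) + 0) * z' j s))
     = (\<Sum>j\<le>M. \<Sum>k\<le>M. 2 * pi * \<i> * wn j (a k))"
  proof (rule sum.cong[OF refl])
    fix j assume "j \<in> {..M}"
    then have j: "j \<le> M" by simp
    interpret smooth_jordan_curve "z j" by (rule curve[OF j])
    have "((\<lambda>s. \<Sum>k\<le>M. z' j s / (z j s - a k)) has_integral (\<Sum>k\<le>M. 2 * pi * \<i> * wn j (a k))) {0..2*pi}"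
    proof (rule has_integral_sum)
      fix k assume "k \<in> {..M}"
      then have ak: "a k \<notin> range (z j)" using off_curve_range[OF j A_off_frontier] by simp
      then show "((\<lambda>s. z' j s / (z j s - a k)) has_integral 2 * pi * \<i> * wn j (a k)) {0..2*pi}"
        by (rule has_integral_winding_number)
    qed simp
    moreover have "(\<Sum>k\<le>M. z' j s / (z j s - a k)) = 1 * ((\<Sum>k\<le>M. 1 / (z j s - a k)) + 0) * z' j s" for s
      by (simp add: sum_distrib_right)
    ultimately show "integral {0..2*pi} (\<lambda>s. 1 * ((\<Sum>k\<le>M. 1 / (z j s - a k)) + 0) * z' j s)
       = (\<Sum>k\<le>M. 2 * pi * \<i> * wn j (a k))"
      by (simp add: integral_unique)
  qed
  also have "\<dots> = (\<Sum>k\<le>M. 2 * pi * \<i> * (\<Sum>j\<le>M. wn j (a k)))"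
    by (subst sum.swap) (simp add: sum_distrib_left)
  also have "\<dots> = (\<Sum>k\<le>M. 2 * pi * \<i> * 1)"
    using sum_winding_inside A_subset by (intro sum.cong refl arg_cong2[where f="(*)"]) blast+
  also have "\<dots> = \<i> * of_real (2 * pi * (real M + 1))" by simp
  finally have "\<i> * of_real (\<Sum>j\<le>M. \<theta> (j, 2*pi) - \<theta> (j, 0)) = \<i> * of_real (2 * pi * (real M + 1))"
    by (simp add: sum_distrib_left)
  then show ?thesis by (simp only: mult_cancel_left of_real_eq_iff) simp
qed

section \<open>Limits along the normal from both sides\<close>

lemma normal_points_eventually:
  assumes j: "j \<le> M"
  shows "\<forall>\<^sub>F \<delta> in at_right 0. 0 < \<delta> \<and> \<delta> \<le> d \<and> off j \<delta> t \<notin> A"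
proof -
  have "\<forall>\<^sub>F \<delta> in at_right 0. off j \<delta> t \<in> - A"
  proof (rule topological_tendstoD)
    have "((\<lambda>\<delta>. off j \<delta> t) \<longlongrightarrow> off j 0 t) (at_right 0)"
      unfolding off_def by (intro tendsto_intros)
    then show "((\<lambda>\<delta>. off j \<delta> t) \<longlongrightarrow> z j t) (at_right 0)" by simp
    show "open (- A)" using finite_A finite_imp_closed by blast
    show "z j t \<in> - A" using range_in_frontier[OF j] A_subset \<Omega>_frontier_disjoint by blast
  qed
  moreover have "\<forall>\<^sub>F \<delta> in at_right 0. 0 < \<delta> \<and> \<delta> \<le> d"
    using d_pos by (intro eventually_at_rightI[where b=d]) auto
  ultimately show ?thesis by eventually_elim auto
qed

lemma off_neg: "off j (- \<delta>) t = z j t - \<i> * of_real \<delta> * z' j t"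
  by (simp add: off_def)

lemma off_tendsto: "((\<lambda>\<delta>. off j \<delta> t) \<longlongrightarrow> z j t) (at_right 0)" "((\<lambda>\<delta>. off j (- \<delta>) t) \<longlongrightarrow> z j t) (at_right 0)"
proof -
  have "((\<lambda>\<delta>. off j \<delta> t) \<longlongrightarrow> off j 0 t) (at_right 0)" "((\<lambda>\<delta>. off j (- \<delta>) t) \<longlongrightarrow> off j (- 0) t) (at_right 0)"
    unfolding off_def by (intro tendsto_intros)+
  then show "((\<lambda>\<delta>. off j \<delta> t) \<longlongrightarrow> z j t) (at_right 0)" "((\<lambda>\<delta>. off j (- \<delta>) t) \<longlongrightarrow> z j t) (at_right 0)" by simp_all
qed

lemma two_sided_transforms:
  assumes j: "j \<le> M" and \<delta>: "0 < \<delta> \<and> \<delta> \<le> d \<and> off j \<delta> t \<notin> A"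
  shows "(\<Sum>k\<le>M. CT k (off j \<delta> t)) = 2 * pi * (deriv f (off j \<delta> t) / f (off j \<delta> t) - (\<Sum>k\<le>M. 1 / (off j \<delta> t - a k)))"
    and "(\<Sum>k\<le>M. CT k (off j (- \<delta>) t)) = - 2 * pi * (\<Sum>k\<le>M. 1 / (off j (- \<delta>) t - a k))"
    and "off j \<delta> t \<notin> frontier \<Omega>" "off j (- \<delta>) t \<notin> frontier \<Omega>"
proof -
  have "off j \<delta> t \<in> \<Omega>" "off j (- \<delta>) t \<notin> closure \<Omega>" using off_in[OF j] off_out[OF j] \<delta> by auto
  then have *: "off j \<delta> t \<in> \<Omega>" "off j \<delta> t \<notin> frontier \<Omega>" "off j (- \<delta>) t \<notin> \<Omega>" "off j (- \<delta>) t \<notin> frontier \<Omega>"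
    using \<Omega>_frontier_disjoint closure_Un_frontier[of \<Omega>] by auto
  moreover have "off j (- \<delta>) t \<notin> A" using *(3) A_subset by blast
  ultimately show "(\<Sum>k\<le>M. CT k (off j \<delta> t)) = 2 * pi * (deriv f (off j \<delta> t) / f (off j \<delta> t) - (\<Sum>k\<le>M. 1 / (off j \<delta> t - a k)))"
    and "(\<Sum>k\<le>M. CT k (off j (- \<delta>) t)) = - 2 * pi * (\<Sum>k\<le>M. 1 / (off j (- \<delta>) t - a k))"
    using Cauchy_transform_sum[of "off j \<delta> t"] Cauchy_transform_sum[of "off j (- \<delta>) t"] \<delta> by simp_all
  show "off j \<delta> t \<notin> frontier \<Omega>" "off j (- \<delta>) t \<notin> frontier \<Omega>" by (rule *)+
qed

lemma CT_other_tendsto: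
  assumes j: "j \<le> M" and k: "k \<in> {..M} - {j}"
  shows "((\<lambda>\<delta>. CT k (off j \<delta> t)) \<longlongrightarrow> CT k (z j t)) (at_right 0)"
    "((\<lambda>\<delta>. CT k (off j (- \<delta>) t)) \<longlongrightarrow> CT k (z j t)) (at_right 0)"
proof -
  have "isCont (CT k) (z j t)" using k disjoint_curves[of j k] j by (intro CT_continuous) auto
  then show "((\<lambda>\<delta>. CT k (off j \<delta> t)) \<longlongrightarrow> CT k (z j t)) (at_right 0)"
    "((\<lambda>\<delta>. CT k (off j (- \<delta>) t)) \<longlongrightarrow> CT k (z j t)) (at_right 0)"
    by (rule isCont_tendsto_compose[OF _ off_tendsto(1)] isCont_tendsto_compose[OF _ off_tendsto(2)])+
qed

lemma poles_tendsto:
  assumes j: "j \<le> M"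
  shows "((\<lambda>\<delta>. \<Sum>k\<le>M. 1 / (off j \<delta> t - a k)) \<longlongrightarrow> (\<Sum>k\<le>M. 1 / (z j t - a k))) (at_right 0)"
    "((\<lambda>\<delta>. \<Sum>k\<le>M. 1 / (off j (- \<delta>) t - a k)) \<longlongrightarrow> (\<Sum>k\<le>M. 1 / (z j t - a k))) (at_right 0)"
proof -
  have "z j t - a k \<noteq> 0" if "k \<in> {..M}" for k
    using off_curve_range[OF j A_off_frontier, of k] that by (metis atMost_iff eq_iff_diff_eq_0 rangeI)
  then show "((\<lambda>\<delta>. \<Sum>k\<le>M. 1 / (off j \<delta> t - a k)) \<longlongrightarrow> (\<Sum>k\<le>M. 1 / (z j t - a k))) (at_right 0)"
    "((\<lambda>\<delta>. \<Sum>k\<le>M. 1 / (off j (- \<delta>) t - a k)) \<longlongrightarrow> (\<Sum>k\<le>M. 1 / (z j t - a k))) (at_right 0)"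
    by (auto intro!: tendsto_intros off_tendsto)
qed

text \<open>In the difference of the two transforms the pole sums and the other curves drop out,
  being continuous at \<open>z j t\<close>. The curve itself contributes
  \<open>2 * \<i> / z' j t\<close> times an integral with limit \<open>pi * \<theta>' j t\<close>,
  and the factor \<open>z' j t / (2 * pi)\<close> normalizes this.\<close>

lemma radial_limit_log_derivative:
  assumes j: "j \<le> M" and t: "0 < t" "t < 2 * pi"
  shows "((\<lambda>\<delta>. z' j t * (deriv f (off j \<delta> t) / f (off j \<delta> t))) \<longlongrightarrow> \<i> * of_real (\<theta>' j t)) (at_right 0)"
proof -
  interpret smooth_jordan_curve "z j" by (rule curve[OF j])
  interpret arc: normalized_arc 0 "2 * pi" t "\<zeta> t" by (rule normalized_arc_\<zeta>[OF t])
  let ?v = "z' j t"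
  have v: "?v \<noteq> 0" by (rule g'_nz)
  have Fat: "((\<lambda>\<delta>. integral {0..2*pi} (\<lambda>s. of_real (\<theta>' j s) * (of_real \<delta> / ((\<zeta> t s)\<^sup>2 + (of_real \<delta>)\<^sup>2))))
     \<longlongrightarrow> of_real pi * of_real (\<theta>' j t)) (at_right 0)"
    by (rule arc.Fatou_kernel_limit[where \<theta>="\<lambda>s. of_real (\<theta> (j, s))" and \<zeta>'="\<lambda>s. z' j s / ?v"])
      (use v in \<open>auto intro!: \<zeta>_deriv continuous_intros cont_g' \<theta>_complex_deriv j\<close>)
  define I where "I \<delta> = integral {0..2*pi} (\<lambda>s. of_real (\<theta>' j s) * (of_real \<delta> / ((\<zeta> t s)\<^sup>2 + (of_real \<delta>)\<^sup>2)))" for \<delta> :: real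
  have CTj: "CT j (off j \<delta> t) - CT j (off j (- \<delta>) t) = 2 * \<i> / ?v * I \<delta>" if \<delta>: "0 < \<delta> \<and> \<delta> \<le> d \<and> off j \<delta> t \<notin> A" for \<delta>
  proof -
    have nf: "off j \<delta> t \<notin> range (z j)" "off j (- \<delta>) t \<notin> range (z j)"
      using two_sided_transforms(3,4)[OF j \<delta>] off_curve_range[OF j] by auto
    have "CT j (off j \<delta> t) - CT j (off j (- \<delta>) t)
       = integral {0..2*pi} (\<lambda>s. of_real (\<theta>' j s) / (z j s - off j \<delta> t) - of_real (\<theta>' j s) / (z j s - off j (- \<delta>) t))"
      unfolding CT_def by (rule Henstock_Kurzweil_Integration.integral_diff[symmetric]) (intro CT_integrable j nf)+
    also have "\<dots> = integral {0..2*pi} (\<lambda>s. 2 * \<i> / ?v * (of_real (\<theta>' j s) * (of_real \<delta> / ((\<zeta> t s)\<^sup>2 + (of_real \<delta>)\<^sup>2))))"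
    proof (rule Henstock_Kurzweil_Integration.integral_cong)
      fix s
      have "z j s \<noteq> off j \<delta> t" "z j s \<noteq> off j (- \<delta>) t" using nf by (metis rangeI)+
      then have k: "1 / (z j s - off j \<delta> t) - 1 / (z j s - off j (- \<delta>) t) = 2 * \<i> / ?v * (of_real \<delta> / ((\<zeta> t s)\<^sup>2 + (of_real \<delta>)\<^sup>2))"
        using two_sided_cauchy_kernel_diff[of \<delta> s t] \<delta> unfolding off_neg by (simp add: off_def)
      have "of_real (\<theta>' j s) / (z j s - off j \<delta> t) - of_real (\<theta>' j s) / (z j s - off j (- \<delta>) t)
         = of_real (\<theta>' j s) * (1 / (z j s - off j \<delta> t) - 1 / (z j s - off j (- \<delta>) t))" by (simp add: right_diff_distrib)
      then show "of_real (\<theta>' j s) / (z j s - off j \<delta> t) - of_real (\<theta>' j s) / (z j s - off j (- \<delta>) t)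
        = 2 * \<i> / ?v * (of_real (\<theta>' j s) * (of_real \<delta> / ((\<zeta> t s)\<^sup>2 + (of_real \<delta>)\<^sup>2)))"
        unfolding k by (simp only: ac_simps)
    qed
    also have "\<dots> = 2 * \<i> / ?v * I \<delta>" unfolding I_def by (rule integral_mult_right)
    finally show ?thesis .
  qed
  \<comment> \<open>The two one-sided identities, solved for \<open>z' j t\<close> times the
    logarithmic derivative.\<close>
  define R where "R \<delta> = ?v * ((\<Sum>k\<le>M. 1 / (off j \<delta> t - a k)) - (\<Sum>k\<le>M. 1 / (off j (- \<delta>) t - a k)))
      + ?v / (2 * pi) * (2 * \<i> / ?v * I \<delta> + (\<Sum>k\<in>{..M} - {j}. CT k (off j \<delta> t) - CT k (off j (- \<delta>) t)))" for \<delta>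
  have "(R \<longlongrightarrow> ?v * ((\<Sum>k\<le>M. 1 / (z j t - a k)) - (\<Sum>k\<le>M. 1 / (z j t - a k)))
      + ?v / (2 * pi) * (2 * \<i> / ?v * (of_real pi * of_real (\<theta>' j t)) + (\<Sum>k\<in>{..M} - {j}. CT k (z j t) - CT k (z j t)))) (at_right 0)"
    unfolding R_def I_def by (intro tendsto_intros poles_tendsto j Fat CT_other_tendsto) auto
  then have lim: "(R \<longlongrightarrow> \<i> * of_real (\<theta>' j t)) (at_right 0)" using v by (simp add: field_simps)
  have "\<forall>\<^sub>F \<delta> in at_right 0. R \<delta> = ?v * (deriv f (off j \<delta> t) / f (off j \<delta> t))"
    using normal_points_eventually[OF j, of t]
  proof eventually_elim
    case (elim \<delta>)
    note ts = two_sided_transforms(1,2)[OF j elim]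
    have "2 * \<i> / ?v * I \<delta> + (\<Sum>k\<in>{..M} - {j}. CT k (off j \<delta> t) - CT k (off j (- \<delta>) t))
        = (\<Sum>k\<le>M. CT k (off j \<delta> t) - CT k (off j (- \<delta>) t))"
      using j by (simp add: sum.remove[of "{..M}" j] CTj[OF elim])
    also have "\<dots> = 2 * pi * (deriv f (off j \<delta> t) / f (off j \<delta> t) - ((\<Sum>k\<le>M. 1 / (off j \<delta> t - a k)) - (\<Sum>k\<le>M. 1 / (off j (- \<delta>) t - a k))))"
      unfolding sum_subtractf ts by (simp add: algebra_simps)
    finally have "R \<delta> = ?v * ((\<Sum>k\<le>M. 1 / (off j \<delta> t - a k)) - (\<Sum>k\<le>M. 1 / (off j (- \<delta>) t - a k)))
       + ?v / (2 * pi) * (2 * pi * (deriv f (off j \<delta> t) / f (off j \<delta> t) - ((\<Sum>k\<le>M. 1 / (off j \<delta> t - a k)) - (\<Sum>k\<le>M. 1 / (off j (- \<delta>) t - a k)))))"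
      by (simp only: R_def)
    moreover have "V * S + V / (2 * pi) * (2 * pi * (X - S)) = V * X" for V S X :: complex
      by (simp add: field_simps)
    ultimately show ?case by simp
  qed
  from Lim_transform_eventually[OF lim this] show ?thesis .
qed

text \<open>
  Hopf's boundary point lemma: on the annulus between a touching disc of centre \<open>q\<close> and the concentric disc of half
  its radius \<open>R\<close>, the maximum principle applies to \<open>f ^ n * (R / (w - q))\<close> for large \<open>n\<close>.
\<close>

lemma normal_growth:
  assumes j: "j \<le> M"
  shows "\<exists>n>0. \<forall>\<delta>. 0 < \<delta> \<longrightarrow> \<delta> < d / 2 \<longrightarrow> norm (f (off j \<delta> t)) ^ n \<le> 1 - \<delta> / d"
proof -
  interpret smooth_jordan_curve "z j" by (rule curve[OF j])
  define q where "q = off j d t"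
  define R where "R = d * norm (z' j t)"
  have R: "R > 0" using d_pos g'_nz by (simp add: R_def)
  have qO: "q \<in> \<Omega>" using off_in[OF j] d_pos by (simp add: q_def)
  have "ball q R \<inter> frontier \<Omega> = {}"
    using discs[rule_format, OF j, of d t] d_pos by (simp add: q_def off_def R_def)
  moreover have "q \<in> ball q R \<inter> \<Omega>" using R qO by simp
  ultimately have bO: "ball q R \<subseteq> \<Omega>" using connected_Int_frontier[of "ball q R" \<Omega>] by blast
  have "closure (ball q R) \<subseteq> closure \<Omega>" by (rule closure_mono[OF bO])
  then have cO: "cball q R \<subseteq> closure \<Omega>" using R by simp
  have "\<exists>x\<in>cball q (R/2). \<forall>y\<in>cball q (R/2). norm (F y) \<le> norm (F x)"
    by (intro continuous_attains_sup continuous_intros continuous_on_subset[OF continuous_on_F]) (use cO R in auto)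
  then obtain x where x: "x \<in> cball q (R/2)" "\<And>y. y \<in> cball q (R/2) \<Longrightarrow> norm (F y) \<le> norm (F x)" by blast
  have "x \<in> \<Omega>" using x(1) bO R by (auto simp: subset_iff)
  then have "norm (F x) < 1" using f_ball by (auto simp: F_def image_subset_iff)
  \<comment> \<open>On the inner circle \<open>R / (w - q)\<close> has modulus 2, so the power of
    \<open>f\<close> must be below 1/2 there. On the outer circle the modulus is 1 and the bound
    \<open>norm (F w) \<le> 1\<close> is enough.\<close>
  then obtain n where n: "norm (F x) ^ n < 1/2" using real_arch_pow_inv[of "1/2" "norm (F x)"] by auto
  then have n0: "n > 0" by (cases n) auto
  define S where "S = ball q R - cball q (R/2)"
  have oS: "open S" by (auto simp: S_def)
  have "closure S \<subseteq> cball q R - ball q (R/2)"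
    by (rule closure_minimal) (auto simp: S_def intro!: closed_Diff)
  then have cS: "closure S \<subseteq> closure \<Omega>" "\<And>w. w \<in> closure S \<Longrightarrow> w \<noteq> q"
    "\<And>w. w \<in> closure S \<Longrightarrow> R/2 \<le> dist q w \<and> dist q w \<le> R"
    using cO R by (auto simp: not_less)
  have F1: "norm (F w) \<le> 1" if "w \<in> closure \<Omega>" for w
  proof (cases "w \<in> \<Omega>")
    case True then show ?thesis using f_ball by (auto simp: F_def image_subset_iff less_imp_le)
  next
    case False
    then show ?thesis using norm_F_frontier[of w] that open_\<Omega> by (simp add: frontier_def interior_open)
  qed
  have max: "norm (F w ^ n * (R / (w - q))) \<le> 1" if w: "w \<in> S" for w
  proof (rule maximum_modulus_frontier[OF _ _ _ _ w])
    have "(\<lambda>w. f w ^ n * (R / (w - q))) holomorphic_on S"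
      using bO R by (intro holomorphic_intros holomorphic_on_subset[OF holf]) (auto simp: S_def)
    then have "(\<lambda>w. F w ^ n * (R / (w - q))) holomorphic_on S"
      by (rule holomorphic_transform) (use bO in \<open>auto simp: S_def F_def\<close>)
    then show "(\<lambda>w. F w ^ n * (R / (w - q))) holomorphic_on interior S" using oS by (simp add: interior_open)
    \<comment> \<open>The outer circle passes through the boundary point \<open>z j t\<close>, so
      continuity up to it is that of \<open>F\<close>.\<close>
    show "continuous_on (closure S) (\<lambda>w. F w ^ n * (R / (w - q)))"
      using cS by (intro continuous_intros continuous_on_subset[OF continuous_on_F]) auto
    show "bounded S" unfolding S_def by (rule bounded_subset[OF bounded_ball]) auto
    fix w assume "w \<in> frontier S"
    then have w: "w \<in> closure S" "w \<notin> S" using oS by (auto simp: frontier_def interior_open)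
    show "norm (F w ^ n * (R / (w - q))) \<le> 1"
    proof (cases "dist q w \<le> R/2")
      case True
      then have dw: "dist q w = R/2" using cS(3)[OF w(1)] by simp
      have "norm (F w) ^ n \<le> norm (F x) ^ n" using x(2)[of w] True by (intro power_mono) auto
      then have "norm (F w) ^ n \<le> 1/2" using n by simp
      moreover have "norm (w - q) = R/2" using dw by (simp add: dist_norm norm_minus_commute)
      then have "norm (R / (w - q)) = R / (R/2)" unfolding norm_divide using R by (simp only: norm_of_real abs_of_pos)
      then have "norm (R / (w - q)) = 2" using R by simp
      ultimately show ?thesis by (simp only: norm_mult norm_power)
    next
      case False
      then have dw: "dist q w = R" using cS(3)[OF w(1)] w(2) by (auto simp: S_def)
      have "norm (F w) ^ n \<le> 1" using F1[of w] cS(1) w(1) by (intro power_le_one) auto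
      moreover have "norm (R / (w - q)) = 1" using dw R by (simp add: norm_divide dist_norm norm_minus_commute)
      ultimately show ?thesis by (simp only: norm_mult norm_power)
    qed
  qed
  have "norm (f (off j \<delta> t)) ^ n \<le> 1 - \<delta> / d" if \<delta>: "0 < \<delta>" "\<delta> < d / 2" for \<delta>
  proof -
    let ?w = "off j \<delta> t"
    have "?w - q = of_real (\<delta> - d) * (\<i> * z' j t)" by (simp add: q_def off_def algebra_simps)
    then have nw: "norm (?w - q) = (d - \<delta>) * norm (z' j t)" using \<delta> by (simp add: norm_mult del: of_real_diff)
    have "d * norm (z' j t) / 2 < (d - \<delta>) * norm (z' j t)" "(d - \<delta>) * norm (z' j t) < d * norm (z' j t)"
      using \<delta> g'_nz[of t] mult_strict_right_mono[of "d/2" "d - \<delta>" "norm (z' j t)"] mult_strict_right_mono[of "d - \<delta>" d "norm (z' j t)"] by auto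
    then have wS: "?w \<in> S" using nw by (simp add: S_def R_def dist_norm norm_minus_commute)
    have "?w \<in> \<Omega>" using off_in[OF j] \<delta> by simp
    then have "norm (f ?w) ^ n * (R / norm (?w - q)) \<le> 1"
      using max[OF wS] R by (simp add: F_def norm_mult norm_power norm_divide)
    \<comment> \<open>At this point the barrier factor exceeds 1 by an amount linear in
      \<open>\<delta>\<close>, which forces the linear decay of the power of
      \<open>f\<close>.\<close>
    moreover have "R / norm (?w - q) = d / (d - \<delta>)" using g'_nz[of t] by (simp add: nw R_def)
    ultimately have "norm (f ?w) ^ n * (d / (d - \<delta>)) \<le> 1" by simp
    then have "norm (f ?w) ^ n * d \<le> d - \<delta>" using \<delta> d_pos by (simp add: divide_simps)
    then show ?thesis using d_pos by (simp add: field_simps)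
  qed
  then show ?thesis using n0 by blast
qed

text \<open>Along the inner normal the logarithm of the modulus of \<open>f\<close> starts at 0, has
  derivative tending to \<open>- \<theta>' j t\<close>, and by \<open>normal_growth\<close> falls at
  least linearly.\<close>

lemma \<theta>'_pos:
  assumes j: "j \<le> M" and t: "0 < t" "t < 2 * pi"
  shows "\<theta>' j t > 0"
proof -
  obtain n where n: "n > 0" "\<And>\<delta>. 0 < \<delta> \<Longrightarrow> \<delta> < d / 2 \<Longrightarrow> norm (f (off j \<delta> t)) ^ n \<le> 1 - \<delta> / d"
    using normal_growth[OF j, of t] by blast
  obtain e0 where e0: "e0 > 0" "e0 \<le> d"
    "\<And>\<epsilon>. \<epsilon> \<in> {0..e0} \<Longrightarrow> F (off j \<epsilon> t) * exp (- \<i> * of_real (\<theta> (j, t))) \<notin> \<real>\<^sub>\<le>\<^sub>0"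
    using logf_domain j t by (metis atLeastAtMost_iff less_imp_le)
  define e where "e = min e0 (d / 2)"
  have e: "e > 0" "e \<le> e0" "e \<le> d / 2" using e0 d_pos by (auto simp: e_def)
  let ?E = "exp (- \<i> * of_real (\<theta> (j, t)))"
  \<comment> \<open>The factor \<open>?E\<close> has modulus 1, so this is the logarithm of the
    modulus of \<open>F\<close>; \<open>?E\<close> only keeps the argument of \<open>Ln\<close> off
    the cut.\<close>
  define y where "y \<delta> = Re (Ln (F (off j \<delta> t) * ?E))" for \<delta>
  have nE: "norm ?E = 1" by simp
  have c: "continuous_on {0..e} y"
  proof -
    have "continuous_on {0..e} (\<lambda>\<delta>. off j \<delta> t)" unfolding off_def by (intro continuous_intros)
    then have "continuous_on {0..e} (\<lambda>\<delta>. F (off j \<delta> t))"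
      by (rule continuous_on_compose2[OF continuous_on_F]) (use off_in_closure[OF j] e e0 in auto)
    then show ?thesis unfolding y_def using e0(3) e by (intro continuous_intros) auto
  qed
  have y0: "y 0 = 0" using t by (simp add: y_def F_z(1)[OF j] flip: exp_add)
  define y' where "y' \<delta> = - Im (z' j t * (deriv f (off j \<delta> t) / f (off j \<delta> t)))" for \<delta>
  have dy: "(y has_real_derivative y' x) (at x)" if x: "0 < x" "x < e" for x
  proof -
    have oO: "off j x t \<in> \<Omega>" using off_in[OF j] x e e0 by simp
    have dom: "f (off j x t) * ?E \<notin> \<real>\<^sub>\<le>\<^sub>0" using e0(3)[of x] x e oO by (simp add: F_def)
    then have nz: "f (off j x t) \<noteq> 0" by auto
    have D1: "((\<lambda>\<delta>. off j \<delta> t) has_vector_derivative \<i> * z' j t) (at x)"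
    proof -
      have "((\<lambda>\<delta>. z j t + of_real \<delta> * (\<i> * z' j t)) has_vector_derivative 0 + 1 * (\<i> * z' j t)) (at x)"
        by (intro has_vector_derivative_add has_vector_derivative_mult_left has_vector_derivative_const)
          (auto intro!: derivative_eq_intros has_vector_derivative_of_real)
      then show ?thesis by (simp add: off_def mult_ac)
    qed
    have D2: "((\<lambda>w. Ln (f w * ?E)) has_field_derivative deriv f (off j x t) / f (off j x t)) (at (off j x t))"
    proof -
      have "((\<lambda>w. f w * ?E) has_field_derivative deriv f (off j x t) * ?E) (at (off j x t))"
        by (intro DERIV_cmult_right holomorphic_derivI[OF holf open_\<Omega> oO])
      from DERIV_chain2[OF has_field_derivative_Ln[OF dom] this]
      show ?thesis using nz by (simp add: field_simps)
    qed
    have D3: "((\<lambda>\<delta>. Ln (f (off j \<delta> t) * ?E)) has_vector_derivative \<i> * z' j t * (deriv f (off j x t) / f (off j x t))) (at x)"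
      using field_vector_diff_chain_at[OF D1 D2] by (simp only: o_def)
    have "((\<lambda>\<delta>. Re (Ln (f (off j \<delta> t) * ?E))) has_real_derivative y' x) (at x)"
    proof -
      have "Re (\<i> * z' j t * X) = - Im (z' j t * X)" for X by (simp add: mult.assoc)
      then show ?thesis
        using bounded_linear.has_vector_derivative[OF bounded_linear_Re D3]
        by (simp only: has_real_derivative_iff_has_vector_derivative y'_def)
    qed
    then show ?thesis
    proof (rule has_field_derivative_transform_within_open[of _ _ _ "{0<..<e}"])
      fix u assume "u \<in> {0<..<e}"
      then have "off j u t \<in> \<Omega>" using off_in[OF j] e e0 by simp
      then show "Re (Ln (f (off j u t) * ?E)) = y u" by (simp add: y_def F_def)
    qed (use x in auto)
  qed
  have "((\<lambda>\<delta>. - Im (z' j t * (deriv f (off j \<delta> t) / f (off j \<delta> t)))) \<longlongrightarrow> - Im (\<i> * of_real (\<theta>' j t))) (at_right 0)"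
    by (intro tendsto_intros radial_limit_log_derivative j t)
  then have lim: "(y' \<longlongrightarrow> - \<theta>' j t) (at_right 0)" by (simp add: y'_def[abs_def])
  \<comment> \<open>The slope comes from \<open>normal_growth\<close> and
    \<open>ln u \<le> u - 1\<close>: \<open>n\<close> times \<open>y x\<close> is at most
    \<open>- x / d\<close>.\<close>
  have "- \<theta>' j t \<le> - (1 / (n * d))"
  proof (rule derivative_limit_le[OF e(1) c y0 dy lim])
    fix x assume x: "0 < x" "x < e"
    have oO: "off j x t \<in> \<Omega>" using off_in[OF j] x e e0 by simp
    have "F (off j x t) * ?E \<noteq> 0" using e0(3)[of x] x e by auto
    then have nz: "norm (f (off j x t)) > 0" and "y x = ln (norm (f (off j x t)))"
      using oO by (auto simp: y_def F_def norm_mult)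
    then have "real n * y x = ln (norm (f (off j x t)) ^ n)" by (simp add: ln_realpow)
    also have "\<dots> \<le> norm (f (off j x t)) ^ n - 1" using nz by (intro ln_le_minus_one) simp
    also have "\<dots> \<le> - (x / d)" using n(2)[of x] x e by simp
    finally show "y x \<le> - (1 / (n * d)) * x" using n(1) d_pos by (simp add: field_simps)
  qed
  then have "1 / (n * d) \<le> \<theta>' j t" by simp
  moreover have "0 < 1 / (n * d)" using n(1) d_pos by simp
  ultimately show ?thesis by linarith
qed

lemma degree_one:
  assumes j: "j \<le> M"
  shows "\<theta> (j, 2*pi) - \<theta> (j, 0) = 2 * pi"
proof -
  have ge: "\<exists>m\<ge>1. \<theta> (j, 2*pi) - \<theta> (j, 0) = 2 * pi * real_of_int m" if j: "j \<le> M" for j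
  proof -
    interpret smooth_jordan_curve "z j" by (rule curve[OF j])
    have "\<theta> (j, 0) < \<theta> (j, 2*pi)"
    proof (rule DERIV_pos_imp_increasing_open[of 0 "2*pi" "\<lambda>s. \<theta> (j, s)"])
      fix x assume x: "0 < x" "x < 2 * pi"
      have "at x within {0..2*pi} = at x" by (rule at_within_interior) (use x in auto)
      then show "\<exists>y. ((\<lambda>s. \<theta> (j, s)) has_real_derivative y) (at x) \<and> 0 < y"
        using \<theta>_deriv[OF j, of x] \<theta>'_pos[OF j x] x by auto
    qed (use continuous_\<theta>[OF j] in auto)
    moreover have "exp (\<i> * of_real (\<theta> (j, 2*pi))) = exp (\<i> * of_real (\<theta> (j, 0)))"
      using F_z(1)[OF j, of 0] F_z(1)[OF j, of "2*pi"] per_g[of 0] by simp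
    then obtain m :: int where "\<i> * complex_of_real (\<theta> (j, 2*pi)) = \<i> * of_real (\<theta> (j, 0)) + of_real (2 * of_int m * pi) * \<i>"
      by (auto simp: exp_eq)
    then have "\<i> * complex_of_real (\<theta> (j, 2*pi)) = \<i> * of_real (\<theta> (j, 0) + 2 * of_int m * pi)"
      by (simp add: algebra_simps)
    then have "\<theta> (j, 2*pi) = \<theta> (j, 0) + 2 * of_int m * pi"
      by (simp only: mult_cancel_left of_real_eq_iff) simp
    ultimately have eq: "\<theta> (j, 2*pi) - \<theta> (j, 0) = 2 * pi * of_int m" and "0 < 2 * pi * real_of_int m" by simp_all
    then have "m \<ge> 1" by (simp add: zero_less_mult_iff)
    then show ?thesis using eq by blast
  qed
  have ge': "2 * pi \<le> \<theta> (k, 2*pi) - \<theta> (k, 0)" if "k \<le> M" for k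
    using ge[OF that] by auto
  have "(\<Sum>k\<le>M. (\<theta> (k, 2*pi) - \<theta> (k, 0)) - 2 * pi) = 0"
    using total_degree sum_subtractf[of "\<lambda>k. \<theta> (k, 2*pi) - \<theta> (k, 0)" "\<lambda>_. 2 * pi" "{..M}"]
    by (simp add: algebra_simps del: sum_subtractf)
  then have "\<forall>k\<in>{..M}. (\<theta> (k, 2*pi) - \<theta> (k, 0)) - 2 * pi = 0"
    by (subst (asm) sum_nonneg_eq_0_iff) (use ge' in auto)
  then show ?thesis using j by auto
qed

end

section \<open>The integral equation\<close>

context mc_boundary
begin

lemma \<theta>'_integrable:
  assumes "j \<le> M"
  shows "((\<lambda>s. \<theta>' j s) has_integral 2 * pi) {0..2*pi}"
proof -
  have "((\<lambda>s. \<theta>' j s) has_integral \<theta> (j, 2*pi) - \<theta> (j, 0)) {0..2*pi}"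
    using \<theta>_deriv[OF assms]
    by (intro fundamental_theorem_of_calculus) (auto simp: has_real_derivative_iff_has_vector_derivative)
  then show ?thesis by (simp add: degree_one[OF assms])
qed

text \<open>The kernel itself is of order \<open>1 / \<delta>\<close> near \<open>t\<close>, but its
  imaginary part has a factor \<open>Im \<zeta>\<close>, which is quadratically small. The remaining
  factor is also of second order, against a denominator of fourth order.\<close>

lemma kernel_imaginary_bound:
  assumes j: "j \<le> M" and t: "0 < t" "t < 2 * pi"
  shows "\<exists>C>0. \<exists>\<delta>1>0. \<forall>s\<in>{0..2*pi}. \<forall>\<delta>. 0 < \<delta> \<longrightarrow> \<delta> \<le> \<delta>1 \<longrightarrow> \<bar>Im (smooth_jordan_curve.\<zeta> (z j) t s / ((smooth_jordan_curve.\<zeta> (z j) t s)\<^sup>2 + (of_real \<delta>)\<^sup>2))\<bar> \<le> C"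
proof -
  interpret smooth_jordan_curve "z j" by (rule curve[OF j])
  define Z where "Z = \<zeta> t"
  interpret arc: normalized_arc 0 "2 * pi" t Z unfolding Z_def by (rule normalized_arc_\<zeta>[OF t])
  obtain c \<delta>1 where c: "c > 0" "\<delta>1 > 0" and low: "\<And>s \<delta>. s \<in> {0..2*pi} \<Longrightarrow> 0 < \<delta> \<Longrightarrow> \<delta> \<le> \<delta>1 \<Longrightarrow>
      c * ((s - t)\<^sup>2 + \<delta>\<^sup>2) \<le> norm ((Z s)\<^sup>2 + (of_real \<delta>)\<^sup>2)"
    using arc.kernel_lower by blast
  obtain C where C: "C > 0" "\<And>s. s \<in> {0..2*pi} \<Longrightarrow> norm (Z s) \<le> C * \<bar>s - t\<bar>"
    using arc.zeta_upper by blast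
  obtain B where B: "B > 0" "\<And>t \<sigma>. norm (z j (t + \<sigma>) - z j t - \<sigma> * z' j t) \<le> B * \<sigma>\<^sup>2" using taylor by blast
  define D where "D = B / norm (z' j t)"
  have D: "D > 0" using B g'_nz by (simp add: D_def)
  have im: "\<bar>Im (Z s)\<bar> \<le> D * (s - t)\<^sup>2" for s
  proof -
    have "\<bar>Im (Z s)\<bar> = \<bar>Im (Z s - of_real (s - t))\<bar>" by simp
    also have "\<dots> \<le> norm (Z s - of_real (s - t))" by (rule abs_Im_le_cmod)
    also have "Z s - of_real (s - t) = (z j (t + (s - t)) - z j t - of_real (s - t) * z' j t) / z' j t"
      using g'_nz[of t] by (simp add: Z_def \<zeta>_def diff_divide_distrib del: of_real_diff)
    also have "norm \<dots> \<le> B * (s - t)\<^sup>2 / norm (z' j t)"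
      unfolding norm_divide by (rule divide_right_mono[OF B(2)]) simp
    finally show ?thesis by (simp add: D_def)
  qed
  have "\<bar>Im (Z s / ((Z s)\<^sup>2 + (of_real \<delta>)\<^sup>2))\<bar> \<le> D * (1 + C\<^sup>2) / c\<^sup>2"
    if s: "s \<in> {0..2*pi}" and \<delta>: "0 < \<delta>" "\<delta> \<le> \<delta>1" for s \<delta>
  proof -
    let ?q = "(s - t)\<^sup>2 + \<delta>\<^sup>2" and ?n = "(Z s)\<^sup>2 + (complex_of_real \<delta>)\<^sup>2"
    have q: "?q > 0" using \<delta> by (simp add: add_nonneg_pos)
    \<comment> \<open>Multiplying by the conjugate denominator isolates the factor
      \<open>Im (Z s)\<close>, because \<open>(Z s) * cnj ((Z s)^2)\<close> is a real multiple of
      \<open>cnj (Z s)\<close>.\<close>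
    have "Im (Z s * cnj ?n) = Im (Z s) * (\<delta>\<^sup>2 - (norm (Z s))\<^sup>2)"
      unfolding cmod_power2 by (simp add: power2_eq_square algebra_simps)
    then have "\<bar>Im (Z s / ?n)\<bar> = \<bar>Im (Z s)\<bar> * \<bar>\<delta>\<^sup>2 - (norm (Z s))\<^sup>2\<bar> / (norm ?n)\<^sup>2"
      by (subst complex_div_cnj) (simp add: abs_mult flip: of_real_power)
    also have "\<dots> \<le> (D * ?q) * ((1 + C\<^sup>2) * ?q) / (c * ?q)\<^sup>2"
    proof (rule frac_le)
      have "(norm (Z s))\<^sup>2 \<le> (C * \<bar>s - t\<bar>)\<^sup>2" using C(2)[OF s] by (intro power_mono) auto
      then have "(norm (Z s))\<^sup>2 \<le> C\<^sup>2 * (s - t)\<^sup>2" by (simp add: power_mult_distrib)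
      then have "\<bar>\<delta>\<^sup>2 - (norm (Z s))\<^sup>2\<bar> \<le> \<delta>\<^sup>2 + C\<^sup>2 * (s - t)\<^sup>2"
        using zero_le_power2[of \<delta>] zero_le_power2[of "norm (Z s)"] by linarith
      also have "\<dots> \<le> \<delta>\<^sup>2 + C\<^sup>2 * (s - t)\<^sup>2 + ((s - t)\<^sup>2 + C\<^sup>2 * \<delta>\<^sup>2)" by simp
      also have "\<dots> = (1 + C\<^sup>2) * ?q" by (simp add: algebra_simps)
      finally have 1: "\<bar>\<delta>\<^sup>2 - (norm (Z s))\<^sup>2\<bar> \<le> (1 + C\<^sup>2) * ?q" .
      have "D * (s - t)\<^sup>2 \<le> D * ?q" using D by simp
      then have 2: "\<bar>Im (Z s)\<bar> \<le> D * ?q" using im[of s] by linarith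
      show "\<bar>Im (Z s)\<bar> * \<bar>\<delta>\<^sup>2 - (norm (Z s))\<^sup>2\<bar> \<le> (D * ?q) * ((1 + C\<^sup>2) * ?q)"
        by (rule mult_mono[OF 2 1]) (use D q in auto)
      show "0 \<le> (D * ?q) * ((1 + C\<^sup>2) * ?q)" using D q by simp
      show "0 < (c * ?q)\<^sup>2" by (rule zero_less_power[OF mult_pos_pos[OF c(1) q]])
      show "(c * ?q)\<^sup>2 \<le> (norm ?n)\<^sup>2" using low[OF s \<delta>] c q by (intro power_mono) auto
    qed
    also have "\<dots> = D * (1 + C\<^sup>2) / c\<^sup>2"
    proof -
      have "(D * X) * ((1 + C\<^sup>2) * X) / (c * X)\<^sup>2 = D * (1 + C\<^sup>2) / c\<^sup>2" if "X > 0" for X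
        using that by (simp add: power2_eq_square)
      from this[OF q] show ?thesis .
    qed
    finally show ?thesis .
  qed
  moreover have "D * (1 + C\<^sup>2) / c\<^sup>2 > 0" using D c by (simp add: add_pos_nonneg)
  ultimately show ?thesis using c(2) unfolding Z_def by blast
qed

lemma Nstar_eq: "(j, t) \<noteq> (k, s) \<Longrightarrow> Nstar z (j, t) (k, s) = 1 / pi * Im (z' j t / (z j t - z k s))"
proof -
  assume "(j, t) \<noteq> (k, s)"
  then show ?thesis by (simp only: Nstar_def zJ_def zJ'_def if_False fst_conv snd_conv)
qed

lemma Nstar_integral_other:
  assumes j: "j \<le> M" and k: "k \<le> M" "k \<noteq> j"
  shows "((\<lambda>s. Nstar z (j, t) (k, s) * \<theta>' k s) has_integral - 1 / pi * Im (z' j t * CT k (z j t))) {0..2*pi}"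
proof -
  have "z j t \<notin> range (z k)" using disjoint_curves[OF j k(1)] k(2) by blast
  then have "((\<lambda>s. of_real (\<theta>' k s) / (z k s - z j t)) has_integral CT k (z j t)) {0..2*pi}"
    unfolding CT_def by (intro integrable_integral CT_integrable k)
  from has_integral_mult_right[OF this, of "- 1 / pi * z' j t"]
  have "((\<lambda>s. Im (- 1 / pi * z' j t * (of_real (\<theta>' k s) / (z k s - z j t)))) has_integral Im (- 1 / pi * z' j t * CT k (z j t))) {0..2*pi}"
    by (rule has_integral_Im)
  moreover have "Im (- 1 / pi * z' j t * (of_real (\<theta>' k s) / (z k s - z j t))) = Nstar z (j, t) (k, s) * \<theta>' k s" for s
  proof -
    have "- 1 / pi * z' j t * (of_real (\<theta>' k s) / (z k s - z j t)) = of_real (1 / pi * \<theta>' k s) * (- (z' j t / (z k s - z j t)))"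
      by simp
    also have "- (z' j t / (z k s - z j t)) = z' j t / (z j t - z k s)"
      by (metis divide_minus_right minus_diff_eq)
    finally have E: "- 1 / pi * z' j t * (of_real (\<theta>' k s) / (z k s - z j t)) = of_real (1 / pi * \<theta>' k s) * (z' j t / (z j t - z k s))" .
    have "Im (of_real x * y) = x * Im y" for x y by simp
    then have "Im (- 1 / pi * z' j t * (of_real (\<theta>' k s) / (z k s - z j t))) = 1 / pi * \<theta>' k s * Im (z' j t / (z j t - z k s))"
      by (simp only: E)
    moreover have "Nstar z (j, t) (k, s) = 1 / pi * Im (z' j t / (z j t - z k s))" using k(2) by (intro Nstar_eq) auto
    ultimately show ?thesis by (simp only: ac_simps)
  qed
  moreover have "Im (- 1 / pi * z' j t * CT k (z j t)) = - 1 / pi * Im (z' j t * CT k (z j t))"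
    by simp
  ultimately show ?thesis by simp
qed

lemma interior_equation:
  assumes j: "j \<le> M" and t: "0 < t" "t < 2 * pi"
  shows "(\<lambda>s. Nstar z (j, t) (j, s) * \<theta>' j s) integrable_on {0..2*pi}"
    and "\<theta>' j t + (\<Sum>k\<le>M. integral {0..2*pi} (\<lambda>s. Nstar z (j, t) (k, s) * \<theta>' k s)) = phi M z a (j, t)"
proof -
  interpret smooth_jordan_curve "z j" by (rule curve[OF j])
  interpret arc: normalized_arc 0 "2 * pi" t "\<zeta> t" by (rule normalized_arc_\<zeta>[OF t])
  let ?v = "z' j t" and ?p = "z j t" and ?S = "{0<..<2*pi}"
  have v: "?v \<noteq> 0" by (rule g'_nz)
  define g where "g \<delta> s = Im (\<zeta> t s / ((\<zeta> t s)\<^sup>2 + (of_real \<delta>)\<^sup>2)) * \<theta>' j s" for \<delta> :: real and s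
  define g0 where "g0 s = Im (1 / \<zeta> t s) * \<theta>' j s" for s
  obtain C \<delta>1 where C: "C > 0" "\<delta>1 > 0" "\<And>s \<delta>. s \<in> {0..2*pi} \<Longrightarrow> 0 < \<delta> \<Longrightarrow> \<delta> \<le> \<delta>1 \<Longrightarrow>
     \<bar>Im (\<zeta> t s / ((\<zeta> t s)\<^sup>2 + (of_real \<delta>)\<^sup>2))\<bar> \<le> C"
    using kernel_imaginary_bound[OF j t] by blast
  obtain d1 where d1: "d1 > 0" "\<And>\<delta>. 0 < \<delta> \<Longrightarrow> \<delta> < d1 \<Longrightarrow> 0 < \<delta> \<and> \<delta> \<le> d \<and> off j \<delta> t \<notin> A"
    using normal_points_eventually[OF j, of t] unfolding eventually_at_right_field by auto
  define e where "e = min \<delta>1 (d1 / 2)"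
  have e: "e > 0" "e \<le> \<delta>1" "e < d1" using C(2) d1(1) by (auto simp: e_def)
  have g_int: "(g \<delta> has_integral 1/2 * Im (?v * (CT j (off j \<delta> t) + CT j (off j (- \<delta>) t)))) {0..2*pi}"
    if \<delta>: "0 < \<delta> \<and> \<delta> \<le> d \<and> off j \<delta> t \<notin> A" for \<delta>
  proof -
    have nf: "off j \<delta> t \<notin> range (z j)" "off j (- \<delta>) t \<notin> range (z j)"
      using two_sided_transforms(3,4)[OF j \<delta>] off_curve_range[OF j] by auto
    have "((\<lambda>s. of_real (\<theta>' j s) / (z j s - off j \<delta> t) + of_real (\<theta>' j s) / (z j s - off j (- \<delta>) t))
       has_integral CT j (off j \<delta> t) + CT j (off j (- \<delta>) t)) {0..2*pi}"
      unfolding CT_def by (intro has_integral_add integrable_integral CT_integrable j nf)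
    from has_integral_Im[OF has_integral_mult_right[OF this, of "?v"]]
    have "((\<lambda>s. 1/2 * Im (?v * (of_real (\<theta>' j s) / (z j s - off j \<delta> t) + of_real (\<theta>' j s) / (z j s - off j (- \<delta>) t))))
       has_integral 1/2 * Im (?v * (CT j (off j \<delta> t) + CT j (off j (- \<delta>) t)))) {0..2*pi}"
      by (rule has_integral_mult_right)
    moreover have "1/2 * Im (?v * (of_real (\<theta>' j s) / (z j s - off j \<delta> t) + of_real (\<theta>' j s) / (z j s - off j (- \<delta>) t))) = g \<delta> s" for s
    proof -
      have "z j s \<noteq> off j \<delta> t" "z j s \<noteq> off j (- \<delta>) t" using nf by (metis rangeI)+
      then have k: "1 / (z j s - off j \<delta> t) + 1 / (z j s - off j (- \<delta>) t) = 2 / ?v * (\<zeta> t s / ((\<zeta> t s)\<^sup>2 + (of_real \<delta>)\<^sup>2))"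
        using two_sided_cauchy_kernel_sum[of \<delta> s t] \<delta> unfolding off_neg by (simp add: off_def)
      have "?v * (of_real (\<theta>' j s) / (z j s - off j \<delta> t) + of_real (\<theta>' j s) / (z j s - off j (- \<delta>) t))
        = of_real (\<theta>' j s) * (?v * (1 / (z j s - off j \<delta> t) + 1 / (z j s - off j (- \<delta>) t)))"
      proof -
        have "V * (r / x + r / y) = r * (V * (1 / x + 1 / y))" for V r x y :: complex by (simp add: algebra_simps)
        then show ?thesis .
      qed
      also have "\<dots> = of_real (2 * \<theta>' j s) * (\<zeta> t s / ((\<zeta> t s)\<^sup>2 + (of_real \<delta>)\<^sup>2))"
        unfolding k using v by simp
      also have "Im \<dots> = 2 * (\<theta>' j s * Im (\<zeta> t s / ((\<zeta> t s)\<^sup>2 + (of_real \<delta>)\<^sup>2)))"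
        by (simp only: times_complex.sel Re_complex_of_real Im_complex_of_real)
      finally show ?thesis by (simp add: g_def)
    qed
    ultimately show ?thesis by (simp only:)
  qed
  \<comment> \<open>The majorant \<open>C * \<theta>' j s\<close> rests on
    \<open>\<theta>'_pos\<close>, which holds at interior parameters; hence the open interval
    \<open>?S\<close>, which has the same integrals.\<close>
  have dom: "g0 integrable_on ?S \<and> (\<lambda>i. integral ?S (g (X i))) \<longlonglongrightarrow> integral ?S g0"
    if X: "\<And>i. 0 < X i" "\<And>i. X i \<le> e" "X \<longlonglongrightarrow> 0" for X
  proof -
    have "(\<lambda>s. C * \<theta>' j s) integrable_on ?S"
      unfolding integrable_on_open_interval_real
      using has_integral_mult_right[OF \<theta>'_integrable[OF j], of C] by (auto simp: integrable_on_def)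
    moreover have "g (X i) integrable_on ?S" for i
      unfolding integrable_on_open_interval_real
      using g_int[OF d1(2)[of "X i"]] X(1,2)[of i] e by (auto simp: integrable_on_def)
    moreover have "norm (g (X i) s) \<le> C * \<theta>' j s" if s: "s \<in> ?S" for i s
      using C(3)[of s "X i"] s X(1,2)[of i] e \<theta>'_pos[OF j, of s] by (auto simp: g_def abs_mult intro!: mult_right_mono)
    moreover have "(\<lambda>i. g (X i) s) \<longlonglongrightarrow> g0 s" if s: "s \<in> ?S" for s
    proof (cases "\<zeta> t s = 0")
      \<comment> \<open>This happens only at \<open>s = t\<close>; there \<open>g0\<close> is 0 as
        well, because \<open>1 / 0 = 0\<close>.\<close>
      case True then show ?thesis by (simp add: g_def g0_def)
    next
      case False
      have "(\<lambda>i. Im (\<zeta> t s / ((\<zeta> t s)\<^sup>2 + (of_real (X i))\<^sup>2)) * \<theta>' j s) \<longlonglongrightarrow> Im (\<zeta> t s / ((\<zeta> t s)\<^sup>2 + (of_real 0)\<^sup>2)) * \<theta>' j s"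
        using False by (intro tendsto_intros X(3)) auto
      moreover have "\<zeta> t s / ((\<zeta> t s)\<^sup>2 + (of_real 0)\<^sup>2) = 1 / \<zeta> t s" using False by (simp add: power2_eq_square)
      ultimately show ?thesis by (simp add: g_def g0_def)
    qed
    ultimately show ?thesis
      using dominated_convergence[of "\<lambda>i. g (X i)" ?S "\<lambda>s. C * \<theta>' j s" g0] by blast
  qed
  have gN: "g0 s = - pi * (Nstar z (j, t) (j, s) * \<theta>' j s)" if "s \<noteq> t" for s
  proof -
    have "1 / \<zeta> t s = - (?v / (?p - z j s))"
      unfolding \<zeta>_def by (metis divide_divide_eq_right div_by_1 divide_minus_right minus_diff_eq mult_1 times_divide_eq_left)
    then show ?thesis using that by (simp add: g0_def Nstar_eq)
  qed
  have "(\<lambda>i. e / real (Suc i)) \<longlonglongrightarrow> 0" by (rule LIMSEQ_Suc[OF lim_const_over_n])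
  moreover have "e / real (Suc i) \<le> e" for i using e by (simp add: divide_le_eq)
  ultimately have g0i: "g0 integrable_on {0..2*pi}"
    using dom[of "\<lambda>i. e / real (Suc i)"] e by (simp add: integrable_on_open_interval_real)
  have "((\<lambda>s. - 1 / pi * g0 s) has_integral - 1 / pi * integral {0..2*pi} g0) {0..2*pi}"
    by (intro has_integral_mult_right integrable_integral g0i)
  \<comment> \<open>The diagonal value of \<open>Nstar\<close> disagrees with \<open>g0\<close> only
    at the single point \<open>t\<close>.\<close>
  then have N: "((\<lambda>s. Nstar z (j, t) (j, s) * \<theta>' j s) has_integral - 1 / pi * integral {0..2*pi} g0) {0..2*pi}"
    by (rule has_integral_spike_finite[of "{t}", rotated 2]) (use gN in auto)
  then show "(\<lambda>s. Nstar z (j, t) (j, s) * \<theta>' j s) integrable_on {0..2*pi}" by (auto simp: integrable_on_def)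
  have lim_g: "((\<lambda>\<delta>. integral {0..2*pi} (g \<delta>)) \<longlongrightarrow> integral {0..2*pi} g0) (at_right 0)"
    unfolding integral_open_interval_real
    by (rule tendsto_at_right_sequentiallyI[OF e(1)]) (use dom in blast)
  define P where "P = (\<Sum>k\<le>M. 1 / (?p - a k))"
  \<comment> \<open>The sum of the two identities, solved for the imaginary part of
    \<open>z' j t\<close> times the logarithmic derivative. The pole sums from both sides add up,
    whence the factor 2 in \<open>phi\<close>.\<close>
  define R where "R \<delta> = Im (?v * ((\<Sum>k\<le>M. 1 / (off j \<delta> t - a k)) + (\<Sum>k\<le>M. 1 / (off j (- \<delta>) t - a k))))
      + 1 / (2 * pi) * (2 * integral {0..2*pi} (g \<delta>) + Im (?v * (\<Sum>k\<in>{..M} - {j}. CT k (off j \<delta> t) + CT k (off j (- \<delta>) t))))" for \<delta>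
  have lim: "(R \<longlongrightarrow> Im (?v * (P + P)) + 1 / (2 * pi) * (2 * integral {0..2*pi} g0
      + Im (?v * (\<Sum>k\<in>{..M} - {j}. CT k ?p + CT k ?p)))) (at_right 0)"
    unfolding R_def P_def by (intro tendsto_intros poles_tendsto j lim_g CT_other_tendsto)
  have ev: "\<forall>\<^sub>F \<delta> in at_right 0. R \<delta> = Im (?v * (deriv f (off j \<delta> t) / f (off j \<delta> t)))"
    using normal_points_eventually[OF j, of t]
  proof eventually_elim
    case (elim \<delta>)
    note ts = two_sided_transforms(1,2)[OF j elim]
    let ?D = "deriv f (off j \<delta> t) / f (off j \<delta> t)"
    let ?Q = "(\<Sum>k\<le>M. 1 / (off j \<delta> t - a k)) + (\<Sum>k\<le>M. 1 / (off j (- \<delta>) t - a k))"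
    have "2 * integral {0..2*pi} (g \<delta>) + Im (?v * (\<Sum>k\<in>{..M} - {j}. CT k (off j \<delta> t) + CT k (off j (- \<delta>) t)))
       = Im (?v * (\<Sum>k\<le>M. CT k (off j \<delta> t) + CT k (off j (- \<delta>) t)))"
      using j by (simp add: sum.remove[of "{..M}" j] integral_unique[OF g_int[OF elim]] distrib_left)
    also have "(\<Sum>k\<le>M. CT k (off j \<delta> t) + CT k (off j (- \<delta>) t)) = of_real (2 * pi) * (?D - ?Q)"
      unfolding sum.distrib ts by (simp add: algebra_simps)
    also have "?v * (of_real (2 * pi) * (?D - ?Q)) = of_real (2 * pi) * (?v * (?D - ?Q))" by simp
    also have "Im (of_real (2 * pi) * (?v * (?D - ?Q))) = 2 * pi * (Im (?v * ?D) - Im (?v * ?Q))"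
      by (simp only: times_complex.sel Re_complex_of_real Im_complex_of_real minus_complex.sel) (simp add: algebra_simps)
    finally have "R \<delta> = Im (?v * ?Q) + 1 / (2 * pi) * (2 * pi * (Im (?v * ?D) - Im (?v * ?Q)))"
      by (simp only: R_def)
    then show ?case by simp
  qed
  have "((\<lambda>\<delta>. Im (?v * (deriv f (off j \<delta> t) / f (off j \<delta> t)))) \<longlongrightarrow> Im (\<i> * of_real (\<theta>' j t))) (at_right 0)"
    by (intro tendsto_intros radial_limit_log_derivative j t)
  moreover note Lim_transform_eventually[OF lim ev]
  ultimately have E: "Im (\<i> * of_real (\<theta>' j t)) = Im (?v * (P + P)) + 1 / (2 * pi) * (2 * integral {0..2*pi} g0
      + Im (?v * (\<Sum>k\<in>{..M} - {j}. CT k ?p + CT k ?p)))"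
    using tendsto_unique[OF trivial_limit_at_right_real] by blast
  have S: "Im (?v * (\<Sum>k\<in>{..M} - {j}. CT k ?p + CT k ?p)) = 2 * (\<Sum>k\<in>{..M} - {j}. Im (?v * CT k ?p))"
    by (simp add: sum_distrib_left Im_sum algebra_simps)
  have "1 / (2 * pi) * (2 * X + 2 * Y) = 1 / pi * (X + Y)" for X Y :: real
    by (simp add: field_simps)
  moreover have "Im (?v * (P + P)) = 2 * Im (?v * P)" by (simp add: distrib_left)
  ultimately have eq: "\<theta>' j t = 2 * Im (?v * P) + 1 / pi * (integral {0..2*pi} g0 + (\<Sum>k\<in>{..M} - {j}. Im (?v * CT k ?p)))"
    using E by (simp only: S) simp
  have "(\<Sum>k\<le>M. integral {0..2*pi} (\<lambda>s. Nstar z (j, t) (k, s) * \<theta>' k s))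
     = integral {0..2*pi} (\<lambda>s. Nstar z (j, t) (j, s) * \<theta>' j s) + (\<Sum>k\<in>{..M} - {j}. integral {0..2*pi} (\<lambda>s. Nstar z (j, t) (k, s) * \<theta>' k s))"
    using j by (simp add: sum.remove)
  also have "\<dots> = - 1 / pi * integral {0..2*pi} g0 + (\<Sum>k\<in>{..M} - {j}. - 1 / pi * Im (?v * CT k ?p))"
    using integral_unique[OF N] integral_unique[OF Nstar_integral_other[OF j]] by (intro arg_cong2[where f="(+)"] sum.cong) auto
  also have "\<dots> = - (1 / pi * (integral {0..2*pi} g0 + (\<Sum>k\<in>{..M} - {j}. Im (?v * CT k ?p))))"
    unfolding sum_distrib_left[symmetric] by (simp only: distrib_left minus_divide_left[symmetric] mult_minus_left minus_add_distrib)
  moreover have "phi M z a (j, t) = 2 * Im (?v * P)"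
    by (simp add: phi_def zJ_def zJ'_def P_def sum_distrib_left atLeast0AtMost)
  ultimately show "\<theta>' j t + (\<Sum>k\<le>M. integral {0..2*pi} (\<lambda>s. Nstar z (j, t) (k, s) * \<theta>' k s)) = phi M z a (j, t)"
    using eq by simp
qed

text \<open>With \<open>w\<close> the normalized chord, the imaginary part of \<open>1 / w\<close>
  is \<open>- Im w / (norm w)^2\<close>. By \<open>normalized_bounds\<close> numerator and
  denominator are both of second order, uniformly in \<open>t\<close>.\<close>

lemma Nstar_bound:
  assumes j: "j \<le> M"
  shows "\<exists>C>0. \<forall>t s. s \<noteq> t \<longrightarrow> \<bar>Nstar z (j, t) (j, s)\<bar> \<le> C"
proof -
  interpret smooth_jordan_curve "z j" by (rule curve[OF j])
  obtain c B where c: "c > 0" and B: "B > 0" and bd: "\<And>t \<sigma>. \<bar>\<sigma>\<bar> \<le> pi \<Longrightarrow> c * \<bar>\<sigma>\<bar> \<le> norm ((z j (t + \<sigma>) - z j t) / z' j t)"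
    "\<And>t \<sigma>. \<bar>\<sigma>\<bar> \<le> pi \<Longrightarrow> \<bar>Im ((z j (t + \<sigma>) - z j t) / z' j t)\<bar> \<le> B * \<sigma>\<^sup>2"
    using normalized_bounds by blast
  have "\<bar>Nstar z (j, t) (j, s)\<bar> \<le> 1 / pi * (B / c\<^sup>2)" if "s \<noteq> t" for s t
  proof -
    obtain \<sigma> where \<sigma>: "\<bar>\<sigma>\<bar> \<le> pi" "z j s = z j (t + \<sigma>)" using representative by blast
    define w where "w = (z j (t + \<sigma>) - z j t) / z' j t"
    have N: "Nstar z (j, t) (j, s) = - 1 / pi * Im (1 / w)"
    proof -
      have "z' j t / (z j t - z j s) = - (1 / w)"
        unfolding w_def \<sigma>(2) by (metis divide_divide_eq_right div_by_1 divide_minus_right minus_diff_eq mult_1 times_divide_eq_left minus_minus)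
      then show ?thesis using that by (simp add: Nstar_eq)
    qed
    have "\<bar>Im (1 / w)\<bar> \<le> B / c\<^sup>2"
    proof (cases "\<sigma> = 0")
      \<comment> \<open>Here \<open>s\<close> and \<open>t\<close> are different parameters of the
        same point, for example the two ends of the interval, and the kernel is
        \<open>1 / 0 = 0\<close>.\<close>
      case True then show ?thesis using B by (simp add: w_def)
    next
      case False
      have "(c * \<bar>\<sigma>\<bar>)\<^sup>2 \<le> (norm w)\<^sup>2" using bd(1)[OF \<sigma>(1)] c by (intro power_mono) (auto simp: w_def)
      then have l: "c\<^sup>2 * \<sigma>\<^sup>2 \<le> (norm w)\<^sup>2" by (simp add: power_mult_distrib)
      have "\<bar>Im (1 / w)\<bar> = \<bar>Im w\<bar> / (norm w)\<^sup>2" by (simp add: Im_divide cmod_power2)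
      also have "\<dots> \<le> (B * \<sigma>\<^sup>2) / (c\<^sup>2 * \<sigma>\<^sup>2)"
        using bd(2)[OF \<sigma>(1), of t] l B c False by (intro frac_le) (auto simp: w_def)
      also have "\<dots> = B / c\<^sup>2" using False by simp
      finally show ?thesis .
    qed
    then have "1 / pi * \<bar>Im (1 / w)\<bar> \<le> 1 / pi * (B / c\<^sup>2)" by (intro mult_left_mono) auto
    then show ?thesis unfolding N by (simp add: abs_mult)
  qed
  moreover have "1 / pi * (B / c\<^sup>2) > 0" using B c by simp
  ultimately show ?thesis by blast
qed

lemma Nstar_tendsto:
  assumes j: "j \<le> M" and k: "k \<le> M" and X: "X \<longlonglongrightarrow> t" and ne: "z k s \<noteq> z j t"
  shows "(\<lambda>i. Nstar z (j, X i) (k, s)) \<longlonglongrightarrow> Nstar z (j, t) (k, s)"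
proof -
  interpret smooth_jordan_curve "z j" by (rule curve[OF j])
  have zX: "(\<lambda>i. z j (X i)) \<longlonglongrightarrow> z j t" "(\<lambda>i. z' j (X i)) \<longlonglongrightarrow> z' j t"
    using cont_g[of UNIV] cont_g'[of UNIV] X by (auto simp: continuous_on_eq_continuous_at intro: isCont_tendsto_compose)
  have "(\<lambda>i. 1 / pi * Im (z' j (X i) / (z j (X i) - z k s))) \<longlonglongrightarrow> 1 / pi * Im (z' j t / (z j t - z k s))"
    using ne by (intro tendsto_intros zX) auto
  moreover have "\<forall>\<^sub>F i in sequentially. z j (X i) \<noteq> z k s"
    by (rule tendsto_imp_eventually_ne[OF zX(1)]) (use ne in auto)
  then have "\<forall>\<^sub>F i in sequentially. 1 / pi * Im (z' j (X i) / (z j (X i) - z k s)) = Nstar z (j, X i) (k, s)"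
    by eventually_elim (subst Nstar_eq; auto)
  moreover have "1 / pi * Im (z' j t / (z j t - z k s)) = Nstar z (j, t) (k, s)"
    using ne by (subst Nstar_eq) auto
  ultimately show ?thesis using Lim_transform_eventually by simp
qed

text \<open>
  The equation passes to the end points of the parameter interval by continuity: there its right-hand side is the
  limit of \<open>\<theta>'\<close> along interior points, which by the mean value theorem equals the one-sided derivative.
\<close>

lemma endpoint_limit:
  assumes j: "j \<le> M" and e: "\<tau> = 0 \<or> \<tau> = 2 * pi" and X: "\<And>i. X i \<in> {0<..<2*pi}" "X \<longlonglongrightarrow> \<tau>"
  shows "(\<lambda>s. Nstar z (j, \<tau>) (j, s) * \<theta>' j s) integrable_on {0..2*pi}"
    and "(\<lambda>i. \<theta>' j (X i)) \<longlonglongrightarrow> phi M z a (j, \<tau>) - (\<Sum>k\<le>M. integral {0..2*pi} (\<lambda>s. Nstar z (j, \<tau>) (k, s) * \<theta>' k s))"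
proof -
  interpret smooth_jordan_curve "z j" by (rule curve[OF j])
  let ?S = "{0<..<2*pi}"
  obtain C where C: "C > 0" "\<And>t s. s \<noteq> t \<Longrightarrow> \<bar>Nstar z (j, t) (j, s)\<bar> \<le> C"
    using Nstar_bound[OF j] by blast
  \<comment> \<open>The bound \<open>C\<close> covers \<open>s \<noteq> X i\<close>, so the diagonal
    value is replaced by 0; this changes one point per integral.\<close>
  define C' where "C' i s = (if s = X i then 0 else Nstar z (j, X i) (j, s))" for i s
  have ints: "(\<lambda>s. C' i s * \<theta>' j s) integrable_on ?S" for i
  proof (rule integrable_spike_finite[of "{X i}"])
    show "(\<lambda>s. Nstar z (j, X i) (j, s) * \<theta>' j s) integrable_on ?S"
      using interior_equation(1)[OF j, of "X i"] X(1)[of i] by (simp add: integrable_on_open_interval_real)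
  qed (auto simp: C'_def)
  have Ceq: "integral ?S (\<lambda>s. C' i s * \<theta>' j s) = integral ?S (\<lambda>s. Nstar z (j, X i) (j, s) * \<theta>' j s)" for i
    by (rule integral_spike[of "{X i}"]) (auto simp: C'_def)
  have h: "(\<lambda>s. C * \<theta>' j s) integrable_on ?S"
    unfolding integrable_on_open_interval_real
    using has_integral_mult_right[OF \<theta>'_integrable[OF j], of C] by (auto simp: integrable_on_def)
  have le: "norm (C' i s * \<theta>' j s) \<le> C * \<theta>' j s" if "s \<in> ?S" for i s
    using C(1) C(2)[of s "X i"] \<theta>'_pos[OF j, of s] that by (auto simp: C'_def abs_mult intro!: mult_right_mono)
  have conv: "(\<lambda>i. C' i s * \<theta>' j s) \<longlonglongrightarrow> Nstar z (j, \<tau>) (j, s) * \<theta>' j s" if s: "s \<in> ?S" for s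
  proof -
    have "z j s \<noteq> z j \<tau>" using inj_mod[of s \<tau>] s e by auto
    then have "(\<lambda>i. Nstar z (j, X i) (j, s)) \<longlonglongrightarrow> Nstar z (j, \<tau>) (j, s)"
      by (rule Nstar_tendsto[OF j j X(2)])
    moreover have "s \<noteq> \<tau>" using s e by auto
    then have "\<forall>\<^sub>F i in sequentially. X i \<noteq> s" by (intro tendsto_imp_eventually_ne[OF X(2)]) auto
    then have "\<forall>\<^sub>F i in sequentially. Nstar z (j, X i) (j, s) = C' i s" by eventually_elim (auto simp: C'_def)
    ultimately have "(\<lambda>i. C' i s) \<longlonglongrightarrow> Nstar z (j, \<tau>) (j, s)" by (rule Lim_transform_eventually)
    then show ?thesis by (intro tendsto_intros)
  qed
  note dc = dominated_convergence[of "\<lambda>i s. C' i s * \<theta>' j s" ?S "\<lambda>s. C * \<theta>' j s" "\<lambda>s. Nstar z (j, \<tau>) (j, s) * \<theta>' j s", OF ints h le conv]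
  show "(\<lambda>s. Nstar z (j, \<tau>) (j, s) * \<theta>' j s) integrable_on {0..2*pi}"
    using dc(1) by (simp add: integrable_on_open_interval_real)
  have own: "(\<lambda>i. integral {0..2*pi} (\<lambda>s. Nstar z (j, X i) (j, s) * \<theta>' j s)) \<longlonglongrightarrow> integral {0..2*pi} (\<lambda>s. Nstar z (j, \<tau>) (j, s) * \<theta>' j s)"
    using dc(2) unfolding Ceq integral_open_interval_real .
  have zX: "(\<lambda>i. z j (X i)) \<longlonglongrightarrow> z j \<tau>" "(\<lambda>i. z' j (X i)) \<longlonglongrightarrow> z' j \<tau>"
    using cont_g[of UNIV] cont_g'[of UNIV] X(2) by (auto simp: continuous_on_eq_continuous_at intro: isCont_tendsto_compose)
  have other: "(\<lambda>i. integral {0..2*pi} (\<lambda>s. Nstar z (j, X i) (k, s) * \<theta>' k s)) \<longlonglongrightarrow> integral {0..2*pi} (\<lambda>s. Nstar z (j, \<tau>) (k, s) * \<theta>' k s)"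
    if k: "k \<le> M" for k
  proof (cases "k = j")
    case True then show ?thesis using own by simp
  next
    case False
    have "isCont (CT k) (z j \<tau>)" using k disjoint_curves[OF j k] False by (intro CT_continuous) auto
    from isCont_tendsto_compose[OF this zX(1)]
    have "(\<lambda>i. - 1 / pi * Im (z' j (X i) * CT k (z j (X i)))) \<longlonglongrightarrow> - 1 / pi * Im (z' j \<tau> * CT k (z j \<tau>))"
      by (intro tendsto_intros zX)
    then show ?thesis by (simp only: integral_unique[OF Nstar_integral_other[OF j k False]])
  qed
  have "(\<lambda>i. phi M z a (j, X i)) \<longlonglongrightarrow> phi M z a (j, \<tau>)"
  proof -
    have "z j \<tau> - a k \<noteq> 0" if "k \<in> {0..M}" for k
      using off_curve_range[OF j A_off_frontier, of k] that by (metis atLeastAtMost_iff eq_iff_diff_eq_0 rangeI)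
    then show ?thesis unfolding phi_def zJ_def zJ'_def fst_conv snd_conv by (intro tendsto_intros zX)
  qed
  then have "(\<lambda>i. phi M z a (j, X i) - (\<Sum>k\<le>M. integral {0..2*pi} (\<lambda>s. Nstar z (j, X i) (k, s) * \<theta>' k s)))
    \<longlonglongrightarrow> phi M z a (j, \<tau>) - (\<Sum>k\<le>M. integral {0..2*pi} (\<lambda>s. Nstar z (j, \<tau>) (k, s) * \<theta>' k s))"
    by (intro tendsto_intros other) auto
  moreover have "phi M z a (j, X i) - (\<Sum>k\<le>M. integral {0..2*pi} (\<lambda>s. Nstar z (j, X i) (k, s) * \<theta>' k s)) = \<theta>' j (X i)" for i
    using interior_equation(2)[OF j, of "X i"] X(1)[of i] by simp
  ultimately show "(\<lambda>i. \<theta>' j (X i)) \<longlonglongrightarrow> phi M z a (j, \<tau>) - (\<Sum>k\<le>M. integral {0..2*pi} (\<lambda>s. Nstar z (j, \<tau>) (k, s) * \<theta>' k s))"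
    by simp
qed

text \<open>Since \<open>\<theta>'\<close> is not known to be continuous at an end point, special
  interior points are needed: the mean value theorem realizes difference quotients at
  \<open>\<tau>\<close> as values of \<open>\<theta>'\<close>.\<close>

lemma endpoint_sequence:
  assumes j: "j \<le> M" and e: "\<tau> = 0 \<or> \<tau> = 2 * pi"
  shows "\<exists>X. (\<forall>i. X i \<in> {0<..<2*pi}) \<and> X \<longlonglongrightarrow> \<tau> \<and> (\<lambda>i. \<theta>' j (X i)) \<longlonglongrightarrow> \<theta>' j \<tau>"
proof -
  \<comment> \<open>The absolute value treats both ends at once: it gives \<open>1 / Suc i\<close>
    for \<open>\<tau> = 0\<close> and \<open>2 * pi - 1 / Suc i\<close> for
    \<open>\<tau> = 2 * pi\<close>.\<close>
  define y where "y i = \<bar>\<tau> - 1 / real (Suc i)\<bar>" for i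
  have y: "y i \<in> {0<..<2*pi}" for i
  proof -
    have "\<bar>\<tau> - u\<bar> \<in> {0<..<2*pi}" if "0 < u" "u \<le> 1" for u
      using that e pi_gt3 by auto
    then show ?thesis unfolding y_def by simp
  qed
  have "(\<lambda>i. \<bar>\<tau> - 1 / real (Suc i)\<bar>) \<longlonglongrightarrow> \<bar>\<tau> - 0\<bar>"
    by (intro tendsto_intros LIMSEQ_Suc[OF lim_const_over_n])
  then have ylim: "y \<longlonglongrightarrow> \<tau>" using e by (auto simp: y_def[abs_def])
  have "\<exists>x. x \<in> {0<..<2*pi} \<and> \<bar>x - \<tau>\<bar> \<le> \<bar>y i - \<tau>\<bar> \<and> (\<theta> (j, y i) - \<theta> (j, \<tau>)) / (y i - \<tau>) = \<theta>' j x" for i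
  proof -
    have D: "((\<lambda>s. \<theta> (j, s)) has_real_derivative \<theta>' j x) (at x)" if "0 < x" "x < 2 * pi" for x
    proof -
      have "at x within {0..2*pi} = at x" by (rule at_within_interior) (use that in auto)
      then show ?thesis using \<theta>_deriv[OF j, of x] that by auto
    qed
    have mvt: "\<exists>x. u < x \<and> x < v \<and> \<theta> (j, v) - \<theta> (j, u) = (v - u) * \<theta>' j x" if "u < v" "0 \<le> u" "v \<le> 2 * pi" for u v
    proof -
      have "\<exists>l x. u < x \<and> x < v \<and> DERIV (\<lambda>s. \<theta> (j, s)) x :> l \<and> \<theta> (j, v) - \<theta> (j, u) = (v - u) * l"
      proof (rule MVT[OF that(1)])
        show "continuous_on {u..v} (\<lambda>s. \<theta> (j, s))"
          by (rule continuous_on_subset[OF continuous_\<theta>[OF j]]) (use that in auto)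
        show "(\<lambda>s. \<theta> (j, s)) differentiable at x" if "u < x" "x < v" for x
          using D[of x] that \<open>0 \<le> u\<close> \<open>v \<le> 2 * pi\<close> by (auto simp: real_differentiable_def)
      qed
      then obtain l x where x: "u < x" "x < v" "DERIV (\<lambda>s. \<theta> (j, s)) x :> l" "\<theta> (j, v) - \<theta> (j, u) = (v - u) * l" by blast
      then have "l = \<theta>' j x" using DERIV_unique[OF x(3) D[of x]] that by auto
      then show ?thesis using x by blast
    qed
    show ?thesis
    proof (cases "\<tau> = 0")
      case True
      obtain x where "0 < x" "x < y i" "\<theta> (j, y i) - \<theta> (j, 0) = (y i - 0) * \<theta>' j x"
        using mvt[of 0 "y i"] y[of i] by auto
      then show ?thesis using True y[of i] by (intro exI[of _ x]) auto
    next
      case False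
      then have \<tau>: "\<tau> = 2 * pi" using e by simp
      obtain x where x: "y i < x" "x < 2 * pi" "\<theta> (j, 2*pi) - \<theta> (j, y i) = (2*pi - y i) * \<theta>' j x"
        using mvt[of "y i" "2*pi"] y[of i] by auto
      have "\<theta> (j, y i) - \<theta> (j, 2*pi) = (y i - 2*pi) * \<theta>' j x" using x(3) by (simp add: algebra_simps)
      then show ?thesis using \<tau> x y[of i] by (intro exI[of _ x]) auto
    qed
  qed
  then obtain X where X: "\<And>i. X i \<in> {0<..<2*pi}" "\<And>i. \<bar>X i - \<tau>\<bar> \<le> \<bar>y i - \<tau>\<bar>"
    "\<And>i. (\<theta> (j, y i) - \<theta> (j, \<tau>)) / (y i - \<tau>) = \<theta>' j (X i)" by metis
  have "(\<lambda>i. \<bar>y i - \<tau>\<bar>) \<longlonglongrightarrow> 0" using ylim by (simp add: LIM_zero tendsto_rabs_zero)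
  then have "(\<lambda>i. X i - \<tau>) \<longlonglongrightarrow> 0"
    by (rule Lim_null_comparison[rotated]) (use X(2) in auto)
  then have "X \<longlonglongrightarrow> \<tau>" by (simp add: LIM_zero_iff)
  moreover have "((\<lambda>s. (\<theta> (j, s) - \<theta> (j, \<tau>)) / (s - \<tau>)) \<longlongrightarrow> \<theta>' j \<tau>) (at \<tau> within {0..2*pi})"
    using \<theta>_deriv[OF j, of \<tau>] e by (auto simp: has_field_derivative_iff)
  then have "(\<lambda>i. (\<theta> (j, y i) - \<theta> (j, \<tau>)) / (y i - \<tau>)) \<longlonglongrightarrow> \<theta>' j \<tau>"
    unfolding tendsto_at_iff_sequentially o_def using ylim y e
    by (metis (no_types, lifting) DiffI atLeastAtMost_iff greaterThanLessThan_iff less_eq_real_def less_irrefl singletonD)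
  ultimately show ?thesis using X(1,3) by auto
qed

theorem boundary_equation:
  assumes j: "j \<le> M" and t: "t \<in> {0..2*pi}"
  shows "(\<lambda>s. Nstar z (j, t) (j, s) * \<theta>' j s) integrable_on {0..2*pi}"
    and "\<theta>' j t + (\<Sum>k\<le>M. integral {0..2*pi} (\<lambda>s. Nstar z (j, t) (k, s) * \<theta>' k s)) = phi M z a (j, t)"
proof -
  have "(\<lambda>s. Nstar z (j, t) (j, s) * \<theta>' j s) integrable_on {0..2*pi} \<and>
    \<theta>' j t + (\<Sum>k\<le>M. integral {0..2*pi} (\<lambda>s. Nstar z (j, t) (k, s) * \<theta>' k s)) = phi M z a (j, t)"
  proof (cases "t = 0 \<or> t = 2 * pi")
    case True
    obtain X where X: "\<And>i. X i \<in> {0<..<2*pi}" "X \<longlonglongrightarrow> t" "(\<lambda>i. \<theta>' j (X i)) \<longlonglongrightarrow> \<theta>' j t"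
      using endpoint_sequence[OF j True] by blast
    have "\<theta>' j t = phi M z a (j, t) - (\<Sum>k\<le>M. integral {0..2*pi} (\<lambda>s. Nstar z (j, t) (k, s) * \<theta>' k s))"
      by (rule LIMSEQ_unique[OF X(3) endpoint_limit(2)[OF j True X(1,2)]])
    then show ?thesis using endpoint_limit(1)[OF j True X(1,2)] by simp
  next
    case False
    then show ?thesis using interior_equation[OF j, of t] t by auto
  qed
  then show "(\<lambda>s. Nstar z (j, t) (j, s) * \<theta>' j s) integrable_on {0..2*pi}"
    and "\<theta>' j t + (\<Sum>k\<le>M. integral {0..2*pi} (\<lambda>s. Nstar z (j, t) (k, s) * \<theta>' k s)) = phi M z a (j, t)" by auto
qed

lemma J_op_\<theta>':
  assumes j: "j \<le> M"
  shows "J_op M (derivJ \<theta>) (j, t) = psi (j, t)"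
proof -
  have "integral {0..2*pi} (\<lambda>s. 1 / (2 * pi) * (\<Sum>i=1..M. chi i (k, s) * chi i (j, t) * \<theta>' k s))
      = (if k = j then psi (j, t) else 0)" if k: "k \<le> M" for k
  proof -
    have "(\<Sum>i=1..M. chi i (k, s) * chi i (j, t) * \<theta>' k s) = (if k = j then psi (j, t) else 0) * \<theta>' k s" for s
    proof -
      \<comment> \<open>Only the index \<open>i = j\<close> can survive, and it lies in
        \<open>1..M\<close> exactly when \<open>j\<close> is not 0; this is the case distinction in
        \<open>psi\<close>.\<close>
      have "(\<Sum>i=1..M. chi i (k, s) * chi i (j, t) * \<theta>' k s) = (\<Sum>i=1..M. if i = j then (if k = j then \<theta>' k s else 0) else 0)"
        by (rule sum.cong) (auto simp: chi_def)
      then show ?thesis using j by (auto simp: psi_def)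
    qed
    moreover have "((\<lambda>s. 1 / (2 * pi) * ((if k = j then psi (j, t) else 0) * \<theta>' k s)) has_integral
        1 / (2 * pi) * ((if k = j then psi (j, t) else 0) * (2 * pi))) {0..2*pi}"
      by (intro has_integral_mult_right \<theta>'_integrable k)
    ultimately have "((\<lambda>s. 1 / (2 * pi) * (\<Sum>i=1..M. chi i (k, s) * chi i (j, t) * \<theta>' k s)) has_integral
        1 / (2 * pi) * ((if k = j then psi (j, t) else 0) * (2 * pi))) {0..2*pi}"
      by (simp only:)
    from integral_unique[OF this] show ?thesis by simp
  qed
  then have "J_op M (derivJ \<theta>) (j, t) = (\<Sum>k\<le>M. if k = j then psi (j, t) else 0)"
    unfolding J_op_def integral_J_def by (intro sum.cong) auto
  then show ?thesis using j by simp
qed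

end

theorem mainTheorem1:
  fixes \<Omega> :: "complex set" and M :: nat and z :: "nat \<Rightarrow> real \<Rightarrow> complex"
    and f :: "complex \<Rightarrow> complex" and a :: "nat \<Rightarrow> complex" and \<theta> :: "nat \<times> real \<Rightarrow> real"
  assumes "bounded_mc_region \<Omega> M z"
    and "a 0 \<in> \<Omega>"
    and "ahlfors_map \<Omega> (a 0) f"
    and "lists_zeros \<Omega> M f a"
    and "boundary_correspondence \<Omega> M z f \<theta>"
  shows "integrable_J M (derivJ \<theta>)
    \<and> (\<forall>t\<in>J_set M. integrable_J M (\<lambda>s. Nstar z t s * derivJ \<theta> s))
    \<and> (\<forall>t\<in>J_set M. derivJ \<theta> t + integral_J M (\<lambda>s. Nstar z t s * derivJ \<theta> s) = phi M z a t)
    \<and> (\<forall>t\<in>J_set M. J_op M (derivJ \<theta>) t = psi t)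
    \<and> (\<forall>t\<in>J_set M. derivJ \<theta> t + Nstar_op M z (derivJ \<theta>) t + J_op M (derivJ \<theta>) t
          = phi M z a t + psi t)"
proof -
  interpret mc_region \<Omega> M z by standard (rule assms(1))
  obtain d where "d > 0" "\<forall>j\<le>M. \<forall>t \<rho>. \<bar>\<rho>\<bar> \<le> d \<longrightarrow>
      ball (z j t + \<i> * of_real \<rho> * z' j t) (\<bar>\<rho>\<bar> * norm (z' j t)) \<inter> frontier \<Omega> = {}"
    using touching_discs_frontier by blast
  then interpret mc_boundary \<Omega> M z d f a \<theta>
    using assms by unfold_locales (auto simp: ahlfors_map_def ahlfors_candidate_def)
  have int: "integrable_J M (derivJ \<theta>)"
    using \<theta>'_integrable by (auto simp: integrable_J_def integrable_on_def)
  have kernel_int: "integrable_J M (\<lambda>s. Nstar z t s * derivJ \<theta> s)" if t: "t \<in> J_set M" for t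
  proof -
    obtain j u where ju: "t = (j, u)" "j \<le> M" "u \<in> {0..2*pi}" using t by (auto simp: J_set_def)
    have "(\<lambda>s. Nstar z (j, u) (k, s) * \<theta>' k s) integrable_on {0..2*pi}" if "k \<le> M" for k
      using boundary_equation(1)[OF ju(2,3)] Nstar_integral_other[OF ju(2) that, of u]
      by (cases "k = j") (auto simp: integrable_on_def)
    then show ?thesis by (simp add: integrable_J_def ju(1))
  qed
  have eq: "derivJ \<theta> t + integral_J M (\<lambda>s. Nstar z t s * derivJ \<theta> s) = phi M z a t" if "t \<in> J_set M" for t
    using boundary_equation(2) that by (auto simp: J_set_def integral_J_def)
  have Jop: "J_op M (derivJ \<theta>) t = psi t" if "t \<in> J_set M" for t
    using J_op_\<theta>' that by (auto simp: J_set_def)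
  show ?thesis
    using int kernel_int eq Jop by (auto simp: Nstar_op_def)
qed

end
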